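(* As the mesh $\delta$ of the partition $\Pi$ goes to $0$, the family of values $\mathsf{V}_\Pi$ converges, uniformly on compact subsets of $\mathbb{R}^+\times\Delta(\Omega)$, to $\mathsf{V}$, the unique viscosity solution on $\mathbb{R}^+\times\Delta(\Omega)$ of $$0=\frac{d}{dt}u(t,\zeta)+\mathrm{val}_{X\times Y}\big[g(\zeta,x,y)\,k(t)+\langle\zeta*q(x,y),\nabla u(t,\zeta)\rangle\big].$$
   Context: Data. $\Omega$ is a finite set; $I,J$ are compact metric spaces; $g:\Omega\times I\times J\to\mathbb{R}$ is continuous on $I\times J$; $k:\mathbb{R}^+\to\mathbb{R}^+$ is a Lipschitz continuous probability density on $\mathbb{R}^+=[0,+\infty)$; $q$ is a bounded transition rate, continuous on $I\times J$: $q(i,j)[\omega,\omega']\ge 0$ for $\omega'\neq\omega$ and $\sum_{\omega'}q(i,j)[\omega,\omega']=0$ for all $i,j,\omega$. For $h\ge0$, $P^h(i,j)=e^{h\,q(i,j)}$. $X=\Delta(I)$ and $Y=\Delta(J)$ are the sets of regular Borel probabilities on $I,J$; $g$ and $q$ are extended bilinearly to $X\times Y$ by expectation, and $g(\zeta,x,y)=\sum_{z}\zeta(z)g(z,x,y)$ for $\zeta\in\Delta(\Omega)$ (probabilities on $\Omega$). For $\mu\in\mathbb{R}^{\Omega\times\Omega}$, $(\zeta*\mu)(z)=\sum_{\omega}\zeta(\omega)\mu[\omega,z]$. $\mathrm{val}_{X\times Y}$ denotes the value ($\sup_X\inf_Y=\inf_Y\sup_X$), Player 1 (choosing in $X$)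 maximizing. Game $\mathsf{G}_\Pi$ (state controlled and not observed). $\Pi=\{t_1=0<t_2<\dots<t_n<\dots\}$ is a partition of $\mathbb{R}^+$ (with $t_n\to\infty$), $\delta_n=t_{n+1}-t_n$, mesh $\delta=\sup_n\delta_n$. A process $Z_t$ in $\Omega$ is controlled as follows: at each time $t_n$ the players simultaneously (and possibly at random) choose actions $(i_n,j_n)\in I\times J$, kept constant on $[t_n,t_{n+1})$; on this interval $Z$ is a continuous-time Markov chain with generator $q(i_n,j_n)$ and the payoff at time $t$ is $g(Z_t,i_n,j_n)$. The players know the initial law of the state and all past actions, but do not observe the state; hence at time $t_n$ both know the law $\zeta_{t_n}\in\Delta(\Omega)$ of $Z_{t_n}$ given past actions, which evolves by $\zeta_{t_{n+1}}=\zeta_{t_n}*P^{\delta_n}(i_n,j_n)$. The total payoff is the expectation of $\int_0^{+\infty}(\text{payoff at time }t)\,k(t)\,dt$. For $t_n\in\Pi$, $\mathsf{V}_\Pi(t_n,\zeta)$ is the value of the game starting at time $t_n$ with law $\zeta$, with the payoff integrated over $[t_n,+\infty)$; $\mathsf{V}_\Pi(\cdot,\zeta)$ is extended to $\mathbb{R}^+$ by linear interpolation. Viscosity solution. A continuous real function $u$ on $\mathbb{R}^+\times\Delta(\Omega)$ is a viscosity solution of $0=\frac{d}{dt}u(t,\zeta)+H(t,\zeta,\nabla u(t,\zeta))$ if for every $\mathcal{C}^1$ real function $\psi$ on $\mathbb{R}^+\times\Delta(\Omega)$ (restriction of a $\mathcal{C}^1$ function on a neighbourhood) such that $u-\psi$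 has a strict maximum at $(\bar t,\bar\zeta)$, one has $0\le\frac{d}{dt}\psi(\bar t,\bar\zeta)+H(\bar t,\bar\zeta,\nabla\psi(\bar t,\bar\zeta))$, and the dual condition holds (strict minimum, reversed inequality). Uniqueness is understood among functions $u$ such that for every $\varepsilon>0$ there is $T$ with $|u(t,\cdot)|\le\varepsilon$ for all $t\ge T$. *)

theory Defs
  imports "HOL-Probability.Probability"
begin

section \<open>Compact metric spaces and regular Borel probabilities\<close>

class compact_metric_space = metric_space +
  assumes compact_UNIV: "compact UNIV"

instance compact_metric_space \<subseteq> polish_space
proof
  show "convergent X" if "Cauchy X" for X :: "nat \<Rightarrow> 'a"
    using compact_imp_complete[OF compact_UNIV] that
    unfolding complete_def convergent_def by blast
next
  have "\<exists>F. finite F \<and> (\<forall>x::'a. \<exists>y\<in>F. dist y x < 1 / real (Suc n))" for n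
  proof -
    have "(0::real) < 1 / real (Suc n)" by simp
    with seq_compact_imp_totally_bounded[OF compact_imp_seq_compact[OF compact_UNIV[where 'a='a]]]
    obtain F where F: "finite F" "UNIV \<subseteq> (\<Union>x\<in>F. ball x (1 / real (Suc n)) :: 'a set)"
      by blast
    have "\<exists>y\<in>F. dist y x < 1 / real (Suc n)" for x
    proof -
      have "x \<in> (\<Union>x\<in>F. ball x (1 / real (Suc n)))" using F(2) by (rule subsetD) simp
      then show ?thesis by (simp only: UN_iff mem_ball)
    qed
    with F(1) show ?thesis by blast
  qed
  then have "\<exists>F. \<forall>n. finite (F n) \<and> (\<forall>x::'a. \<exists>y\<in>F n. dist y x < 1 / real (Suc n))"
    by (intro choice allI)
  then obtain F where fin: "\<And>n. finite (F n)"
    and cov: "\<And>n (x::'a). \<exists>y\<in>F n. dist y x < 1 / real (Suc n)"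
    by blast
  let ?B = "\<Union>n. (\<lambda>x. ball x (1 / real (Suc n))) ` F n"
  have "countable ?B"
    using fin by (intro countable_UN) (auto intro: countable_finite)
  moreover have "topological_basis ?B"
  proof (rule topological_basisI)
    show "open U" if "U \<in> ?B" for U using that by auto
  next
    fix S :: "'a set" and x assume "open S" "x \<in> S"
    then obtain e where e: "e > 0" "ball x e \<subseteq> S" by (meson open_contains_ball)
    obtain n where n: "1 / real (Suc n) < e / 2"
      using reals_Archimedean[of "e / 2"] e(1) by (auto simp: inverse_eq_divide)
    obtain y where y: "y \<in> F n" "dist y x < 1 / real (Suc n)"
      using cov[of n x] by blast
    have "ball y (1 / real (Suc n)) \<subseteq> ball x e"
    proof
      fix z assume "z \<in> ball y (1 / real (Suc n))"
      then have "dist y z < e / 2" "dist y x < e / 2" using n y by auto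
      then show "z \<in> ball x e" using dist_triangle[of x z y] by (simp add: dist_commute)
    qed
    then show "\<exists>U\<in>?B. x \<in> U \<and> U \<subseteq> S"
      using y e(2) by (intro bexI[of _ "ball y (1 / real (Suc n))"] conjI) (simp, blast, blast)
  qed
  ultimately show "\<exists>B :: 'a set set. countable B \<and> open = generate_topology B"
    by (meson topological_basis_imp_subbasis)
qed

definition regular_probs :: "'a::topological_space measure set" where
  "regular_probs = {\<mu>. prob_space \<mu> \<and> sets \<mu> = sets borel \<and>
     (\<forall>B \<in> sets borel.
        emeasure \<mu> B = (SUP K \<in> {K. K \<subseteq> B \<and> compact K}. emeasure \<mu> K) \<and>
        emeasure \<mu> B = (INF U \<in> {U. B \<subseteq> U \<and> open U}. emeasure \<mu> U))}"

text \<open>Justifies using the library's kernels into \<^const>\<open>prob_algebra\<close> \<^const>\<open>borel\<close> as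
  behavioural strategies below: on a compact metric space regularity is automatic.\<close>

lemma regular_probs_eq:
  "(regular_probs :: 'a::compact_metric_space measure set) = space (prob_algebra borel)"
proof -
  have "\<mu> \<in> regular_probs \<longleftrightarrow> prob_space \<mu> \<and> sets \<mu> = sets borel" for \<mu> :: "'a measure"
  proof (cases "prob_space \<mu> \<and> sets \<mu> = sets borel")
    case True
    then interpret prob_space \<mu> by simp
    have fin: "emeasure \<mu> (space \<mu>) \<noteq> \<infinity>" by simp
    show ?thesis
      unfolding regular_probs_def mem_Collect_eq
      using True inner_regular[of \<mu>, OF _ fin] outer_regular[of \<mu>, OF _ fin]
      by blast
  next
    case False
    then show ?thesis unfolding regular_probs_def by blast
  qed
  then show ?thesis by (auto simp: space_prob_algebra)
qed


section \<open>Values of zero-sum games\<close>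

text \<open>Taking the bounds in the extended reals makes the formula meaningful for every payoff
  function; \<open>A\<close> is the choice set of the maximizer.\<close>

definition is_value :: "'a set \<Rightarrow> 'b set \<Rightarrow> ('a \<Rightarrow> 'b \<Rightarrow> real) \<Rightarrow> real \<Rightarrow> bool" where
  "is_value A B f v \<longleftrightarrow>
     (SUP a\<in>A. INF b\<in>B. ereal (f a b)) = ereal v \<and>
     (INF b\<in>B. SUP a\<in>A. ereal (f a b)) = ereal v"

definition game_value :: "'a set \<Rightarrow> 'b set \<Rightarrow> ('a \<Rightarrow> 'b \<Rightarrow> real) \<Rightarrow> real" where
  "game_value A B f = (THE v. is_value A B f v)"


section \<open>Data of the game\<close>

definition prob_vecs :: "(real ^ 'w::finite) set" where
  "prob_vecs = {\<zeta>. (\<forall>z. 0 \<le> \<zeta> $ z) \<and> (\<Sum>z\<in>UNIV. \<zeta> $ z) = 1}"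

definition transition_rate ::
    "('i::topological_space \<Rightarrow> 'j::topological_space \<Rightarrow> real ^ 'w::finite ^ 'w) \<Rightarrow> bool" where
  "transition_rate q \<longleftrightarrow>
     (\<forall>i j z z'. z' \<noteq> z \<longrightarrow> 0 \<le> q i j $ z $ z') \<and>
     (\<forall>i j z. (\<Sum>z'\<in>UNIV. q i j $ z $ z') = 0) \<and>
     bounded (range (\<lambda>(i, j). q i j)) \<and>
     continuous_on UNIV (\<lambda>(i, j). q i j)"

text \<open>The library's \<^const>\<open>exp\<close> is not available for the matrix product \<open>**\<close>.\<close>

definition matrix_exp :: "real ^ 'w::finite ^ 'w \<Rightarrow> real ^ 'w ^ 'w" where
  "matrix_exp A = (\<Sum>n. (1 / fact n) *\<^sub>R (((**) A) ^^ n) (mat 1))"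

definition trans_prob ::
    "('i \<Rightarrow> 'j \<Rightarrow> real ^ 'w::finite ^ 'w) \<Rightarrow> real \<Rightarrow> 'i \<Rightarrow> 'j \<Rightarrow> real ^ 'w ^ 'w" where
  "trans_prob q h i j = matrix_exp (h *\<^sub>R q i j)"

definition mixed_ext ::
    "('i \<Rightarrow> 'j \<Rightarrow> 'b::{banach, second_countable_topology}) \<Rightarrow> 'i measure \<Rightarrow> 'j measure \<Rightarrow> 'b" where
  "mixed_ext f x y = (\<integral>p. f (fst p) (snd p) \<partial>(x \<Otimes>\<^sub>M y))"

definition belief_payoff ::
    "('w \<Rightarrow> 'i \<Rightarrow> 'j \<Rightarrow> real) \<Rightarrow> real ^ 'w::finite \<Rightarrow> 'i measure \<Rightarrow> 'j measure \<Rightarrow> real" where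
  "belief_payoff g \<zeta> x y = (\<Sum>z\<in>UNIV. \<zeta> $ z * mixed_ext (g z) x y)"


section \<open>The Hamilton--Jacobi equation\<close>

text \<open>The product \<open>\<zeta> * \<mu>\<close> of the mathematical text is the library's \<open>\<zeta> v* \<mu>\<close>.\<close>

definition hamiltonian_payoff ::
    "('w \<Rightarrow> 'i \<Rightarrow> 'j \<Rightarrow> real) \<Rightarrow> (real \<Rightarrow> real) \<Rightarrow> ('i \<Rightarrow> 'j \<Rightarrow> real ^ 'w::finite ^ 'w) \<Rightarrow>
     real \<Rightarrow> real ^ 'w \<Rightarrow> real ^ 'w \<Rightarrow> 'i measure \<Rightarrow> 'j measure \<Rightarrow> real" where
  "hamiltonian_payoff g k q t \<zeta> p x y =
     belief_payoff g \<zeta> x y * k t + inner (\<zeta> v* mixed_ext q x y) p"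

definition hamiltonian ::
    "('w \<Rightarrow> 'i::topological_space \<Rightarrow> 'j::topological_space \<Rightarrow> real) \<Rightarrow> (real \<Rightarrow> real) \<Rightarrow>
     ('i \<Rightarrow> 'j \<Rightarrow> real ^ 'w::finite ^ 'w) \<Rightarrow> real \<Rightarrow> real ^ 'w \<Rightarrow> real ^ 'w \<Rightarrow> real" where
  "hamiltonian g k q t \<zeta> p =
     game_value regular_probs regular_probs (hamiltonian_payoff g k q t \<zeta> p)"

definition time_beliefs :: "(real \<times> (real ^ 'w::finite)) set" where
  "time_beliefs = {0..} \<times> prob_vecs"

text \<open>\<open>G\<close> is the gradient in \<open>(t, \<zeta>)\<close>: its first component is the time derivative, its second
  component is \<open>\<nabla>\<psi>\<close>.\<close>

definition C1_test_function ::
    "(real \<times> (real ^ 'w::finite) \<Rightarrow> real) \<Rightarrow> (real \<times> (real ^ 'w) \<Rightarrow> real \<times> (real ^ 'w)) \<Rightarrow> bool" where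
  "C1_test_function \<psi> G \<longleftrightarrow>
     (\<exists>U. open U \<and> time_beliefs \<subseteq> U \<and> (\<forall>p\<in>U. GDERIV \<psi> p :> G p) \<and> continuous_on U G)"

definition strict_max_on :: "'a set \<Rightarrow> ('a \<Rightarrow> real) \<Rightarrow> 'a \<Rightarrow> bool" where
  "strict_max_on S f p \<longleftrightarrow> p \<in> S \<and> (\<forall>r\<in>S. r \<noteq> p \<longrightarrow> f r < f p)"

definition strict_min_on :: "'a set \<Rightarrow> ('a \<Rightarrow> real) \<Rightarrow> 'a \<Rightarrow> bool" where
  "strict_min_on S f p \<longleftrightarrow> p \<in> S \<and> (\<forall>r\<in>S. r \<noteq> p \<longrightarrow> f p < f r)"

definition viscosity_solution ::
    "(real \<Rightarrow> real ^ 'w::finite \<Rightarrow> real ^ 'w \<Rightarrow> real) \<Rightarrow> (real \<times> (real ^ 'w) \<Rightarrow> real) \<Rightarrow> bool" where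
  "viscosity_solution H u \<longleftrightarrow>
     continuous_on time_beliefs u \<and>
     (\<forall>\<psi> G t \<zeta>. C1_test_function \<psi> G \<longrightarrow>
        strict_max_on time_beliefs (\<lambda>p. u p - \<psi> p) (t, \<zeta>) \<longrightarrow>
        0 \<le> fst (G (t, \<zeta>)) + H t \<zeta> (snd (G (t, \<zeta>)))) \<and>
     (\<forall>\<psi> G t \<zeta>. C1_test_function \<psi> G \<longrightarrow>
        strict_min_on time_beliefs (\<lambda>p. u p - \<psi> p) (t, \<zeta>) \<longrightarrow>
        0 \<ge> fst (G (t, \<zeta>)) + H t \<zeta> (snd (G (t, \<zeta>))))"

definition vanishes_at_infinity :: "(real \<times> (real ^ 'w::finite) \<Rightarrow> real) \<Rightarrow> bool" where
  "vanishes_at_infinity u \<longleftrightarrow>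
     (\<forall>\<epsilon>>0. \<exists>T\<ge>0. \<forall>t\<ge>T. \<forall>\<zeta>\<in>prob_vecs. \<bar>u (t, \<zeta>)\<bar> \<le> \<epsilon>)"


section \<open>The game with controlled and unobserved state\<close>

definition time_partition :: "(nat \<Rightarrow> real) \<Rightarrow> bool" where
  "time_partition \<pi> \<longleftrightarrow> \<pi> 0 = 0 \<and> strict_mono \<pi> \<and> filterlim \<pi> at_top sequentially"

definition mesh :: "(nat \<Rightarrow> real) \<Rightarrow> ereal" where
  "mesh \<pi> = (SUP n. ereal (\<pi> (Suc n) - \<pi> n))"

definition vanishing_mesh :: "(nat \<Rightarrow> real) filter" where
  "vanishing_mesh = inf (filtercomap mesh (nhds 0)) (principal {\<pi>. time_partition \<pi>})"

definition stage :: "(nat \<Rightarrow> real) \<Rightarrow> real \<Rightarrow> nat" where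
  "stage s t = (GREATEST n. s n \<le> t)"

text \<open>Behavioural strategies. Before stage \<open>n\<close> a player knows the action pairs of the stages
  \<open>0, \<dots>, n - 1\<close>, but not the states.\<close>

definition strategies ::
    "(nat \<Rightarrow> (nat \<Rightarrow> 'i::topological_space \<times> 'j::topological_space) \<Rightarrow>
      'a::topological_space measure) set" where
  "strategies = {\<sigma>. \<forall>n. \<sigma> n \<in> (\<Pi>\<^sub>M l\<in>{0..<n}. borel \<Otimes>\<^sub>M borel) \<rightarrow>\<^sub>M prob_algebra borel}"

text \<open>In the following, \<open>s\<close> is the sequence of decision times of the (sub)game, which starts at time
  \<open>s 0\<close> with initial law \<open>\<zeta>\<close>. A play \<open>h\<close> records, for every stage \<open>n\<close>, the triple \<open>(z, i, j)\<close> of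
  the state \<open>Z\<close> at time \<open>s n\<close> and the actions chosen then.\<close>

definition stage_space ::
    "('w \<times> 'i::topological_space \<times> 'j::topological_space) measure" where
  "stage_space = count_space UNIV \<Otimes>\<^sub>M (borel \<Otimes>\<^sub>M borel)"

definition state_law :: "real ^ 'w::finite \<Rightarrow> 'w measure" where
  "state_law p = density (count_space UNIV) (\<lambda>z. ennreal (p $ z))"

definition next_state_probs ::
    "('i \<Rightarrow> 'j \<Rightarrow> real ^ 'w::finite ^ 'w) \<Rightarrow> (nat \<Rightarrow> real) \<Rightarrow> real ^ 'w \<Rightarrow>
     nat \<Rightarrow> (nat \<Rightarrow> 'w \<times> 'i \<times> 'j) \<Rightarrow> real ^ 'w" where
  "next_state_probs q s \<zeta> n h =
     (case n of 0 \<Rightarrow> \<zeta>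
      | Suc m \<Rightarrow> (case h m of (z, i, j) \<Rightarrow> trans_prob q (s (Suc m) - s m) i j $ z))"

definition stage_kernel ::
    "('i::topological_space \<Rightarrow> 'j::topological_space \<Rightarrow> real ^ 'w::finite ^ 'w) \<Rightarrow>
     (nat \<Rightarrow> real) \<Rightarrow> real ^ 'w \<Rightarrow>
     (nat \<Rightarrow> (nat \<Rightarrow> 'i \<times> 'j) \<Rightarrow> 'i measure) \<Rightarrow> (nat \<Rightarrow> (nat \<Rightarrow> 'i \<times> 'j) \<Rightarrow> 'j measure) \<Rightarrow>
     nat \<Rightarrow> (nat \<Rightarrow> 'w \<times> 'i \<times> 'j) \<Rightarrow> ('w \<times> 'i \<times> 'j) measure" where
  "stage_kernel q s \<zeta> \<sigma> \<tau> n h =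
     (let a = (\<lambda>l\<in>{0..<n}. snd (h l))
      in state_law (next_state_probs q s \<zeta> n h) \<Otimes>\<^sub>M (\<sigma> n a \<Otimes>\<^sub>M \<tau> n a))"

text \<open>The law of the infinite play: the Ionescu-Tulcea measure of the stage kernels.\<close>

definition play_law ::
    "('i::topological_space \<Rightarrow> 'j::topological_space \<Rightarrow> real ^ 'w::finite ^ 'w) \<Rightarrow>
     (nat \<Rightarrow> real) \<Rightarrow> real ^ 'w \<Rightarrow>
     (nat \<Rightarrow> (nat \<Rightarrow> 'i \<times> 'j) \<Rightarrow> 'i measure) \<Rightarrow> (nat \<Rightarrow> (nat \<Rightarrow> 'i \<times> 'j) \<Rightarrow> 'j measure) \<Rightarrow>
     (nat \<Rightarrow> 'w \<times> 'i \<times> 'j) measure" where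
  "play_law q s \<zeta> \<sigma> \<tau> =
     projective_family.lim UNIV
       (Ionescu_Tulcea.CI (stage_kernel q s \<zeta> \<sigma> \<tau>) (\<lambda>_. stage_space)) (\<lambda>_. stage_space)"

text \<open>Conditional expectation of the payoff \<open>g Z i j\<close> at time \<open>t\<close> given the play. For \<open>t\<close> in
  \<open>[s n, s (n + 1))\<close> the state at time \<open>t\<close> of the Markov chain with generator \<open>q i j\<close> that is in
  \<open>z\<close> at time \<open>s n\<close> has law \<open>trans_prob q (t - s n) i j $ z\<close>.\<close>

definition payoff_at ::
    "('w \<Rightarrow> 'i \<Rightarrow> 'j \<Rightarrow> real) \<Rightarrow> ('i \<Rightarrow> 'j \<Rightarrow> real ^ 'w::finite ^ 'w) \<Rightarrow> (nat \<Rightarrow> real) \<Rightarrow>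
     (nat \<Rightarrow> 'w \<times> 'i \<times> 'j) \<Rightarrow> real \<Rightarrow> real" where
  "payoff_at g q s h t =
     (case h (stage s t) of (z, i, j) \<Rightarrow>
        \<Sum>z'\<in>UNIV. trans_prob q (t - s (stage s t)) i j $ z $ z' * g z' i j)"

definition total_payoff ::
    "('w \<Rightarrow> 'i::topological_space \<Rightarrow> 'j::topological_space \<Rightarrow> real) \<Rightarrow> (real \<Rightarrow> real) \<Rightarrow>
     ('i \<Rightarrow> 'j \<Rightarrow> real ^ 'w::finite ^ 'w) \<Rightarrow> (nat \<Rightarrow> real) \<Rightarrow> real ^ 'w \<Rightarrow>
     (nat \<Rightarrow> (nat \<Rightarrow> 'i \<times> 'j) \<Rightarrow> 'i measure) \<Rightarrow> (nat \<Rightarrow> (nat \<Rightarrow> 'i \<times> 'j) \<Rightarrow> 'j measure) \<Rightarrow>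
     real" where
  "total_payoff g k q s \<zeta> \<sigma> \<tau> =
     (\<integral>h. (LINT t:{s 0..}|lborel. payoff_at g q s h t * k t) \<partial>play_law q s \<zeta> \<sigma> \<tau>)"

text \<open>The game starting at the \<open>n\<close>-th partition time is played on the shifted sequence of times.\<close>

definition payoff_from ::
    "('w \<Rightarrow> 'i::topological_space \<Rightarrow> 'j::topological_space \<Rightarrow> real) \<Rightarrow> (real \<Rightarrow> real) \<Rightarrow>
     ('i \<Rightarrow> 'j \<Rightarrow> real ^ 'w::finite ^ 'w) \<Rightarrow> (nat \<Rightarrow> real) \<Rightarrow> nat \<Rightarrow> real ^ 'w \<Rightarrow>
     (nat \<Rightarrow> (nat \<Rightarrow> 'i \<times> 'j) \<Rightarrow> 'i measure) \<Rightarrow> (nat \<Rightarrow> (nat \<Rightarrow> 'i \<times> 'j) \<Rightarrow> 'j measure) \<Rightarrow>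
     real" where
  "payoff_from g k q \<pi> n \<zeta> = total_payoff g k q (\<lambda>l. \<pi> (n + l)) \<zeta>"

definition V_grid ::
    "('w \<Rightarrow> 'i::topological_space \<Rightarrow> 'j::topological_space \<Rightarrow> real) \<Rightarrow> (real \<Rightarrow> real) \<Rightarrow>
     ('i \<Rightarrow> 'j \<Rightarrow> real ^ 'w::finite ^ 'w) \<Rightarrow> (nat \<Rightarrow> real) \<Rightarrow> nat \<Rightarrow> real ^ 'w \<Rightarrow> real" where
  "V_grid g k q \<pi> n \<zeta> = game_value strategies strategies (payoff_from g k q \<pi> n \<zeta>)"

definition V_part ::
    "('w \<Rightarrow> 'i::topological_space \<Rightarrow> 'j::topological_space \<Rightarrow> real) \<Rightarrow> (real \<Rightarrow> real) \<Rightarrow>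
     ('i \<Rightarrow> 'j \<Rightarrow> real ^ 'w::finite ^ 'w) \<Rightarrow> (nat \<Rightarrow> real) \<Rightarrow> real \<times> (real ^ 'w) \<Rightarrow> real" where
  "V_part g k q \<pi> = (\<lambda>(t, \<zeta>).
     let n = stage \<pi> t
     in V_grid g k q \<pi> n \<zeta> +
        (t - \<pi> n) / (\<pi> (Suc n) - \<pi> n) * (V_grid g k q \<pi> (Suc n) \<zeta> - V_grid g k q \<pi> n \<zeta>))"

end

(* A player's stage game at a known belief is a continuous game on I x J, so it has a value in mixed
   actions; solving the resulting recursive equation backwards and playing stagewise near-optimal
   actions selected measurably from finitely many gives the value V_Pi of the whole game. These
   values are uniformly Lipschitz in the belief and nearly Lipschitz in time. Hence their upper limit
   along vanishing mesh is a continuous function, and testing the recursive equation against a smooth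
   function shows that it is a viscosity subsolution. Exchanging the players, the lower limit is a
   supersolution. The comparison principle, proved by doubling the variables, forces both limits to
   agree, which is convergence, and also gives uniqueness. *)

theory Submission
  imports Defs
begin

section \<open>Values\<close>

text \<open>The state is hidden: the law of the play is built from the true state transitions, while
  the recursive equation runs on beliefs. The link is that strategies read actions only, so the
  belief is the conditional law of the state given the past actions. The unbounded horizon is
  controlled by one function, \<open>tail\<close>, the mass of \<open>k\<close> after a given time:
  it takes the place of a contraction factor, bounds the Lipschitz constants and measures every
  truncation error. Partitions of small mesh share no common grid. Limits are therefore taken along
  the filter \<open>vanishing_mesh\<close>, as infima of eventual upper bounds, without extracting
  subsequences, and near-maxima over the partition times replace the maxima of the classical
  stability argument. Test functions may touch at any point of \<open>time_beliefs\<close>, time 0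
  and the faces of the simplex included, so the doubling argument treats these points like all
  others; the only prescribed behaviour is that at infinity. The minimax theorem comes from regret
  matching, an explicit play of a finite game whose time averages are near-optimal.\<close>

lemma is_valueI:
  assumes lo: "\<And>e. e > 0 \<Longrightarrow> \<exists>a\<in>A. \<forall>b\<in>B. v - e \<le> f a b"
    and hi: "\<And>e. e > 0 \<Longrightarrow> \<exists>b\<in>B. \<forall>a\<in>A. f a b \<le> v + e"
  shows "is_value A B f v"
proof -
  let ?L = "SUP a\<in>A. INF b\<in>B. ereal (f a b)" and ?U = "INF b\<in>B. SUP a\<in>A. ereal (f a b)"
  \<comment> \<open>Weak duality closes the chain: the guarantees of the two players only give v
    \<le> ?L and ?U \<le> v.\<close>
  have LU: "?L \<le> ?U"
    by (intro SUP_least INF_greatest) (meson INF_lower SUP_upper order_trans)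
  have "ereal v \<le> ?L + ereal e" if "e > 0" for e
  proof -
    obtain a where a: "a \<in> A" "\<And>b. b \<in> B \<Longrightarrow> v - e \<le> f a b" using lo[OF \<open>e > 0\<close>] by blast
    have "ereal (v - e) \<le> (INF b\<in>B. ereal (f a b))" using a by (intro INF_greatest) simp
    also have "\<dots> \<le> ?L" using a by (intro SUP_upper)
    finally have "ereal (v - e) + ereal e \<le> ?L + ereal e" by (rule add_right_mono)
    then show ?thesis by simp
  qed
  then have L: "ereal v \<le> ?L" by (rule ereal_le_epsilon2) blast
  have "?U \<le> ereal v + ereal e" if "e > 0" for e
  proof -
    obtain b where b: "b \<in> B" "\<And>a. a \<in> A \<Longrightarrow> f a b \<le> v + e" using hi[OF \<open>e > 0\<close>] by blast
    have "?U \<le> (SUP a\<in>A. ereal (f a b))" using b by (intro INF_lower)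
    also have "\<dots> \<le> ereal (v + e)" using b by (intro SUP_least) simp
    finally show ?thesis by simp
  qed
  then have U: "?U \<le> ereal v" by (rule ereal_le_epsilon2) blast
  show ?thesis unfolding is_value_def using LU L U by (meson order_antisym order_trans)
qed

lemma is_value_maximizer:
  assumes "is_value A B f v" "e > 0"
  shows "\<exists>a\<in>A. \<forall>b\<in>B. v - e \<le> f a b"
proof -
  have "ereal (v - e) < (SUP a\<in>A. INF b\<in>B. ereal (f a b))" using assms by (simp add: is_value_def)
  then obtain a where a: "a \<in> A" "ereal (v - e) < (INF b\<in>B. ereal (f a b))"
    by (auto simp: less_SUP_iff)
  have "v - e \<le> f a b" if "b \<in> B" for b
    using order.strict_trans2[OF a(2) INF_lower[OF that]] by simp
  with a show ?thesis by blast
qed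

lemma is_value_minimizer:
  assumes "is_value A B f v" "e > 0"
  shows "\<exists>b\<in>B. \<forall>a\<in>A. f a b \<le> v + e"
proof -
  have "(INF b\<in>B. SUP a\<in>A. ereal (f a b)) < ereal (v + e)" using assms by (simp add: is_value_def)
  then obtain b where b: "b \<in> B" "(SUP a\<in>A. ereal (f a b)) < ereal (v + e)"
    by (auto simp: INF_less_iff)
  have "f a b \<le> v + e" if "a \<in> A" for a
    using order.strict_trans1[OF SUP_upper[OF that] b(2)] by simp
  with b show ?thesis by blast
qed

lemma game_value_eq: "is_value A B f v \<Longrightarrow> game_value A B f = v"
  unfolding game_value_def by (rule the_equality) (auto simp: is_value_def)

text \<open>A near-optimal choice of the maximizer in \<open>f\<close> meets a near-optimal choice
  of the minimizer in \<open>f'\<close>, and the two values are compared at this single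
  pair.\<close>

lemma is_value_mono:
  fixes v w :: real
  assumes "is_value A B f v" "is_value A B f' w"
    and le: "\<And>a b. a \<in> A \<Longrightarrow> b \<in> B \<Longrightarrow> f a b \<le> f' a b + c"
  shows "v \<le> w + c"
proof (rule field_le_epsilon)
  fix e :: real assume "e > 0"
  then have "e / 2 > 0" by simp
  from is_value_maximizer[OF assms(1) this] is_value_minimizer[OF assms(2) this]
  obtain a b where "a \<in> A" "b \<in> B" "v - e / 2 \<le> f a b" "f' a b \<le> w + e / 2" by blast
  with le[of a b] show "v \<le> w + c + e" by linarith
qed

section \<open>The minimax theorem for continuous payoffs\<close>

text \<open>Regret matching: player 1 plays each action with probability proportional to the positive
  part of its cumulated regret, against best replies. The potential \<open>\<Sum>a. (max 0 (R a))\<^sup>2\<close>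
  then grows at most linearly in time, so the average regret vanishes.\<close>

lemma max0_add_square_le:
  fixes r d :: real
  shows "(max 0 (r + d))\<^sup>2 \<le> (max 0 r)\<^sup>2 + 2 * max 0 r * d + d\<^sup>2"
proof -
  have "(max 0 r)\<^sup>2 + 2 * max 0 r * d + d\<^sup>2 = (max 0 r + d)\<^sup>2" by (simp add: power2_sum)
  moreover have "(max 0 (r + d))\<^sup>2 \<le> (max 0 r + d)\<^sup>2"
  proof (cases "r + d \<le> 0")
    case False
    then show ?thesis by (intro power_mono) auto
  qed simp
  ultimately show ?thesis by simp
qed

lemma regret_matching:
  fixes f :: "'a \<Rightarrow> 'b \<Rightarrow> real"
  assumes A: "finite A" "A \<noteq> {}" and bd: "\<And>a b. a \<in> A \<Longrightarrow> \<bar>f a b\<bar> \<le> M" and e: "e > 0"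
  obtains x :: "'a \<Rightarrow> real" and b :: "nat \<Rightarrow> 'b" and T :: nat
  where "\<And>a. a \<in> A \<Longrightarrow> 0 \<le> x a" "sum x A = 1" "T > 0"
    "\<And>a b'. a \<in> A \<Longrightarrow> (\<Sum>t<T. f a (b t)) / T \<le> (\<Sum>a\<in>A. x a * f a b') + e"
proof -
  define S where "S r = (\<Sum>a\<in>A. max 0 (r a))" for r :: "'a \<Rightarrow> real"
  \<comment> \<open>When no regret is positive there is no direction to favour; the uniform mixture
    keeps \<open>mix r\<close> a probability.\<close>
  define mix where "mix r a = (if S r = 0 then 1 / card A else max 0 (r a) / S r)"
    for r :: "'a \<Rightarrow> real" and a
  define F where "F x b = (\<Sum>a\<in>A. x a * f a b)" for x :: "'a \<Rightarrow> real" and b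
  have S0: "S r \<ge> 0" for r unfolding S_def by (intro sum_nonneg) auto
  have mix0: "mix r a \<ge> 0" for r a using S0[of r] by (auto simp: mix_def)
  have mix1: "sum (mix r) A = 1" for r
  proof (cases "S r = 0")
    case True then show ?thesis using A by (simp add: mix_def)
  next
    case False
    then have "sum (mix r) A = S r / S r"
      by (simp add: mix_def S_def sum_divide_distrib[symmetric])
    then show ?thesis using False by simp
  qed
  have Fbd: "\<bar>F (mix r) b\<bar> \<le> M" for r b
  proof -
    have "\<bar>F (mix r) b\<bar> \<le> (\<Sum>a\<in>A. mix r a * M)" unfolding F_def
      by (rule order_trans[OF sum_abs]) (auto intro!: sum_mono mult_left_mono bd simp: abs_mult mix0)
    then show ?thesis by (simp add: sum_distrib_right[symmetric] mix1)
  qed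
  \<comment> \<open>The type 'b carries no topology, so the infimum over replies need not be
    attained. Half of \<open>e\<close> pays for near-best replies, the other half is kept for the
    average regret.\<close>
  have "\<exists>b. \<forall>b'. F (mix r) b \<le> F (mix r) b' + e / 2" for r
  proof -
    have bb: "bdd_below (range (F (mix r)))" using Fbd[of r]
      by (intro bdd_belowI[of _ "- M"]) (metis abs_le_D2 imageE minus_le_iff)
    have "(INF b. F (mix r) b) < (INF b. F (mix r) b) + e / 2" using e by simp
    then obtain b where "F (mix r) b < (INF b. F (mix r) b) + e / 2"
      using cInf_lessD[of "range (F (mix r))"] by fastforce
    moreover have "(INF b. F (mix r) b) \<le> F (mix r) b'" for b' by (intro cINF_lower bb) simp
    ultimately show ?thesis by (intro exI[of _ b]) (smt (verit))
  qed
  then obtain br where br: "\<And>r b'. F (mix r) (br r) \<le> F (mix r) b' + e / 2" by metis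
  define R where "R = rec_nat (\<lambda>_. 0) (\<lambda>_ r a. r a + (f a (br r) - F (mix r) (br r)))"
  have R0: "R 0 = (\<lambda>_. 0)" and RS: "\<And>t a. R (Suc t) a = R t a + (f a (br (R t)) - F (mix (R t)) (br (R t)))"
    by (simp_all add: R_def)
  define \<Phi> where "\<Phi> t = (\<Sum>a\<in>A. (max 0 (R t a))\<^sup>2)" for t
  \<comment> \<open>Blackwell's condition: with weights proportional to the positive regrets, the
    regret increment is orthogonal to them for every reply \<open>b\<close>. This removes the cross
    term of \<open>max0_add_square_le\<close>.\<close>
  have orth: "(\<Sum>a\<in>A. max 0 (r a) * (f a b - F (mix r) b)) = 0" for r b
  proof (cases "S r = 0")
    case True
    then have "\<forall>a\<in>A. max 0 (r a) = 0" unfolding S_def using A by (subst (asm) sum_nonneg_eq_0_iff) auto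
    then show ?thesis by (intro sum.neutral) auto
  next
    case False
    have "F (mix r) b = (\<Sum>a\<in>A. max 0 (r a) * f a b) / S r"
      using False by (simp add: F_def mix_def sum_divide_distrib)
    then have "(\<Sum>a\<in>A. max 0 (r a) * f a b) = S r * F (mix r) b" using False by simp
    then show ?thesis
      by (simp only: right_diff_distrib sum_subtractf sum_distrib_right[symmetric] S_def[symmetric])
  qed
  obtain a0 where a0: "a0 \<in> A" using A by blast
  have M0: "M \<ge> 0" using bd[OF a0, of undefined] by linarith
  have PhiS: "\<Phi> (Suc t) \<le> \<Phi> t + card A * (2 * M)\<^sup>2" for t
  proof -
    let ?d = "\<lambda>a. f a (br (R t)) - F (mix (R t)) (br (R t))"
    have "\<Phi> (Suc t) \<le> (\<Sum>a\<in>A. (max 0 (R t a))\<^sup>2 + 2 * (max 0 (R t a) * ?d a) + (2 * M)\<^sup>2)"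
      unfolding \<Phi>_def RS
    proof (rule sum_mono)
      fix a assume "a \<in> A"
      have "\<bar>?d a\<bar> \<le> \<bar>2 * M\<bar>" using bd[OF \<open>a \<in> A\<close>, of "br (R t)"] Fbd[of "R t" "br (R t)"] by linarith
      then have "(?d a)\<^sup>2 \<le> (2 * M)\<^sup>2" by (simp only: abs_le_square_iff)
      with max0_add_square_le[of "R t a" "?d a"]
      show "(max 0 (R t a + ?d a))\<^sup>2 \<le> (max 0 (R t a))\<^sup>2 + 2 * (max 0 (R t a) * ?d a) + (2 * M)\<^sup>2"
        by linarith
    qed
    also have "\<dots> = \<Phi> t + card A * (2 * M)\<^sup>2"
      using orth[of "R t" "br (R t)"] by (simp add: sum.distrib sum_distrib_left[symmetric] \<Phi>_def)
    finally show ?thesis .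
  qed
  have Phi: "\<Phi> t \<le> t * (card A * (2 * M)\<^sup>2)" for t
  proof (induction t)
    case 0 then show ?case by (simp add: \<Phi>_def R0)
  next
    case (Suc t) with PhiS[of t] show ?case by (simp add: algebra_simps)
  qed
  \<comment> \<open>The potential grows at most linearly in time, while a regret above e / 2 * T
    would force it above a quadratic function of T; this T decides between the two.\<close>
  obtain T :: nat where T: "card A * (2 * M)\<^sup>2 / (e / 2)\<^sup>2 < T" using reals_Archimedean2 by blast
  have e2: "(e / 2)\<^sup>2 > 0" using e by simp
  have T0: "T > 0" using le_less_trans[OF _ T, of 0] e2 by simp
  have RT: "R T a \<le> e / 2 * T" if "a \<in> A" for a
  proof -
    have "(max 0 (R T a))\<^sup>2 \<le> \<Phi> T" unfolding \<Phi>_def using A that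
      by (intro member_le_sum) auto
    also have "\<dots> \<le> T * (card A * (2 * M)\<^sup>2)" by (rule Phi)
    also have "\<dots> \<le> T * (T * (e / 2)\<^sup>2)" using T e2
      by (intro mult_left_mono) (auto simp: pos_divide_less_eq)
    also have "\<dots> = (e / 2 * T)\<^sup>2" by (simp add: power2_eq_square)
    finally have "max 0 (R T a) \<le> e / 2 * T" by (rule power2_le_imp_le) (use e in simp)
    then show ?thesis by simp
  qed
  have Rsum: "R t a = (\<Sum>s<t. f a (br (R s))) - (\<Sum>s<t. F (mix (R s)) (br (R s)))" for t a
    by (induction t) (auto simp: R0 RS)
  define x where "x a = (\<Sum>t<T. mix (R t) a) / T" for a
  show thesis
  proof (rule that[of x T "\<lambda>t. br (R t)"])
    show "0 \<le> x a" for a by (auto simp: x_def intro!: divide_nonneg_nonneg sum_nonneg mix0)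
    have "sum x A = (\<Sum>t<T. sum (mix (R t)) A) / T"
      unfolding x_def by (subst sum.swap) (simp add: sum_divide_distrib[symmetric] sum.swap[of _ A])
    then show "sum x A = 1" using T0 by (simp add: mix1)
    show "T > 0" by fact
    fix a b' assume a: "a \<in> A"
    have "(\<Sum>a\<in>A. x a * f a b') = (\<Sum>t<T. F (mix (R t)) b') / T"
      unfolding x_def F_def by (subst sum.swap)
        (simp add: sum_divide_distrib[symmetric] sum_distrib_right sum.swap[of _ A] divide_simps)
    moreover have "(\<Sum>t<T. F (mix (R t)) (br (R t))) \<le> (\<Sum>t<T. F (mix (R t)) b' + e / 2)"
      by (intro sum_mono br)
    ultimately have "(\<Sum>t<T. f a (br (R t))) \<le> T * ((\<Sum>a\<in>A. x a * f a b') + e)"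
      using Rsum[of T a] RT[OF a] T0 by (simp add: sum.distrib algebra_simps)
    then show "(\<Sum>t<T. f a (br (R t))) / T \<le> (\<Sum>a\<in>A. x a * f a b') + e"
      using T0 by (simp add: pos_divide_le_eq mult.commute)
  qed
qed

text \<open>A \<open>pmf\<close> is a measure on all subsets. Transport along the identity only
  shrinks the sigma-algebra to the Borel sets, as membership in \<open>prob_algebra borel\<close>
  demands.\<close>

lemma finite_support_prob:
  fixes A :: "'a::topological_space set"
  assumes "finite A" "\<And>a. a \<in> A \<Longrightarrow> 0 \<le> x a" "sum x A = 1"
  obtains \<mu> :: "'a measure" where "\<mu> \<in> space (prob_algebra borel)"
    "\<And>f :: 'a \<Rightarrow> real. f \<in> borel_measurable borel \<Longrightarrow> (\<integral>a. f a \<partial>\<mu>) = (\<Sum>a\<in>A. x a * f a)"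
proof -
  \<comment> \<open>Nothing is assumed of \<open>x\<close> outside \<open>A\<close>, so it is cut
    off there before it becomes a \<open>pmf\<close>.\<close>
  define w where "w a = (if a \<in> A then x a else 0)" for a
  have w0: "w a \<ge> 0" for a using assms by (simp add: w_def)
  have "(\<integral>\<^sup>+a. ennreal (w a) \<partial>count_space UNIV) = (\<Sum>a\<in>A. ennreal (w a))"
    by (intro nn_integral_count_space'[OF assms(1)]) (auto simp: w_def)
  also have "\<dots> = ennreal (sum w A)" using w0 by (intro sum_ennreal)
  also have "sum w A = 1" using assms by (simp add: w_def)
  finally have w1: "(\<integral>\<^sup>+a. ennreal (w a) \<partial>count_space UNIV) = 1" by simp
  let ?p = "embed_pmf w"
  have pw: "pmf ?p a = w a" for a by (intro pmf_embed_pmf w0 w1)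
  show thesis
  proof (rule that[of "distr (measure_pmf ?p) borel (\<lambda>a. a)"])
    show "distr (measure_pmf ?p) borel (\<lambda>a. a) \<in> space (prob_algebra borel)"
      by (auto simp: space_prob_algebra intro!: measure_pmf.prob_space_distr)
    fix f :: "'a \<Rightarrow> real" assume [measurable]: "f \<in> borel_measurable borel"
    have "(\<integral>a. f a \<partial>distr (measure_pmf ?p) borel (\<lambda>a. a)) = (\<integral>a. f a \<partial>measure_pmf ?p)"
      by (subst integral_distr) auto
    also have "\<dots> = (\<Sum>a\<in>A. f a * pmf ?p a)"
      by (rule integral_measure_pmf_real[OF assms(1)]) (auto simp: set_pmf_iff pw w_def split: if_splits)
    also have "\<dots> = (\<Sum>a\<in>A. x a * f a)" by (intro sum.cong) (auto simp: pw w_def)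
    finally show "(\<integral>a. f a \<partial>distr (measure_pmf ?p) borel (\<lambda>a. a)) = (\<Sum>a\<in>A. x a * f a)" .
  qed
qed

section \<open>Continuous games on compact metric spaces\<close>

lemma compact_UNIV_Times:
  "compact (UNIV :: ('a::compact_metric_space \<times> 'b::compact_metric_space) set)"
  using compact_Times[OF compact_UNIV compact_UNIV] by simp

lemma continuous_Pair_bounded:
  fixes f :: "'i::compact_metric_space \<Rightarrow> 'j::compact_metric_space \<Rightarrow> 'b::real_normed_vector"
  assumes "continuous_on UNIV (\<lambda>(i, j). f i j)"
  obtains M where "M \<ge> 0" "\<And>i j. norm (f i j) \<le> M"
proof -
  have "bounded (range (\<lambda>(i, j). f i j))"
    using compact_imp_bounded[OF compact_continuous_image[OF assms compact_UNIV_Times]] .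
  then obtain M where M: "\<And>x. x \<in> range (\<lambda>(i, j). f i j) \<Longrightarrow> norm x \<le> M" unfolding bounded_iff by blast
  have "norm (f i j) \<le> M" for i j using M[of "f i j"] by force
  moreover from this[of undefined undefined] have "M \<ge> 0" using norm_ge_zero order_trans by blast
  ultimately show thesis using that by blast
qed

lemma continuous_Pair_measurable:
  fixes f :: "'i::compact_metric_space \<Rightarrow> 'j::compact_metric_space \<Rightarrow> 'b::real_normed_vector"
  assumes "continuous_on UNIV (\<lambda>(i, j). f i j)"
  shows "(\<lambda>p. f (fst p) (snd p)) \<in> borel_measurable (borel \<Otimes>\<^sub>M borel)"
    and "f i \<in> borel_measurable borel" and "(\<lambda>i. f i j) \<in> borel_measurable borel"
proof -
  show "(\<lambda>p. f (fst p) (snd p)) \<in> borel_measurable (borel \<Otimes>\<^sub>M borel)"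
    unfolding borel_prod using borel_measurable_continuous_onI[OF assms] by (simp add: case_prod_beta')
  have "continuous_on UNIV (\<lambda>j. (\<lambda>(i, j). f i j) (i, j))"
    by (intro continuous_on_compose2[OF assms] continuous_intros) auto
  then show "f i \<in> borel_measurable borel" using borel_measurable_continuous_onI by fastforce
  have "continuous_on UNIV (\<lambda>i. (\<lambda>(i, j). f i j) (i, j))"
    by (intro continuous_on_compose2[OF assms] continuous_intros) auto
  then show "(\<lambda>i. f i j) \<in> borel_measurable borel" using borel_measurable_continuous_onI by fastforce
qed

lemma regular_probsD:
  assumes "\<mu> \<in> (regular_probs :: 'a::compact_metric_space measure set)"
  shows "prob_space \<mu>" "sets \<mu> = sets borel" "space \<mu> = UNIV"
  using assms sets_eq_imp_space_eq[of \<mu> borel] by (auto simp: regular_probs_eq space_prob_algebra)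

lemma regular_probs_nonempty: "(regular_probs :: 'a::compact_metric_space measure set) \<noteq> {}"
proof -
  have "return borel undefined \<in> space (prob_algebra (borel :: 'a measure))"
    by (auto simp: space_prob_algebra intro!: prob_space_return)
  then show ?thesis by (auto simp: regular_probs_eq)
qed

context
  fixes f :: "'i::compact_metric_space \<Rightarrow> 'j::compact_metric_space \<Rightarrow> real"
  assumes cont: "continuous_on UNIV (\<lambda>(i, j). f i j)"
begin

lemma integrable_slices:
  assumes "x \<in> regular_probs" "y \<in> regular_probs"
  shows "integrable y (f i)" "integrable x (\<lambda>i. f i j)"
proof -
  obtain M where M: "\<And>i j. norm (f i j) \<le> M" using continuous_Pair_bounded[OF cont] by blast
  note m = continuous_Pair_measurable[OF cont]
  note xD = regular_probsD[OF assms(1)] and yD = regular_probsD[OF assms(2)]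
  interpret x: prob_space x by (rule xD)
  interpret y: prob_space y by (rule yD)
  show "integrable y (f i)" using M m(2)
    by (intro y.integrable_const_bound[of _ M]) (auto simp: measurable_cong_sets[OF yD(2) refl])
  show "integrable x (\<lambda>i. f i j)" using M m(3)
    by (intro x.integrable_const_bound[of _ M]) (auto simp: measurable_cong_sets[OF xD(2) refl])
qed

text \<open>Regret matching on a finite net of the first action set supplies the mixture
  \<open>x\<close>; the empirical distribution of the replies met on the way is \<open>y\<close>.
  Uniform continuity replaces an arbitrary action by a net point at cost e / 2. One bound over all
  pairs of pure actions yields both halves of the minimax theorem.\<close>

lemma minimax_pair:
  assumes e: "e > 0"
  obtains x y where "x \<in> regular_probs" "y \<in> regular_probs"
    "\<And>i j. (\<integral>j'. f i j' \<partial>y) \<le> (\<integral>i'. f i' j \<partial>x) + e"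
proof -
  obtain M where M: "\<And>i j. \<bar>f i j\<bar> \<le> M"
    using continuous_Pair_bounded[OF cont] by (metis real_norm_def)
  note m = continuous_Pair_measurable[OF cont]
  have "uniformly_continuous_on UNIV (\<lambda>(i, j). f i j)"
    by (rule compact_uniformly_continuous[OF cont compact_UNIV_Times])
  moreover have "e / 2 > 0" using e by simp
  ultimately obtain d where d: "d > 0"
    and dc: "\<And>p p'. dist p p' < d \<Longrightarrow> dist (f (fst p) (snd p)) (f (fst p') (snd p')) < e / 2"
    unfolding uniformly_continuous_on_def case_prod_beta' by (metis UNIV_I)
  have near: "\<bar>f i j - f i' j\<bar> \<le> e / 2" if "dist i i' < d" for i i' j
    using dc[of "(i, j)" "(i', j)"] that by (simp add: dist_Pair_Pair dist_real_def)
  obtain A :: "'i set" where A: "finite A" and cov: "UNIV \<subseteq> (\<Union>a\<in>A. ball a d)"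
    using seq_compact_imp_totally_bounded[OF compact_imp_seq_compact[OF compact_UNIV]] d by blast
  from cov have A0: "A \<noteq> {}" by auto
  obtain w b T where w: "\<And>a. a \<in> A \<Longrightarrow> 0 \<le> w a" "sum w A = 1" and T: "(T::nat) > 0"
    and reg: "\<And>a b'. a \<in> A \<Longrightarrow> (\<Sum>t<T. f a (b t)) / T \<le> (\<Sum>a\<in>A. w a * f a b') + e / 2"
    using regret_matching[OF A A0, of f M "e / 2"] M e by (metis half_gt_zero_iff)
  obtain x :: "'i measure" where x: "x \<in> space (prob_algebra borel)"
    "\<And>f. f \<in> borel_measurable borel \<Longrightarrow> (\<integral>a. f a \<partial>x) = (\<Sum>a\<in>A. w a * (f a :: real))"
    using finite_support_prob[OF A w] by metis
  define y where "y = distr (measure_pmf (pmf_of_set {..<T})) borel b"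
  have y: "y \<in> space (prob_algebra borel)" unfolding y_def
    by (auto simp: space_prob_algebra intro!: measure_pmf.prob_space_distr)
  have yint: "(\<integral>j. h j \<partial>y) = (\<Sum>t<T. h (b t)) / T" if [measurable]: "h \<in> borel_measurable borel" for h :: "'j \<Rightarrow> real"
    unfolding y_def using T by (subst integral_distr) (auto simp: integral_pmf_of_set lessThan_empty_iff)
  show thesis
  proof (rule that[of x y])
    show "x \<in> regular_probs" "y \<in> regular_probs" using x y by (simp_all add: regular_probs_eq)
    fix i j
    obtain a where a: "a \<in> A" "dist a i < d" using cov by (metis UNIV_I UN_E mem_ball subsetD)
    have "(\<Sum>t<T. f i (b t)) \<le> (\<Sum>t<T. f a (b t) + e / 2)"
      using near[OF a(2)] by (intro sum_mono) (smt (verit) field_sum_of_halves)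
    also have "\<dots> = (\<Sum>t<T. f a (b t)) + T * (e / 2)" by (simp only: sum.distrib sum_constant card_lessThan)
    finally have "(\<Sum>t<T. f i (b t)) / T \<le> (\<Sum>t<T. f a (b t)) / T + e / 2"
      using T by (simp add: pos_divide_le_eq distrib_left mult.commute)
    also have "\<dots> \<le> (\<Sum>a\<in>A. w a * f a j) + e" using reg[OF a(1), of j] by simp
    finally show "(\<integral>j'. f i j' \<partial>y) \<le> (\<integral>i'. f i' j \<partial>x) + e"
      using x(2)[OF m(3)] yint[OF m(2)] by simp
  qed
qed

lemma mixed_ext_iterated:
  assumes "x \<in> regular_probs" "y \<in> regular_probs"
  shows "integrable (x \<Otimes>\<^sub>M y) (\<lambda>p. f (fst p) (snd p))"
    and "mixed_ext f x y = (\<integral>i. (\<integral>j. f i j \<partial>y) \<partial>x)"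
    and "mixed_ext f x y = (\<integral>j. (\<integral>i. f i j \<partial>x) \<partial>y)"
    and "integrable x (\<lambda>i. \<integral>j. f i j \<partial>y)" and "integrable y (\<lambda>j. \<integral>i. f i j \<partial>x)"
proof -
  obtain M where M: "\<And>i j. norm (f i j) \<le> M" using continuous_Pair_bounded[OF cont] by blast
  note m = continuous_Pair_measurable[OF cont]
  note xD = regular_probsD[OF assms(1)] and yD = regular_probsD[OF assms(2)]
  interpret x: prob_space x by (rule xD)
  interpret y: prob_space y by (rule yD)
  interpret xy: pair_prob_space x y by unfold_locales
  have s: "sets (x \<Otimes>\<^sub>M y) = sets (borel \<Otimes>\<^sub>M borel)" by (intro sets_pair_measure_cong xD yD)
  show int: "integrable (x \<Otimes>\<^sub>M y) (\<lambda>p. f (fst p) (snd p))" using M m(1)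
    by (intro xy.integrable_const_bound[of _ M]) (auto simp: measurable_cong_sets[OF s refl])
  then have int': "integrable (x \<Otimes>\<^sub>M y) (\<lambda>(i, j). f i j)" by (simp add: case_prod_beta')
  show "mixed_ext f x y = (\<integral>i. (\<integral>j. f i j \<partial>y) \<partial>x)" "integrable x (\<lambda>i. \<integral>j. f i j \<partial>y)"
    using xy.integral_fst'[OF int'] xy.integrable_fst'[OF int'] by (simp_all add: mixed_ext_def case_prod_beta')
  show "mixed_ext f x y = (\<integral>j. (\<integral>i. f i j \<partial>x) \<partial>y)" "integrable y (\<lambda>j. \<integral>i. f i j \<partial>x)"
    using xy.integral_snd[OF int'] xy.integrable_snd[OF int'] by (simp_all add: mixed_ext_def case_prod_beta')
qed

text \<open>The value is the supremum of the levels that the maximizer can guarantee against pure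
  replies. The pair from \<open>minimax_pair\<close> shows that the minimizer can hold every pure
  action to that supremum up to \<open>e\<close>, and Fubini extends both guarantees to mixed
  opponents.\<close>

lemma continuous_game_has_value:
  "\<exists>v. is_value regular_probs regular_probs (mixed_ext f) v"
proof -
  obtain M where M: "\<And>i j. \<bar>f i j\<bar> \<le> M"
    using continuous_Pair_bounded[OF cont] by (metis real_norm_def)
  let ?X = "{c. \<exists>x\<in>regular_probs. \<forall>j. c \<le> (\<integral>i. f i j \<partial>x)}"
  have bd: "c \<le> M" if "c \<in> ?X" for c
  proof -
    from that obtain x where x: "x \<in> regular_probs" "\<And>j. c \<le> (\<integral>i. f i j \<partial>x)" by blast
    interpret x: prob_space x using regular_probsD[OF x(1)] by simp
    have "c \<le> (\<integral>i. f i undefined \<partial>x)" by (rule x)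
    also have "\<dots> \<le> (\<integral>i. M \<partial>x)"
      using M integrable_slices(2)[OF x(1)] regular_probs_nonempty by (intro integral_mono) (auto simp: abs_le_iff)
    finally show ?thesis by (simp add: x.prob_space)
  qed
  then have bdd: "bdd_above ?X" by (rule bdd_aboveI)
  define v where "v = Sup ?X"
  \<comment> \<open>The payoff of row \<open>i\<close> against \<open>y\<close>, lowered by
    \<open>e\<close>, is a level guaranteed by \<open>x\<close>, hence one of the levels whose
    supremum is \<open>v\<close>.\<close>
  have mem: "(\<integral>j'. f i j' \<partial>y) - e \<le> v" if "x \<in> regular_probs" "\<And>j. (\<integral>j'. f i j' \<partial>y) \<le> (\<integral>i'. f i' j \<partial>x) + e" for x y i e
    unfolding v_def using that by (intro cSup_upper bdd) (fastforce simp: algebra_simps)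
  have ne: "?X \<noteq> {}"
  proof -
    obtain x y where "x \<in> regular_probs" "\<And>i j. (\<integral>j'. f i j' \<partial>y) \<le> (\<integral>i'. f i' j \<partial>x) + 1"
      using minimax_pair[of 1] by (metis zero_less_one)
    then show ?thesis by (auto simp: algebra_simps intro!: exI[of _ "(\<integral>j'. f undefined j' \<partial>y) - 1"] bexI[of _ x])
  qed
  have "is_value regular_probs regular_probs (mixed_ext f) v"
  proof (rule is_valueI)
    fix e :: real assume e: "e > 0"
    then have "v - e < Sup ?X" by (simp add: v_def)
    then obtain c where "c \<in> ?X" "v - e < c" using less_cSup_iff[OF ne bdd] by blast
    from \<open>c \<in> ?X\<close> obtain x where x: "x \<in> regular_probs" "\<And>j. c \<le> (\<integral>i. f i j \<partial>x)" by blast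
    have x2: "v - e \<le> (\<integral>i. f i j \<partial>x)" for j using x(2)[of j] \<open>v - e < c\<close> by simp
    have "v - e \<le> mixed_ext f x y" if y: "y \<in> regular_probs" for y
    proof -
      interpret y: prob_space y using regular_probsD[OF y] by simp
      have "(\<integral>j. v - e \<partial>y) \<le> (\<integral>j. (\<integral>i. f i j \<partial>x) \<partial>y)"
        by (intro integral_mono mixed_ext_iterated(5) x(1) y) (use x2 in simp_all)
      then show ?thesis by (simp add: mixed_ext_iterated(3)[OF x(1) y] y.prob_space)
    qed
    with x(1) show "\<exists>a\<in>regular_probs. \<forall>b\<in>regular_probs. v - e \<le> mixed_ext f a b" by blast
    obtain x y where x: "x \<in> regular_probs" and y: "y \<in> regular_probs"
      "\<And>i j. (\<integral>j'. f i j' \<partial>y) \<le> (\<integral>i'. f i' j \<partial>x) + e"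
      using minimax_pair[OF e] by metis
    have "mixed_ext f x' y \<le> v + e" if x': "x' \<in> regular_probs" for x'
    proof -
      interpret x': prob_space x' using regular_probsD[OF x'] by simp
      have "(\<integral>i. (\<integral>j. f i j \<partial>y) \<partial>x') \<le> (\<integral>i. v + e \<partial>x')"
        using mem[OF x y(2)]
        by (intro integral_mono mixed_ext_iterated(4) x' y(1)) (simp_all add: algebra_simps)
      then show ?thesis by (simp add: mixed_ext_iterated(2)[OF x' y(1)] x'.prob_space)
    qed
    with y show "\<exists>b\<in>regular_probs. \<forall>a\<in>regular_probs. mixed_ext f a b \<le> v + e" by blast
  qed
  then show ?thesis ..
qed

end

section \<open>Calculus of values in mixed actions, used for the stage games and for the Hamiltonian
  alike\<close>

definition mixed_value :: "('i::compact_metric_space \<Rightarrow> 'j::compact_metric_space \<Rightarrow> real) \<Rightarrow> real" where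
  "mixed_value f = game_value regular_probs regular_probs (mixed_ext f)"

lemma is_value_mixed_value:
  "continuous_on UNIV (\<lambda>(i, j). f i j) \<Longrightarrow>
    is_value regular_probs regular_probs (mixed_ext f) (mixed_value f)"
  unfolding mixed_value_def using continuous_game_has_value game_value_eq by metis

lemma mixed_ext_affine:
  fixes f :: "'i::compact_metric_space \<Rightarrow> 'j::compact_metric_space \<Rightarrow> real"
  assumes "continuous_on UNIV (\<lambda>(i, j). f i j)" "x \<in> regular_probs" "y \<in> regular_probs"
  shows "mixed_ext (\<lambda>i j. c * f i j + d) x y = c * mixed_ext f x y + d"
proof -
  interpret x: prob_space x by (rule regular_probsD assms)+
  interpret y: prob_space y by (rule regular_probsD assms)+
  interpret xy: pair_prob_space x y by unfold_locales
  show ?thesis using mixed_ext_iterated(1)[OF assms] by (simp add: mixed_ext_def xy.prob_space)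
qed

lemma continuous_affine_Pair:
  fixes f :: "'i::topological_space \<Rightarrow> 'j::topological_space \<Rightarrow> real"
  assumes "continuous_on UNIV (\<lambda>(i, j). f i j)"
  shows "continuous_on UNIV (\<lambda>(i, j). c * f i j + d)"
  using assms by (auto simp: case_prod_beta' intro!: continuous_intros)

lemma continuous_swap_uminus:
  fixes f :: "'i::topological_space \<Rightarrow> 'j::topological_space \<Rightarrow> real"
  assumes "continuous_on UNIV (\<lambda>(i, j). f i j)"
  shows "continuous_on UNIV (\<lambda>(j, i). - f i j)"
proof -
  have "continuous_on UNIV (\<lambda>p :: 'j \<times> 'i. - (\<lambda>(i, j). f i j) (snd p, fst p))"
    by (intro continuous_intros continuous_on_compose2[OF assms]) auto
  then show ?thesis by (simp add: case_prod_beta')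
qed

lemma mixed_ext_mono:
  fixes f f' :: "'i::compact_metric_space \<Rightarrow> 'j::compact_metric_space \<Rightarrow> real"
  assumes c: "continuous_on UNIV (\<lambda>(i, j). f i j)" and c': "continuous_on UNIV (\<lambda>(i, j). f' i j)"
    and le: "\<And>i j. f i j \<le> f' i j + d" and xy: "x \<in> regular_probs" "y \<in> regular_probs"
  shows "mixed_ext f x y \<le> mixed_ext f' x y + d"
proof -
  have "mixed_ext f x y \<le> mixed_ext (\<lambda>i j. 1 * f' i j + d) x y"
    unfolding mixed_ext_def
    by (intro integral_mono mixed_ext_iterated(1) c continuous_affine_Pair c' xy)
      (use le in auto)
  also have "\<dots> = 1 * mixed_ext f' x y + d" by (rule mixed_ext_affine[OF c' xy])
  finally show ?thesis by simp
qed

lemma mixed_value_mono: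
  fixes f f' :: "'i::compact_metric_space \<Rightarrow> 'j::compact_metric_space \<Rightarrow> real"
  assumes c: "continuous_on UNIV (\<lambda>(i, j). f i j)" and c': "continuous_on UNIV (\<lambda>(i, j). f' i j)"
    and le: "\<And>i j. f i j \<le> f' i j + d"
  shows "mixed_value f \<le> mixed_value f' + d"
proof (rule is_value_mono[OF is_value_mixed_value[OF c] is_value_mixed_value[OF c']])
  fix x :: "'i measure" and y :: "'j measure" assume xy: "x \<in> regular_probs" "y \<in> regular_probs"
  then show "mixed_ext f x y \<le> mixed_ext f' x y + d" by (intro mixed_ext_mono c c' le)
qed

lemma mixed_value_const: "mixed_value (\<lambda>i j. c) = c"
proof -
  have "mixed_ext (\<lambda>(i::'a) (j::'b). c) x y = c" if "x \<in> regular_probs" "y \<in> regular_probs" for x y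
  proof -
    interpret x: prob_space x by (rule regular_probsD that)+
    interpret y: prob_space y by (rule regular_probsD that)+
    interpret xy: pair_prob_space x y by unfold_locales
    show ?thesis by (simp add: mixed_ext_def xy.prob_space)
  qed
  then show ?thesis unfolding mixed_value_def
    by (intro game_value_eq is_valueI) (use regular_probs_nonempty in fastforce)+
qed

lemma mixed_value_affine_le:
  fixes f :: "'i::compact_metric_space \<Rightarrow> 'j::compact_metric_space \<Rightarrow> real"
  assumes f: "continuous_on UNIV (\<lambda>(i, j). f i j)" and "c \<ge> 0"
  shows "mixed_value (\<lambda>i j. c * f i j + d) \<le> c * mixed_value f + d"
proof (rule field_le_epsilon)
  fix e :: real assume "e > 0"
  \<comment> \<open>The two near-optimality errors enter with weights c and 1; the divisor c + 1 is
    positive even for c = 0.\<close>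
  define e' where "e' = e / (c + 1)"
  have e': "e' > 0" "(c + 1) * e' = e" using \<open>c \<ge> 0\<close> \<open>e > 0\<close> by (auto simp: e'_def)
  from is_value_maximizer[OF is_value_mixed_value[OF continuous_affine_Pair[OF f]] e'(1), of c d]
    is_value_minimizer[OF is_value_mixed_value[OF f] e'(1)]
  obtain x y where xy: "x \<in> regular_probs" "y \<in> regular_probs"
    and 1: "mixed_value (\<lambda>i j. c * f i j + d) - e' \<le> mixed_ext (\<lambda>i j. c * f i j + d) x y"
    and 2: "mixed_ext f x y \<le> mixed_value f + e'" by blast
  have "mixed_value (\<lambda>i j. c * f i j + d) - e' \<le> c * mixed_ext f x y + d"
    using 1 by (simp add: mixed_ext_affine[OF f xy])
  also have "\<dots> \<le> c * (mixed_value f + e') + d" using 2 \<open>c \<ge> 0\<close> by (simp add: mult_left_mono)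
  finally show "mixed_value (\<lambda>i j. c * f i j + d) \<le> c * mixed_value f + d + e"
    using e'(2) by (simp add: algebra_simps)
qed

text \<open>A guarantee of the minimizer in \<open>f\<close> is a guarantee of the maximizer in the
  negated transposed game. Supersolutions are later obtained from subsolutions by this
  duality.\<close>

lemma mixed_value_swap:
  fixes f :: "'i::compact_metric_space \<Rightarrow> 'j::compact_metric_space \<Rightarrow> real"
  assumes f: "continuous_on UNIV (\<lambda>(i, j). f i j)"
  shows "mixed_value (\<lambda>j i. - f i j) = - mixed_value f"
proof -
  note f' = continuous_swap_uminus[OF f]
  have ext: "mixed_ext (\<lambda>j i. - f i j) y x = - mixed_ext f x y"
    if "x \<in> regular_probs" "y \<in> regular_probs" for x y
    using mixed_ext_iterated(2)[OF f' that(2,1)] mixed_ext_iterated(3)[OF f that] by simp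
  have "is_value regular_probs regular_probs (mixed_ext (\<lambda>j i. - f i j)) (- mixed_value f)"
  proof (rule is_valueI)
    fix e :: real assume e: "e > 0"
    from is_value_minimizer[OF is_value_mixed_value[OF f] e]
    show "\<exists>a\<in>regular_probs. \<forall>b\<in>regular_probs. - mixed_value f - e \<le> mixed_ext (\<lambda>j i. - f i j) a b"
      by (force simp: ext)
    from is_value_maximizer[OF is_value_mixed_value[OF f] e]
    show "\<exists>b\<in>regular_probs. \<forall>a\<in>regular_probs. mixed_ext (\<lambda>j i. - f i j) a b \<le> - mixed_value f + e"
      by (force simp: ext)
  qed
  from game_value_eq[OF this] show ?thesis by (simp add: mixed_value_def)
qed

section \<open>Exponentials of transition rates\<close>

definition mpow :: "real ^ 'w::finite ^ 'w \<Rightarrow> nat \<Rightarrow> real ^ 'w ^ 'w" where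
  "mpow A n = (((**) A) ^^ n) (mat 1)"

lemma mpow_0 [simp]: "mpow A 0 = mat 1" and mpow_Suc [simp]: "mpow A (Suc n) = A ** mpow A n"
  by (simp_all add: mpow_def)

lemma matrix_mult_entry: "(A ** B) $ z $ z' = (\<Sum>m\<in>UNIV. A $ z $ m * B $ m $ z')"
  for A B :: "real ^ 'w::finite ^ 'w"
  by (simp add: matrix_matrix_mult_def)

lemma mpow_entry_bound:
  fixes A :: "real ^ 'w::finite ^ 'w" and c :: real
  assumes "\<And>z z'. \<bar>A $ z $ z'\<bar> \<le> c"
  shows "\<bar>mpow A n $ z $ z'\<bar> \<le> (CARD('w) * c) ^ n"
proof (induction n arbitrary: z)
  case 0 then show ?case by (simp add: mat_def)
next
  case (Suc n)
  have "c \<ge> 0" using assms[of undefined undefined] by linarith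
  then have "\<bar>mpow A (Suc n) $ z $ z'\<bar> \<le> (\<Sum>m\<in>(UNIV::'w set). c * (CARD('w) * c) ^ n)"
    unfolding mpow_Suc matrix_mult_entry
    by (intro order_trans[OF sum_abs] sum_mono) (auto simp: abs_mult intro!: mult_mono assms Suc)
  then show ?case by simp
qed

lemma norm_vec_vec_le:
  fixes A :: "real ^ 'w::finite ^ 'v::finite" and c :: real
  assumes "\<And>z z'. \<bar>A $ z $ z'\<bar> \<le> c"
  shows "norm A \<le> CARD('v) * (CARD('w) * c)"
proof -
  have "norm A \<le> (\<Sum>z\<in>UNIV. norm (A $ z))" unfolding norm_vec_def by (rule L2_set_le_sum) simp
  also have "\<dots> \<le> (\<Sum>z\<in>UNIV. \<Sum>z'\<in>UNIV. \<bar>A $ z $ z'\<bar>)" by (intro sum_mono norm_le_l1_cart)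
  also have "\<dots> \<le> sum (\<lambda>z :: 'v. sum (\<lambda>z' :: 'w. c) UNIV) UNIV" by (intro sum_mono assms)
  finally show ?thesis by simp
qed

lemma abs_entry_le_norm: "\<bar>A $ z $ z'\<bar> \<le> norm (A :: real ^ 'w::finite ^ 'v::finite)"
  using order_trans[OF component_le_norm_cart Finite_Cartesian_Product.norm_nth_le] .

lemma matrix_exp_summable:
  fixes A :: "real ^ 'w::finite ^ 'w"
  shows "summable (\<lambda>n. (1 / fact n) *\<^sub>R mpow A n)"
proof (rule summable_comparison_test')
  let ?c = "real CARD('w) * norm A"
  show "summable (\<lambda>n. real CARD('w) * (real CARD('w) * (inverse (fact n) * ?c ^ n)))"
    by (intro summable_mult summable_exp)
  fix n
  have "\<bar>((1 / fact n) *\<^sub>R mpow A n) $ z $ z'\<bar> \<le> inverse (fact n) * ?c ^ n" for z z'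
    using mpow_entry_bound[of A "norm A" n z z'] abs_entry_le_norm[of A]
    by (simp add: abs_mult divide_inverse mult_left_mono)
  from norm_vec_vec_le[of "(1 / fact n) *\<^sub>R mpow A n", OF this]
  show "norm ((1 / fact n) *\<^sub>R mpow A n) \<le> CARD('w) * (CARD('w) * (inverse (fact n) * ?c ^ n))" .
qed

lemma matrix_exp_entry:
  fixes A :: "real ^ 'w::finite ^ 'w"
  shows "(\<lambda>n. mpow A n $ z $ z' / fact n) sums (matrix_exp A $ z $ z')"
proof -
  have bl: "bounded_linear (\<lambda>B :: real ^ 'w ^ 'w. B $ z $ z')"
    by (rule bounded_linear_compose[OF bounded_linear_vec_nth bounded_linear_vec_nth])
  from bounded_linear.sums[OF bl summable_sums[OF matrix_exp_summable]]
  show ?thesis by (simp add: matrix_exp_def mpow_def)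
qed

text \<open>From second order on, the entries are dominated by the series of the scalar exponential
  at x = CARD('w) * c, and exp x - 1 - x is at most x squared for x in [0, 1]; this is where
  \<open>c\<close> has to be small.\<close>

lemma matrix_exp_expansion:
  fixes A :: "real ^ 'w::finite ^ 'w" and c :: real
  assumes A: "\<And>z z'. \<bar>A $ z $ z'\<bar> \<le> c" and c: "CARD('w) * c \<le> 1"
  shows "\<bar>matrix_exp A $ z $ z' - mat 1 $ z $ z' - A $ z $ z'\<bar> \<le> (CARD('w) * c)\<^sup>2"
proof -
  let ?x = "real CARD('w) * c"
  have c0: "c \<ge> 0" using A[of undefined undefined] by linarith
  let ?a = "\<lambda>n. mpow A n $ z $ z' / fact n"
  have s: "(\<lambda>n. ?a (n + 2)) sums (matrix_exp A $ z $ z' - (\<Sum>n<2. ?a n))"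
    by (rule sums_split_initial_segment[OF matrix_exp_entry])
  have e: "(\<lambda>n. inverse (fact (n + 2)) *\<^sub>R ?x ^ (n + 2)) sums (exp ?x - (\<Sum>n<2. inverse (fact n) *\<^sub>R ?x ^ n))"
    by (rule sums_split_initial_segment[OF exp_converges])
  have le: "\<bar>?a (n + 2)\<bar> \<le> inverse (fact (n + 2)) *\<^sub>R ?x ^ (n + 2)" for n
    using mpow_entry_bound[OF A, where n = "n + 2" and z = z and z' = z']
    by (simp add: divide_inverse abs_mult mult.commute mult_left_mono del: fact_Suc)
  have "\<bar>\<Sum>n. ?a (n + 2)\<bar> \<le> (\<Sum>n. inverse (fact (n + 2)) *\<^sub>R ?x ^ (n + 2))"
    using norm_suminf_le[OF _ sums_summable[OF e], of "\<lambda>n. ?a (n + 2)"] le by (simp only: real_norm_def)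
  also have "\<dots> = exp ?x - 1 - ?x" using sums_unique[OF e] by (simp add: lessThan_nat_numeral lessThan_Suc)
  also have "\<dots> \<le> ?x\<^sup>2" using exp_bound[of ?x] c c0 by simp
  finally show ?thesis using sums_unique[OF s] by (simp add: lessThan_nat_numeral lessThan_Suc algebra_simps)
qed

lemma continuous_mpow_entry:
  "continuous_on S (\<lambda>A :: real ^ 'w::finite ^ 'w. mpow A n $ z $ z')"
proof (induction n arbitrary: z)
  case 0 then show ?case by simp
next
  case (Suc n)
  have "continuous_on S (\<lambda>A :: real ^ 'w ^ 'w. A $ z $ m)" for m by (intro continuous_intros)
  with Suc show ?case unfolding mpow_Suc matrix_mult_entry
    by (intro continuous_on_sum continuous_on_mult)
qed

text \<open>The Weierstrass test applies on each ball, where one scalar exponential series dominates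
  all entries; balls suffice because continuity is local.\<close>

lemma continuous_matrix_exp: "continuous_on UNIV (matrix_exp :: real ^ 'w::finite ^ 'w \<Rightarrow> _)"
proof -
  have entry: "continuous_on (ball 0 r) (\<lambda>A :: real ^ 'w ^ 'w. matrix_exp A $ z $ z')" for r z z'
  proof -
    let ?c = "real CARD('w) * r"
    have "uniform_limit (ball 0 r) (\<lambda>N (A :: real ^ 'w ^ 'w). \<Sum>n<N. mpow A n $ z $ z' / fact n)
        (\<lambda>A. \<Sum>n. mpow A n $ z $ z' / fact n) sequentially"
    proof (rule Weierstrass_m_test)
      fix n and A :: "real ^ 'w ^ 'w" assume "A \<in> ball 0 r"
      then have "norm A \<le> r" by simp
      then have "\<bar>A $ z $ z'\<bar> \<le> r" for z z' using abs_entry_le_norm[of A z z'] by linarith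
      from mpow_entry_bound[OF this, of n z z']
      show "norm (mpow A n $ z $ z' / fact n) \<le> inverse (fact n) * ?c ^ n"
        by (simp add: divide_inverse abs_mult mult.commute mult_left_mono)
    next
      show "summable (\<lambda>n. inverse (fact n) * ?c ^ n)" by (rule summable_exp)
    qed
    then have "continuous_on (ball 0 r) (\<lambda>A :: real ^ 'w ^ 'w. \<Sum>n. mpow A n $ z $ z' / fact n)"
      by (rule uniform_limit_theorem[rotated])
        (auto intro!: always_eventually continuous_intros continuous_mpow_entry)
    then show ?thesis by (simp add: sums_unique[OF matrix_exp_entry, symmetric])
  qed
  have ball: "continuous_on (ball 0 r) (matrix_exp :: real ^ 'w ^ 'w \<Rightarrow> _)" for r
  proof -
    have "continuous_on (ball 0 r) (\<lambda>A :: real ^ 'w ^ 'w. \<chi> z z'. matrix_exp A $ z $ z')"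
      by (intro continuous_on_vec_lambda entry)
    then show ?thesis by simp
  qed
  have "isCont matrix_exp A" for A :: "real ^ 'w ^ 'w"
    using ball[of "norm A + 1"] continuous_on_eq_continuous_at[OF open_ball, of 0 "norm A + 1" matrix_exp]
    by auto
  then show ?thesis by (simp add: continuous_at_imp_continuous_on)
qed

text \<open>The binomial theorem for A = B - c I, divided by n!: the right-hand side is the n-th
  term of the Cauchy product of the series of \<open>B\<close> and of exp (- c).\<close>

lemma mpow_shift:
  fixes A :: "real ^ 'w::finite ^ 'w" and c :: real
  defines "B \<equiv> A + c *\<^sub>R mat 1"
  shows "mpow A n $ z $ z' / fact n = (\<Sum>i\<le>n. (mpow B i $ z $ z' / fact i) * ((- c) ^ (n - i) / fact (n - i)))"
proof -
  have AB: "(A ** M) $ z $ z' = (B ** M) $ z $ z' - c * M $ z $ z'" for M :: "real ^ 'w ^ 'w" and z z'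
  proof -
    have "(B ** M) $ z $ z' = (\<Sum>m\<in>UNIV. A $ z $ m * M $ m $ z' + (if z = m then c * M $ m $ z' else 0))"
      unfolding matrix_mult_entry B_def by (intro sum.cong) (auto simp: mat_def algebra_simps)
    then show ?thesis by (simp add: sum.distrib matrix_mult_entry)
  qed
  have "mpow A n $ z $ z' = (\<Sum>i\<le>n. of_nat (n choose i) * mpow B i $ z $ z' * (- c) ^ (n - i))" for z
  proof (induction n arbitrary: z)
    case 0 then show ?case by simp
  next
    case (Suc n)
    let ?b = "\<lambda>i. mpow B i $ z $ z'"
    have BM: "(B ** mpow A n) $ z $ z' = (\<Sum>i\<le>n. of_nat (n choose i) * ?b (Suc i) * (- c) ^ (n - i))"
      unfolding matrix_mult_entry Suc sum_distrib_left
      by (subst sum.swap) (simp add: matrix_mult_entry sum_distrib_left sum_distrib_right mult_ac)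
    have shift: "(\<Sum>i\<le>n. of_nat (n choose i) * ?b (Suc i) * (- c) ^ (n - i))
      = (\<Sum>i\<le>Suc n. (if i = 0 then 0 else of_nat (n choose (i - 1)) * ?b i * (- c) ^ (Suc n - i)))"
      by (simp only: sum.atMost_Suc_shift) simp
    have two: "- c * (\<Sum>i\<le>n. of_nat (n choose i) * ?b i * (- c) ^ (n - i))
      = (\<Sum>i\<le>Suc n. of_nat (n choose i) * ?b i * (- c) ^ (Suc n - i))"
      by (simp add: sum_distrib_left binomial_eq_0 Suc_diff_le mult_ac cong: sum.cong)
         (rule sum.cong, auto simp: Suc_diff_le mult_ac)
    have "mpow A (Suc n) $ z $ z' = (B ** mpow A n) $ z $ z' + - c * (mpow A n $ z $ z')"
      by (simp add: AB)
    also have "\<dots> = (\<Sum>i\<le>Suc n. (if i = 0 then 0 else of_nat (n choose (i - 1)) * ?b i * (- c) ^ (Suc n - i))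
        + of_nat (n choose i) * ?b i * (- c) ^ (Suc n - i))"
      unfolding BM shift Suc[of z] two by (simp only: sum.distrib)
    also have "\<dots> = (\<Sum>i\<le>Suc n. of_nat (Suc n choose i) * ?b i * (- c) ^ (Suc n - i))"
    proof (rule sum.cong[OF refl])
      fix i show "(if i = 0 then 0 else of_nat (n choose (i - 1)) * ?b i * (- c) ^ (Suc n - i))
        + of_nat (n choose i) * ?b i * (- c) ^ (Suc n - i) = of_nat (Suc n choose i) * ?b i * (- c) ^ (Suc n - i)"
        by (cases i) (simp_all add: distrib_right)
    qed
    finally show ?case .
  qed
  then have "mpow A n $ z $ z' / fact n
      = (\<Sum>i\<le>n. of_nat (n choose i) * mpow B i $ z $ z' * (- c) ^ (n - i) / fact n)"
    by (simp add: sum_divide_distrib)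
  also have "\<dots> = (\<Sum>i\<le>n. (mpow B i $ z $ z' / fact i) * ((- c) ^ (n - i) / fact (n - i)))"
    by (intro sum.cong) (auto simp: binomial_fact)
  finally show ?thesis .
qed

text \<open>Entrywise, \<open>exp A = exp (- c) exp (A + c I)\<close> as a Cauchy product; for large \<open>c\<close> the matrix
  \<open>A + c I\<close> is nonnegative.\<close>

lemma matrix_exp_nonneg:
  fixes A :: "real ^ 'w::finite ^ 'w"
  assumes "\<And>z z'. z \<noteq> z' \<Longrightarrow> 0 \<le> A $ z $ z'"
  shows "0 \<le> matrix_exp A $ z $ z'"
proof -
  \<comment> \<open>The norm dominates every entry of \<open>A\<close>, so this shift makes the
    diagonal nonnegative.\<close>
  define B where "B = A + norm A *\<^sub>R mat 1"
  have "0 \<le> B $ z $ z'" for z z'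
    using assms[of z z'] abs_entry_le_norm[of A z z'] by (auto simp: B_def mat_def)
  then have Bn: "0 \<le> mpow B n $ z $ z'" for n z
    by (induction n arbitrary: z) (auto simp: mat_def matrix_mult_entry intro!: sum_nonneg mult_nonneg_nonneg)
  let ?b = "\<lambda>n. mpow B n $ z $ z' / fact n" and ?e = "\<lambda>n. (- norm A) ^ n / fact n"
  have sb: "summable (\<lambda>n. norm (?b n))"
    using sums_summable[OF matrix_exp_entry[of B z z']] Bn by simp
  have se: "summable (\<lambda>n. norm (?e n))"
    using summable_exp[of "norm A"] by (simp add: abs_mult power_abs divide_inverse mult.commute)
  have "(\<lambda>n. \<Sum>i\<le>n. ?b i * ?e (n - i)) sums ((\<Sum>n. ?b n) * (\<Sum>n. ?e n))"
    by (rule Cauchy_product_sums[OF sb se])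
  then have "matrix_exp A $ z $ z' = (\<Sum>n. ?b n) * (\<Sum>n. ?e n)"
    unfolding B_def mpow_shift[of A _ z z' "norm A", symmetric]
    using matrix_exp_entry[of A z z'] sums_unique2 by blast
  also have "(\<Sum>n. ?e n) = exp (- norm A)"
    by (simp add: exp_def divide_inverse mult.commute)
  also have "(\<Sum>n. ?b n) * \<dots> \<ge> 0"
    using Bn sums_summable[OF matrix_exp_entry[of B z z']] by (intro mult_nonneg_nonneg suminf_nonneg) auto
  finally show ?thesis .
qed

text \<open>The vector of ones is in the kernel of \<open>A\<close>, hence of all its positive
  powers, and only the term of order 0 contributes to the row sum.\<close>

lemma matrix_exp_row_sum:
  fixes A :: "real ^ 'w::finite ^ 'w"
  assumes "\<And>z. (\<Sum>z'\<in>UNIV. A $ z $ z') = 0"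
  shows "(\<Sum>z'\<in>UNIV. matrix_exp A $ z $ z') = 1"
proof -
  have row: "(\<Sum>z'\<in>UNIV. mpow A n $ z $ z') = (if n = 0 then 1 else 0)" for n
  proof -
    have comm: "(\<Sum>z'\<in>UNIV. mpow A n $ z $ z') = (if n = 0 then 1 else 0)" for z
    proof (induction n arbitrary: z)
      case 0 then show ?case by (simp add: mat_def)
    next
      case (Suc n)
      have "(\<Sum>z'\<in>UNIV. mpow A (Suc n) $ z $ z') = (\<Sum>m\<in>UNIV. A $ z $ m * (\<Sum>z'\<in>UNIV. mpow A n $ m $ z'))"
        unfolding mpow_Suc matrix_mult_entry by (subst sum.swap) (simp add: sum_distrib_left)
      also have "\<dots> = (\<Sum>m\<in>UNIV. A $ z $ m) * (if n = 0 then 1 else 0)"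
        by (simp add: Suc)
      finally show ?case by (simp add: assms)
    qed
    then show ?thesis .
  qed
  have "(\<lambda>n. \<Sum>z'\<in>UNIV. mpow A n $ z $ z' / fact n) sums (\<Sum>z'\<in>UNIV. matrix_exp A $ z $ z')"
    by (intro sums_sum matrix_exp_entry)
  moreover have "(\<lambda>n. \<Sum>z'\<in>UNIV. mpow A n $ z $ z' / fact n) = (\<lambda>n. if n = 0 then 1 else 0)"
    by (auto simp: sum_divide_distrib[symmetric] row)
  ultimately show ?thesis using sums_single[of 0 "\<lambda>_. 1 :: real"] sums_unique2 by metis
qed

section \<open>The one-stage operator\<close>

text \<open>Stochastic matrices act on row vectors without increasing this norm
  (\<open>vP_l1\<close>), which fails in general for the Euclidean norm. Lipschitz constants
  measured in it do not grow through the transitions of the recursion.\<close>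

definition l1 :: "real ^ 'w::finite \<Rightarrow> real" where
  "l1 v = (\<Sum>z\<in>UNIV. \<bar>v $ z\<bar>)"

lemma l1_nonneg [simp]: "0 \<le> l1 v" by (simp add: l1_def sum_nonneg)

lemma norm_le_l1: "norm v \<le> l1 v" unfolding l1_def by (rule norm_le_l1_cart)

lemma l1_le_norm: "l1 (v :: real ^ 'w::finite) \<le> CARD('w) * norm v"
  unfolding l1_def using sum_bounded_above[of UNIV "\<lambda>z. \<bar>v $ z\<bar>" "norm v"] component_le_norm_cart by auto

lemma continuous_on_l1 [continuous_intros]:
  "continuous_on S f \<Longrightarrow> continuous_on S (\<lambda>x. l1 (f x))"
  unfolding l1_def by (intro continuous_intros)

lemma prob_vecsD:
  assumes "\<zeta> \<in> prob_vecs"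
  shows "0 \<le> \<zeta> $ z" "(\<Sum>z\<in>UNIV. \<zeta> $ z) = 1" "l1 \<zeta> = 1" "\<zeta> $ z \<le> 1"
proof -
  show *: "0 \<le> \<zeta> $ z" "(\<Sum>z\<in>UNIV. \<zeta> $ z) = 1" for z using assms by (auto simp: prob_vecs_def)
  then show "l1 \<zeta> = 1" by (simp add: l1_def)
  show "\<zeta> $ z \<le> 1" using member_le_sum[of z UNIV "($) \<zeta>"] * by simp
qed

lemma weighted_abs_le:
  assumes "\<zeta> \<in> prob_vecs" "\<And>z. \<bar>f z\<bar> \<le> c"
  shows "\<bar>\<Sum>z\<in>UNIV. \<zeta> $ z * f z\<bar> \<le> c"
proof -
  have "\<bar>\<Sum>z\<in>UNIV. \<zeta> $ z * f z\<bar> \<le> (\<Sum>z\<in>UNIV. \<zeta> $ z * c)"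
    by (rule order_trans[OF sum_abs])
      (auto simp: abs_mult prob_vecsD[OF assms(1)] intro!: sum_mono mult_left_mono assms(2))
  then show ?thesis by (simp add: sum_distrib_right[symmetric] prob_vecsD[OF assms(1)])
qed

lemma weighted_diff_le:
  assumes "\<And>z. \<bar>f z\<bar> \<le> c"
  shows "\<bar>(\<Sum>z\<in>UNIV. \<zeta> $ z * f z) - (\<Sum>z\<in>UNIV. \<zeta>' $ z * f z)\<bar> \<le> c * l1 (\<zeta> - \<zeta>')"
proof -
  have "\<bar>(\<Sum>z\<in>UNIV. \<zeta> $ z * f z) - (\<Sum>z\<in>UNIV. \<zeta>' $ z * f z)\<bar> = \<bar>\<Sum>z\<in>UNIV. (\<zeta> - \<zeta>') $ z * f z\<bar>"
    by (simp add: sum_subtractf[symmetric] left_diff_distrib)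
  also have "\<dots> \<le> (\<Sum>z\<in>UNIV. \<bar>(\<zeta> - \<zeta>') $ z\<bar> * c)"
    by (rule order_trans[OF sum_abs]) (auto simp: abs_mult intro!: sum_mono mult_left_mono assms)
  finally show ?thesis by (simp add: l1_def sum_distrib_left mult.commute)
qed

definition l1_lipschitz :: "real \<Rightarrow> (real ^ 'w::finite \<Rightarrow> real) \<Rightarrow> bool" where
  "l1_lipschitz L w \<longleftrightarrow> (\<forall>\<zeta>\<in>prob_vecs. \<forall>\<zeta>'\<in>prob_vecs. \<bar>w \<zeta> - w \<zeta>'\<bar> \<le> L * l1 (\<zeta> - \<zeta>'))"

lemma l1_lipschitzD:
  "l1_lipschitz L w \<Longrightarrow> \<zeta> \<in> prob_vecs \<Longrightarrow> \<zeta>' \<in> prob_vecs \<Longrightarrow> \<bar>w \<zeta> - w \<zeta>'\<bar> \<le> L * l1 (\<zeta> - \<zeta>')"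
  unfolding l1_lipschitz_def by blast

lemma l1_lipschitz_continuous:
  assumes "l1_lipschitz L w" shows "continuous_on prob_vecs w"
proof -
  have "(w \<longlongrightarrow> w \<zeta>) (at \<zeta> within prob_vecs)" if \<zeta>: "\<zeta> \<in> prob_vecs" for \<zeta>
  proof -
    have "((\<lambda>\<zeta>'. L * l1 (\<zeta>' - \<zeta>)) \<longlongrightarrow> L * l1 (\<zeta> - \<zeta>)) (at \<zeta> within prob_vecs)"
      unfolding l1_def by (intro tendsto_intros)
    then have "((\<lambda>\<zeta>'. L * l1 (\<zeta>' - \<zeta>)) \<longlongrightarrow> 0) (at \<zeta> within prob_vecs)" by (simp add: l1_def)
    moreover have ev: "eventually (\<lambda>\<zeta>'. norm (w \<zeta>' - w \<zeta>) \<le> L * l1 (\<zeta>' - \<zeta>)) (at \<zeta> within prob_vecs)"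
      using l1_lipschitzD[OF assms _ \<zeta>] by (auto simp: eventually_at_filter)
    ultimately have "((\<lambda>\<zeta>'. w \<zeta>' - w \<zeta>) \<longlongrightarrow> 0) (at \<zeta> within prob_vecs)"
      using Lim_null_comparison[OF ev] by blast
    then show ?thesis by (simp add: LIM_zero_iff)
  qed
  then show ?thesis by (simp add: continuous_on_def)
qed

section \<open>Standing assumptions and the action of the transition matrices on beliefs\<close>

locale unobserved_game =
  fixes g :: "'w::finite \<Rightarrow> 'i::compact_metric_space \<Rightarrow> 'j::compact_metric_space \<Rightarrow> real"
    and k :: "real \<Rightarrow> real"
    and q :: "'i \<Rightarrow> 'j \<Rightarrow> real ^ 'w ^ 'w"
  assumes g_cont: "\<And>z. continuous_on UNIV (\<lambda>(i, j). g z i j)"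
    and k_nonneg: "\<And>t. t \<ge> 0 \<Longrightarrow> k t \<ge> 0"
    and k_lipschitz: "\<exists>L. L-lipschitz_on {0..} k"
    and k_integrable: "set_integrable lborel {0..} k"
    and k_density: "(LINT t:{0..}|lborel. k t) = 1"
    and q_rate: "transition_rate q"
begin

abbreviation P where "P \<equiv> trans_prob q"

definition M where "M = (SOME M. M \<ge> 0 \<and> (\<forall>z i j. \<bar>g z i j\<bar> \<le> M))"

lemma M: "M \<ge> 0" "\<bar>g z i j\<bar> \<le> M"
proof -
  have "\<exists>m. \<forall>i j. \<bar>g z i j\<bar> \<le> m" for z
    using continuous_Pair_bounded[OF g_cont[of z]] by (metis real_norm_def)
  then obtain m where m: "\<And>z i j. \<bar>g z i j\<bar> \<le> m z" by metis
  then have m0: "m z \<ge> 0" for z using abs_ge_zero order_trans by blast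
  have "\<bar>g z i j\<bar> \<le> sum m UNIV" for z i j
    using m[of z i j] member_le_sum[of z UNIV m] m0 by fastforce
  then have "\<exists>M. M \<ge> 0 \<and> (\<forall>z i j. \<bar>g z i j\<bar> \<le> M)" using m0 sum_nonneg by metis
  from someI_ex[OF this, folded M_def] show "M \<ge> 0" "\<bar>g z i j\<bar> \<le> M" by auto
qed

lemma q_cont: "continuous_on UNIV (\<lambda>(i, j). q i j)"
  and q_nonneg: "z \<noteq> z' \<Longrightarrow> 0 \<le> q i j $ z $ z'"
  and q_sum: "(\<Sum>z'\<in>UNIV. q i j $ z $ z') = 0"
  using q_rate by (auto simp: transition_rate_def)

lemma q_bound: "\<exists>B\<ge>0. \<forall>i j z z'. \<bar>q i j $ z $ z'\<bar> \<le> B"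
proof -
  obtain B where "B \<ge> 0" "\<And>i j. norm (q i j) \<le> B" using continuous_Pair_bounded[OF q_cont] by blast
  then show ?thesis using order_trans[OF abs_entry_le_norm] by blast
qed

lemma P_nonneg: "h \<ge> 0 \<Longrightarrow> 0 \<le> P h i j $ z $ z'"
  unfolding trans_prob_def by (rule matrix_exp_nonneg) (simp add: q_nonneg)

lemma P_sum: "(\<Sum>z'\<in>UNIV. P h i j $ z $ z') = 1"
  unfolding trans_prob_def
  by (rule matrix_exp_row_sum) (simp add: q_sum sum_distrib_left[symmetric])

lemma P_row: "h \<ge> 0 \<Longrightarrow> P h i j $ z \<in> prob_vecs"
  by (simp add: prob_vecs_def P_nonneg P_sum)

lemma P_cont:
  assumes "continuous_on S h" "continuous_on S a" "continuous_on S b"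
  shows "continuous_on S (\<lambda>x. P (h x) (a x) (b x))"
proof -
  have "continuous_on S (\<lambda>x. (\<lambda>(i, j). q i j) (a x, b x))"
    by (intro continuous_on_compose2[OF q_cont] continuous_intros assms) auto
  then show ?thesis unfolding trans_prob_def
    by (intro continuous_on_compose2[OF continuous_matrix_exp] continuous_intros assms) auto
qed

lemma vP_entry: "(\<zeta> v* P h i j) $ z' = (\<Sum>z\<in>UNIV. \<zeta> $ z * P h i j $ z $ z')"
  by (simp add: vector_matrix_mult_def mult.commute)

lemma vP_prob:
  assumes "h \<ge> 0" "\<zeta> \<in> prob_vecs" shows "\<zeta> v* P h i j \<in> prob_vecs"
proof -
  have "(\<Sum>z'\<in>UNIV. (\<zeta> v* P h i j) $ z') = (\<Sum>z\<in>UNIV. \<zeta> $ z * (\<Sum>z'\<in>UNIV. P h i j $ z $ z'))"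
    unfolding vP_entry by (subst sum.swap) (simp add: sum_distrib_left)
  then show ?thesis using assms
    by (auto simp: prob_vecs_def P_sum vP_entry P_nonneg intro!: sum_nonneg mult_nonneg_nonneg)
qed

text \<open>After the triangle inequality the sum over the target states is taken first, and each
  row of \<open>P\<close> sums to 1.\<close>

lemma vP_l1:
  assumes "h \<ge> 0" shows "l1 (\<zeta> v* P h i j - \<zeta>' v* P h i j) \<le> l1 (\<zeta> - \<zeta>')"
proof -
  have "l1 (\<zeta> v* P h i j - \<zeta>' v* P h i j) = (\<Sum>z'\<in>UNIV. \<bar>\<Sum>z\<in>UNIV. (\<zeta> - \<zeta>') $ z * P h i j $ z $ z'\<bar>)"
    by (simp add: l1_def vP_entry sum_subtractf[symmetric] left_diff_distrib)
  also have "\<dots> \<le> (\<Sum>z'\<in>UNIV. \<Sum>z\<in>UNIV. \<bar>(\<zeta> - \<zeta>') $ z\<bar> * P h i j $ z $ z')"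
    by (intro sum_mono order_trans[OF sum_abs]) (simp add: abs_mult P_nonneg assms)
  also have "\<dots> = l1 (\<zeta> - \<zeta>')"
    by (subst sum.swap) (simp add: sum_distrib_left[symmetric] P_sum l1_def)
  finally show ?thesis .
qed

text \<open>The constants are uniform in the actions and the belief because \<open>q\<close> is
  bounded. The second-order and first-order estimates for the belief and the row estimate for
  \<open>P\<close> itself are bundled so as to share \<open>C\<close> and \<open>h0\<close>.\<close>

lemma vP_expansion:
  "\<exists>C\<ge>0. \<exists>h0>0. \<forall>h i j. \<forall>\<zeta>\<in>prob_vecs. 0 \<le> h \<and> h \<le> h0 \<longrightarrow>
     l1 (\<zeta> v* P h i j - \<zeta> - h *\<^sub>R (\<zeta> v* q i j)) \<le> C * h\<^sup>2 \<and> l1 (\<zeta> v* P h i j - \<zeta>) \<le> C * h \<and>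
     (\<forall>z. (\<Sum>z'\<in>UNIV. \<bar>P h i j $ z $ z' - mat 1 $ z $ z'\<bar>) \<le> C * h)"
proof -
  obtain B where B: "B \<ge> 0" "\<And>i j z z'. \<bar>q i j $ z $ z'\<bar> \<le> B" using q_bound by blast
  define N where "N = real CARD('w)"
  have N: "N \<ge> 1" unfolding N_def by (simp add: Suc_le_eq)
  \<comment> \<open>Small enough for \<open>matrix_exp_expansion\<close>, whose condition is N * (h
    * B) \<le> 1, and at most 1, so that the square of h can be absorbed in h.\<close>
  define h0 where "h0 = 1 / (N * B + 1)"
  have NB: "N * B \<ge> 0" using N B by simp
  have h0: "h0 > 0" "N * (h0 * B) \<le> 1" "h0 \<le> 1" using NB by (auto simp: h0_def field_simps)
  \<comment> \<open>The first summand collects the quadratic remainders of the N entries of a row,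
    the second the linear term h * q.\<close>
  define C where "C = N * (N * B)\<^sup>2 + N * B"
  have C0: "C \<ge> 0" using NB N by (simp add: C_def)
  {
    fix h i j assume h: "0 \<le> h" "h \<le> h0"
    have hh: "h * h \<le> h" using h h0(3) by (simp add: mult_left_le)
    have q': "\<bar>(h *\<^sub>R q i j) $ z $ z'\<bar> \<le> h * B" for z z' using B(2) h by (simp add: abs_mult mult_left_mono)
    have "N * (h * B) \<le> N * (h0 * B)" using h N B by (intro mult_left_mono mult_right_mono) auto
    then have "N * (h * B) \<le> 1" using h0 by simp
    then have ex: "\<bar>P h i j $ z $ z' - mat 1 $ z $ z' - h * q i j $ z $ z'\<bar> \<le> (N * B)\<^sup>2 * h\<^sup>2" for z z'
      using matrix_exp_expansion[OF q', of z z'] by (simp add: trans_prob_def N_def power_mult_distrib mult_ac)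
    have row: "(\<Sum>z'\<in>UNIV. \<bar>P h i j $ z $ z' - mat 1 $ z $ z' - h * q i j $ z $ z'\<bar>) \<le> N * (N * B)\<^sup>2 * h\<^sup>2" for z
      using sum_mono[of UNIV "\<lambda>z'. \<bar>P h i j $ z $ z' - mat 1 $ z $ z' - h * q i j $ z $ z'\<bar>" "\<lambda>_. (N * B)\<^sup>2 * h\<^sup>2"] ex
      by (simp add: N_def mult_ac)
    have qrow: "(\<Sum>z'\<in>UNIV. \<bar>h * q i j $ z $ z'\<bar>) \<le> N * B * h" for z
      using sum_mono[of UNIV "\<lambda>z'. \<bar>h * q i j $ z $ z'\<bar>" "\<lambda>_. h * B"] q'[of z]
      by (simp add: N_def mult_ac)
    have row2: "(\<Sum>z'\<in>UNIV. \<bar>P h i j $ z $ z' - mat 1 $ z $ z'\<bar>) \<le> C * h" for z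
    proof -
      have "(\<Sum>z'\<in>UNIV. \<bar>P h i j $ z $ z' - mat 1 $ z $ z'\<bar>) \<le>
          (\<Sum>z'\<in>UNIV. \<bar>P h i j $ z $ z' - mat 1 $ z $ z' - h * q i j $ z $ z'\<bar> + \<bar>h * q i j $ z $ z'\<bar>)"
        by (intro sum_mono) linarith
      also have "\<dots> \<le> N * (N * B)\<^sup>2 * h\<^sup>2 + N * B * h" using row[of z] qrow[of z] by (simp add: sum.distrib)
      also have "N * (N * B)\<^sup>2 * h\<^sup>2 \<le> N * (N * B)\<^sup>2 * h" using hh N by (intro mult_left_mono) (auto simp: power2_eq_square)
      finally show ?thesis by (simp add: C_def distrib_right)
    qed
    {
      fix \<zeta> :: "real ^ 'w" assume \<zeta>: "\<zeta> \<in> prob_vecs"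
      \<comment> \<open>Writing the belief as its own image under the identity turns both
        differences into averages of row errors of \<open>P\<close>.\<close>
      have id: "\<zeta> $ z' = (\<Sum>z\<in>UNIV. \<zeta> $ z * mat 1 $ z $ z')" for z'
        by (simp add: mat_def if_distrib[of "\<lambda>x. _ * x"] cong: if_cong)
      have wsum: "(\<Sum>z'\<in>UNIV. \<bar>\<Sum>z\<in>UNIV. \<zeta> $ z * d z z'\<bar>) \<le> c" if "\<And>z. (\<Sum>z'\<in>UNIV. \<bar>d z z'\<bar>) \<le> c" for d and c :: real
      proof -
        have "(\<Sum>z'\<in>UNIV. \<bar>\<Sum>z\<in>UNIV. \<zeta> $ z * d z z'\<bar>) \<le> (\<Sum>z'\<in>UNIV. \<Sum>z\<in>UNIV. \<zeta> $ z * \<bar>d z z'\<bar>)"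
          by (intro sum_mono order_trans[OF sum_abs]) (simp add: abs_mult prob_vecsD[OF \<zeta>])
        also have "\<dots> = (\<Sum>z\<in>UNIV. \<zeta> $ z * (\<Sum>z'\<in>UNIV. \<bar>d z z'\<bar>))"
          by (subst sum.swap) (simp add: sum_distrib_left)
        also have "\<dots> \<le> (\<Sum>z\<in>UNIV. \<zeta> $ z * c)" by (intro sum_mono mult_left_mono that prob_vecsD[OF \<zeta>])
        finally show ?thesis by (simp add: sum_distrib_right[symmetric] prob_vecsD[OF \<zeta>])
      qed
      have "l1 (\<zeta> v* P h i j - \<zeta> - h *\<^sub>R (\<zeta> v* q i j))
          = (\<Sum>z'\<in>UNIV. \<bar>\<Sum>z\<in>UNIV. \<zeta> $ z * (P h i j $ z $ z' - mat 1 $ z $ z' - h * q i j $ z $ z')\<bar>)"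
        unfolding l1_def
        by (rule sum.cong[OF refl], simp add: vP_entry, subst id)
          (simp add: vector_matrix_mult_def sum_subtractf[symmetric] right_diff_distrib sum_distrib_left mult_ac)
      also have "\<dots> \<le> N * (N * B)\<^sup>2 * h\<^sup>2" by (rule wsum) (rule row)
      also have "\<dots> \<le> C * h\<^sup>2" using NB N by (intro mult_right_mono) (auto simp: C_def)
      finally have 1: "l1 (\<zeta> v* P h i j - \<zeta> - h *\<^sub>R (\<zeta> v* q i j)) \<le> C * h\<^sup>2" .
      have "l1 (\<zeta> v* P h i j - \<zeta>)
          = (\<Sum>z'\<in>UNIV. \<bar>\<Sum>z\<in>UNIV. \<zeta> $ z * (P h i j $ z $ z' - mat 1 $ z $ z')\<bar>)"
        unfolding l1_def
        by (rule sum.cong[OF refl], simp add: vP_entry, subst id)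
          (simp add: sum_subtractf[symmetric] right_diff_distrib)
      also have "\<dots> \<le> C * h" by (rule wsum) (rule row2)
      finally have "l1 (\<zeta> v* P h i j - \<zeta>) \<le> C * h" .
      note 1 this
    }
    note this row2
  }
  note bounds = this
  show ?thesis
    by (intro exI[of _ C] exI[of _ h0] conjI C0 h0(1) allI ballI impI; elim conjE; rule bounds; assumption)
qed

subsection \<open>Integrals of the weight\<close>

lemma k_integrable_on: "A \<in> sets borel \<Longrightarrow> A \<subseteq> {0..} \<Longrightarrow> set_integrable lborel A k"
  by (rule set_integrable_subset[OF k_integrable]) auto

lemma k_integrable_stage: "0 \<le> a \<Longrightarrow> set_integrable lborel {a..<b} k"
  by (rule k_integrable_on) auto

definition mass where "mass a b = (LINT t:{a..<b}|lborel. k t)"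
text \<open>Multiplied by \<open>M\<close>, this single quantity bounds the values from time
  \<open>a\<close> on, their l1 Lipschitz constants and the effect of stopping the game at
  \<open>a\<close>.\<close>

definition tail where "tail a = (LINT t:{a..}|lborel. k t)"

text \<open>If k exceeded 1 + L at some t, the Lipschitz condition would keep it above 1 on
  [t, t + 1], and its integral would exceed 1.\<close>

lemma k_bound: "\<exists>K\<ge>0. \<forall>t\<ge>0. k t \<le> K"
proof -
  obtain L where L: "L-lipschitz_on {0..} k" using k_lipschitz by blast
  have L0: "L \<ge> 0" by (rule lipschitz_on_nonneg[OF L])
  have "k t \<le> 1 + L" if t: "t \<ge> 0" for t
  proof -
    have le: "k t - L \<le> k s" if "s \<in> {t..t + 1}" for s
    proof -
      have "\<bar>k t - k s\<bar> \<le> L * \<bar>t - s\<bar>" using lipschitz_onD[OF L, of t s] t that by (simp add: dist_real_def)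
      also have "\<dots> \<le> L * 1" using that L0 by (intro mult_left_mono) auto
      finally show ?thesis by linarith
    qed
    have fin: "set_integrable lborel {t..t+1} (\<lambda>_. k t - L)" unfolding set_integrable_def by simp
    have "k t - L = (LINT s:{t..t + 1}|lborel. k t - L)" by (simp add: set_lebesgue_integral_def)
    also have "\<dots> \<le> (LINT s:{t..t + 1}|lborel. k s)"
      using t by (intro set_integral_mono fin k_integrable_on le) auto
    also have "\<dots> \<le> (LINT s:{0..}|lborel. k s)"
      unfolding set_lebesgue_integral_def using t k_nonneg
      by (intro integral_mono k_integrable_on[of "{t..t+1}", unfolded set_integrable_def] k_integrable[unfolded set_integrable_def])
        (auto split: split_indicator)
    finally show ?thesis by (simp add: k_density)
  qed
  then show ?thesis using L0 by (intro exI[of _ "1 + L"]) auto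
qed

lemma mass_nonneg: "0 \<le> a \<Longrightarrow> 0 \<le> mass a b"
  unfolding mass_def set_lebesgue_integral_def using k_nonneg
  by (intro Bochner_Integration.integral_nonneg) (auto split: split_indicator)

lemma tail_nonneg: "0 \<le> a \<Longrightarrow> 0 \<le> tail a"
  unfolding tail_def set_lebesgue_integral_def using k_nonneg
  by (intro Bochner_Integration.integral_nonneg) (auto split: split_indicator)

lemma mass_tail: "0 \<le> a \<Longrightarrow> a \<le> b \<Longrightarrow> tail a = mass a b + tail b"
  unfolding mass_def tail_def
  by (subst set_integral_Un[symmetric]) (auto intro!: k_integrable_on simp: ivl_disj_un)

lemma tail_0: "tail 0 = 1" by (simp add: tail_def k_density)

lemma tail_antimono: "0 \<le> a \<Longrightarrow> a \<le> b \<Longrightarrow> tail b \<le> tail a"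
  using mass_tail mass_nonneg by fastforce

lemma tail_le_1: "0 \<le> a \<Longrightarrow> tail a \<le> 1" using tail_antimono[of 0 a] tail_0 by simp

lemma mass_le: "0 \<le> a \<Longrightarrow> a \<le> b \<Longrightarrow> (\<And>t. t \<ge> 0 \<Longrightarrow> k t \<le> K) \<Longrightarrow> mass a b \<le> K * (b - a)"
proof -
  assume ab: "0 \<le> a" "a \<le> b" and K: "\<And>t. t \<ge> 0 \<Longrightarrow> k t \<le> K"
  have "mass a b \<le> (LINT t:{a..<b}|lborel. K)" unfolding mass_def
    by (intro set_integral_mono k_integrable_on) (use ab K in \<open>auto simp: set_integrable_def\<close>)
  then show ?thesis using ab by (simp add: set_lebesgue_integral_def mult.commute)
qed

lemma tail_tendsto:
  assumes "filterlim X at_top sequentially" "\<And>n. 0 \<le> X n"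
  shows "(\<lambda>n. tail (X n)) \<longlonglongrightarrow> 0"
proof -
  have k: "integrable lborel (\<lambda>t. indicator {0..} t *\<^sub>R k t)"
    using k_integrable unfolding set_integrable_def .
  have "(\<lambda>n. \<integral>t. indicator {X n..} t *\<^sub>R k t \<partial>lborel) \<longlonglongrightarrow> integral\<^sup>L lborel (\<lambda>t :: real. 0)"
  proof (rule integral_dominated_convergence[where w = "\<lambda>t. norm (indicator {0..} t *\<^sub>R k t)"])
    show "(\<lambda>t. indicator {X n..} t *\<^sub>R k t) \<in> borel_measurable lborel" for n
      using k_integrable_on[of "{X n..}"] assms(2)[of n] unfolding set_integrable_def
      by (intro borel_measurable_integrable) auto
    show "AE t in lborel. (\<lambda>n. indicator {X n..} t *\<^sub>R k t) \<longlonglongrightarrow> 0"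
    proof (rule AE_I2)
      fix t :: real
      have "eventually (\<lambda>n. t < X n) sequentially" using assms(1) by (simp add: filterlim_at_top_dense)
      then have "eventually (\<lambda>n. indicator {X n..} t *\<^sub>R k t = 0) sequentially"
        by eventually_elim auto
      then show "(\<lambda>n. indicator {X n..} t *\<^sub>R k t) \<longlonglongrightarrow> 0" by (rule tendsto_eventually)
    qed
    show "integrable lborel (\<lambda>t. norm (indicator {0..} t *\<^sub>R k t))" using k by (rule integrable_norm)
    show "AE t in lborel. norm (indicator {X n..} t *\<^sub>R k t) \<le> norm (indicator {0..} t *\<^sub>R k t)" for n
      using assms(2)[of n] by (intro AE_I2) (auto split: split_indicator)
  qed simp
  then show ?thesis by (simp add: tail_def set_lebesgue_integral_def)
qed

subsection \<open>Stage payoffs\<close>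

definition flow_payoff where
  "flow_payoff h z i j = (\<Sum>z'\<in>UNIV. P h i j $ z $ z' * g z' i j)"

definition stage_payoff where
  "stage_payoff a b z i j = (LINT t:{a..<b}|lborel. flow_payoff (t - a) z i j * k t)"

definition belief_stage_payoff where
  "belief_stage_payoff a b \<zeta> i j = (\<Sum>z\<in>UNIV. \<zeta> $ z * stage_payoff a b z i j)"

lemma flow_payoff_bound: "h \<ge> 0 \<Longrightarrow> \<bar>flow_payoff h z i j\<bar> \<le> M"
  unfolding flow_payoff_def by (rule weighted_abs_le[OF P_row M(2)])

lemma flow_payoff_cont:
  assumes "continuous_on S h" "continuous_on S a" "continuous_on S b"
  shows "continuous_on S (\<lambda>x. flow_payoff (h x) z (a x) (b x))"
proof -
  have "continuous_on S (\<lambda>x. (\<lambda>(i, j). g z' i j) (a x, b x))" for z'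
    by (intro continuous_on_compose2[OF g_cont] continuous_intros assms) auto
  then have "continuous_on S (\<lambda>x. g z' (a x) (b x))" for z' by simp
  then show ?thesis unfolding flow_payoff_def by (intro continuous_intros P_cont assms)
qed

lemma flow_payoff_measurable: "(\<lambda>t. flow_payoff (t - a) z i j) \<in> borel_measurable borel"
  by (intro borel_measurable_continuous_onI flow_payoff_cont continuous_intros)

lemma flow_integrable:
  assumes "0 \<le> a" "A \<in> sets borel" "A \<subseteq> {a..}"
  shows "set_integrable lborel A (\<lambda>t. flow_payoff (t - a) z i j * k t)"
proof -
  have A0: "A \<subseteq> {0..}" using assms by auto
  have k: "integrable lborel (\<lambda>t. indicator A t *\<^sub>R k t)"
    using k_integrable_on[OF assms(2) A0] unfolding set_integrable_def .
  show ?thesis unfolding set_integrable_def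
  proof (rule Bochner_Integration.integrable_bound)
    show "integrable lborel (\<lambda>t. M * (indicator A t *\<^sub>R k t))" using k by simp
    have [measurable]: "(\<lambda>t. indicator A t *\<^sub>R k t) \<in> borel_measurable lborel"
      "(\<lambda>t. flow_payoff (t - a) z i j) \<in> borel_measurable lborel"
      using k flow_payoff_measurable by auto
    have "(\<lambda>t. indicator A t *\<^sub>R (flow_payoff (t - a) z i j * k t)) = (\<lambda>t. flow_payoff (t - a) z i j * (indicator A t *\<^sub>R k t))"
      by auto
    then show "(\<lambda>t. indicator A t *\<^sub>R (flow_payoff (t - a) z i j * k t)) \<in> borel_measurable lborel"
      by (simp only:) measurable
    show "AE t in lborel. norm (indicator A t *\<^sub>R (flow_payoff (t - a) z i j * k t)) \<le> norm (M * (indicator A t *\<^sub>R k t))"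
      using assms M(1) by (intro AE_I2) (auto split: split_indicator simp: abs_mult intro!: mult_right_mono flow_payoff_bound)
  qed
qed

lemma flow_integrable_stage:
  "0 \<le> a \<Longrightarrow> set_integrable lborel {a..<b} (\<lambda>t. flow_payoff (t - a) z i j * k t)"
  by (intro flow_integrable) auto

lemma stage_payoff_bound:
  assumes "0 \<le> a" shows "\<bar>stage_payoff a b z i j\<bar> \<le> M * mass a b"
proof -
  have "\<bar>stage_payoff a b z i j\<bar> \<le> (LINT t:{a..<b}|lborel. \<bar>flow_payoff (t - a) z i j * k t\<bar>)"
    unfolding stage_payoff_def using set_integral_norm_bound[OF flow_integrable_stage[OF assms, of b z i j]] by simp
  also have "\<dots> \<le> (LINT t:{a..<b}|lborel. M * k t)"
    using assms by (intro set_integral_mono set_integrable_abs flow_integrable_stage set_integrable_mult_right k_integrable_on)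
      (auto simp: abs_mult k_nonneg intro!: mult_right_mono flow_payoff_bound)
  finally show ?thesis by (simp add: mass_def)
qed

lemma stage_payoff_cont:
  assumes "0 \<le> a" shows "continuous_on UNIV (\<lambda>(i, j). stage_payoff a b z i j)"
proof (subst continuous_on_sequentially, intro allI impI ballI)
  fix x :: "nat \<Rightarrow> 'i \<times> 'j" and y
  assume "(\<forall>n. x n \<in> UNIV) \<and> x \<longlonglongrightarrow> y"
  then have x: "x \<longlonglongrightarrow> y" by simp
  have int: "integrable lborel (\<lambda>t. indicator {a..<b} t *\<^sub>R (flow_payoff (t - a) z i j * k t))" for i j
    using flow_integrable_stage[OF assms] unfolding set_integrable_def .
  have "(\<lambda>n. \<integral>t. indicator {a..<b} t *\<^sub>R (flow_payoff (t - a) z (fst (x n)) (snd (x n)) * k t) \<partial>lborel)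
      \<longlonglongrightarrow> (\<integral>t. indicator {a..<b} t *\<^sub>R (flow_payoff (t - a) z (fst y) (snd y) * k t) \<partial>lborel)"
  proof (rule integral_dominated_convergence[where w = "\<lambda>t. M * (indicator {a..<b} t *\<^sub>R k t)"])
    show "integrable lborel (\<lambda>t. M * (indicator {a..<b} t *\<^sub>R k t))"
      using k_integrable_stage[OF assms] unfolding set_integrable_def by (rule integrable_mult_right)
    show "AE t in lborel. (\<lambda>n. indicator {a..<b} t *\<^sub>R (flow_payoff (t - a) z (fst (x n)) (snd (x n)) * k t))
        \<longlonglongrightarrow> indicator {a..<b} t *\<^sub>R (flow_payoff (t - a) z (fst y) (snd y) * k t)"
    proof (intro AE_I2 tendsto_intros)
      fix t
      have "continuous_on UNIV (\<lambda>p. flow_payoff (t - a) z (fst p) (snd p))"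
        by (intro flow_payoff_cont continuous_intros)
      from continuous_on_tendsto_compose[OF this x]
      show "(\<lambda>n. flow_payoff (t - a) z (fst (x n)) (snd (x n))) \<longlonglongrightarrow> flow_payoff (t - a) z (fst y) (snd y)" by simp
    qed
    show "AE t in lborel. norm (indicator {a..<b} t *\<^sub>R (flow_payoff (t - a) z (fst (x n)) (snd (x n)) * k t))
        \<le> M * (indicator {a..<b} t *\<^sub>R k t)" for n
      using assms by (intro AE_I2) (auto split: split_indicator simp: abs_mult k_nonneg intro!: mult_right_mono flow_payoff_bound)
  qed (use int in \<open>auto intro!: borel_measurable_integrable\<close>)
  then show "((\<lambda>(i, j). stage_payoff a b z i j) \<circ> x) \<longlonglongrightarrow> (case y of (i, j) \<Rightarrow> stage_payoff a b z i j)"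
    by (simp add: o_def case_prod_beta' stage_payoff_def set_lebesgue_integral_def)
qed

lemma belief_stage_payoff_cont:
  assumes "0 \<le> a" shows "continuous_on UNIV (\<lambda>(i, j). belief_stage_payoff a b \<zeta> i j)"
  using stage_payoff_cont[OF assms] unfolding belief_stage_payoff_def case_prod_beta'
  by (intro continuous_intros) auto

lemma belief_stage_payoff_bound:
  "0 \<le> a \<Longrightarrow> \<zeta> \<in> prob_vecs \<Longrightarrow> \<bar>belief_stage_payoff a b \<zeta> i j\<bar> \<le> M * mass a b"
  unfolding belief_stage_payoff_def by (rule weighted_abs_le[OF _ stage_payoff_bound])

text \<open>Freezing the state and the weight at the start of the stage costs O(b - a) at each time,
  since \<open>P\<close> is that close to the identity and \<open>k\<close> is Lipschitz;
  integration over the stage adds the second factor b - a.\<close>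

lemma stage_payoff_expansion:
  "\<exists>C\<ge>0. \<exists>h0>0. \<forall>a b. \<forall>\<zeta>\<in>prob_vecs. \<forall>i j. 0 \<le> a \<and> a \<le> b \<and> b - a \<le> h0 \<longrightarrow>
     \<bar>belief_stage_payoff a b \<zeta> i j - (b - a) * ((\<Sum>z\<in>UNIV. \<zeta> $ z * g z i j) * k a)\<bar> \<le> C * (b - a)\<^sup>2"
proof -
  obtain C h0 where C: "C \<ge> 0" "h0 > 0" and Ph: "\<And>h i j z. 0 \<le> h \<Longrightarrow> h \<le> h0 \<Longrightarrow>
      (\<Sum>z'\<in>UNIV. \<bar>P h i j $ z $ z' - mat 1 $ z $ z'\<bar>) \<le> C * h"
  proof -
    \<comment> \<open>In \<open>vP_expansion\<close> the row estimate stands under a quantifier over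
      beliefs; a point mass is supplied to reach it.\<close>
    have "(\<chi> z. if z = undefined then 1 else 0) \<in> (prob_vecs :: (real ^ 'w) set)" by (simp add: prob_vecs_def)
    then show thesis using vP_expansion that by blast
  qed
  obtain K where K: "K \<ge> 0" "\<And>t. t \<ge> 0 \<Longrightarrow> k t \<le> K" using k_bound by blast
  obtain L where L: "L-lipschitz_on {0..} k" using k_lipschitz by blast
  have L0: "L \<ge> 0" by (rule lipschitz_on_nonneg[OF L])
  \<comment> \<open>M * C * K comes from the motion of the state under a weight at most K, M * L
    from the variation of the weight under a payoff at most M.\<close>
  define D where "D = M * C * K + M * L"
  have D0: "D \<ge> 0" using M C K L0 by (simp add: D_def)
  have "\<bar>belief_stage_payoff a b \<zeta> i j - (b - a) * ((\<Sum>z\<in>UNIV. \<zeta> $ z * g z i j) * k a)\<bar> \<le> D * (b - a)\<^sup>2"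
    if \<zeta>: "\<zeta> \<in> prob_vecs" and ab: "0 \<le> a" "a \<le> b" "b - a \<le> h0" for a b \<zeta> i j
  proof -
    have pt: "\<bar>flow_payoff (t - a) z i j * k t - g z i j * k a\<bar> \<le> D * (b - a)" if t: "t \<in> {a..<b}" for t z
    proof -
      have "flow_payoff (t - a) z i j - g z i j = (\<Sum>z'\<in>UNIV. (P (t - a) i j $ z $ z' - mat 1 $ z $ z') * g z' i j)"
        by (simp add: flow_payoff_def left_diff_distrib sum_subtractf mat_def if_distrib[of "\<lambda>x. x * _"] cong: if_cong)
      also have "\<bar>\<dots>\<bar> \<le> (\<Sum>z'\<in>UNIV. \<bar>P (t - a) i j $ z $ z' - mat 1 $ z $ z'\<bar> * M)"
        by (rule order_trans[OF sum_abs]) (auto simp: abs_mult intro!: sum_mono mult_left_mono M)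
      also have "\<dots> \<le> C * (t - a) * M"
        unfolding sum_distrib_right[symmetric] using t ab M by (intro mult_right_mono Ph) auto
      also have "\<dots> \<le> C * (b - a) * M" using t C M by (intro mult_right_mono mult_left_mono) auto
      finally have f: "\<bar>flow_payoff (t - a) z i j - g z i j\<bar> \<le> C * (b - a) * M" .
      have "\<bar>k t - k a\<bar> \<le> L * \<bar>t - a\<bar>" using lipschitz_onD[OF L, of t a] t ab by (simp add: dist_real_def)
      also have "\<dots> \<le> L * (b - a)" using t L0 by (intro mult_left_mono) auto
      finally have kk: "\<bar>k t - k a\<bar> \<le> L * (b - a)" .
      have "flow_payoff (t - a) z i j * k t - g z i j * k a = (flow_payoff (t - a) z i j - g z i j) * k t + g z i j * (k t - k a)"
        by (simp add: algebra_simps)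
      also have "\<bar>\<dots>\<bar> \<le> (C * (b - a) * M) * K + M * (L * (b - a))"
        using f kk K(2)[of t] k_nonneg[of t] M K t ab C
        by (intro order_trans[OF abs_triangle_ineq] add_mono) (auto simp: abs_mult intro!: mult_mono)
      finally show ?thesis by (simp add: D_def algebra_simps)
    qed
    have "\<bar>stage_payoff a b z i j - (b - a) * (g z i j * k a)\<bar> \<le> D * (b - a)\<^sup>2" for z
    proof -
      have c: "set_integrable lborel {a..<b} (\<lambda>t. c :: real)" for c
        unfolding set_integrable_def using ab
        by (intro integrable_scaleR_left integrable_real_indicator) auto
      have ci: "(LINT t:{a..<b}|lborel. c) = (b - a) * c" for c :: real using ab by (simp add: set_lebesgue_integral_def)
      have fi: "set_integrable lborel {a..<b} (\<lambda>t. flow_payoff (t - a) z i j * k t)" using ab by (intro flow_integrable_stage)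
      have "stage_payoff a b z i j - (b - a) * (g z i j * k a) = (LINT t:{a..<b}|lborel. flow_payoff (t - a) z i j * k t - g z i j * k a)"
        unfolding stage_payoff_def by (subst set_integral_diff(2)[OF fi c]) (simp add: ci)
      also have "\<bar>\<dots>\<bar> \<le> (LINT t:{a..<b}|lborel. \<bar>flow_payoff (t - a) z i j * k t - g z i j * k a\<bar>)"
        using set_integral_norm_bound[OF set_integral_diff(1)[OF fi c[of "g z i j * k a"]]] by simp
      also have "\<dots> \<le> (LINT t:{a..<b}|lborel. D * (b - a))"
        by (intro set_integral_mono c set_integrable_abs set_integral_diff(1)[OF fi c] pt)
      finally show ?thesis by (simp add: ci power2_eq_square mult_ac)
    qed
    from weighted_abs_le[OF \<zeta> this] show ?thesis
      by (simp add: belief_stage_payoff_def right_diff_distrib sum_subtractf sum_distrib_left sum_distrib_right mult_ac)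
  qed
  with D0 C(2) show ?thesis by blast
qed

text \<open>The dynamic programming operator of the game whose state is the belief. The continuation
  sits inside the stage game because the actions, once played, are public and determine the next
  belief.\<close>

definition shapley where
  "shapley a b w \<zeta> = mixed_value (\<lambda>i j. belief_stage_payoff a b \<zeta> i j + w (\<zeta> v* P (b - a) i j))"

lemma shapley_cont:
  assumes "0 \<le> a" "a \<le> b" "continuous_on prob_vecs w" "\<zeta> \<in> prob_vecs"
  shows "continuous_on UNIV (\<lambda>(i, j). belief_stage_payoff a b \<zeta> i j + w (\<zeta> v* P (b - a) i j))"
proof -
  have "continuous_on UNIV (\<lambda>p :: 'i \<times> 'j. \<zeta> v* P (b - a) (fst p) (snd p))"
    unfolding vector_matrix_mult_def by (intro continuous_intros P_cont continuous_on_vec_lambda)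
  then have "continuous_on UNIV (\<lambda>p :: 'i \<times> 'j. w (\<zeta> v* P (b - a) (fst p) (snd p)))"
    by (rule continuous_on_compose2[OF assms(3)]) (use assms vP_prob in auto)
  then show ?thesis using belief_stage_payoff_cont[OF assms(1), of b \<zeta>] unfolding case_prod_beta'
    by (intro continuous_intros) auto
qed

lemma shapley_mono:
  assumes "0 \<le> a" "a \<le> b" "continuous_on prob_vecs w" "continuous_on prob_vecs w'" "\<zeta> \<in> prob_vecs"
    and "\<And>\<zeta>. \<zeta> \<in> prob_vecs \<Longrightarrow> w \<zeta> \<le> w' \<zeta> + d"
  shows "shapley a b w \<zeta> \<le> shapley a b w' \<zeta> + d"
  unfolding shapley_def using assms
  by (intro mixed_value_mono shapley_cont) (auto simp: vP_prob)

lemma shapley_bound: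
  assumes ab: "0 \<le> a" "a \<le> b" and c: "continuous_on prob_vecs w" and \<zeta>: "\<zeta> \<in> prob_vecs"
    and w: "\<And>\<zeta>. \<zeta> \<in> prob_vecs \<Longrightarrow> \<bar>w \<zeta>\<bar> \<le> B"
  shows "\<bar>shapley a b w \<zeta>\<bar> \<le> M * mass a b + B"
proof -
  have b: "\<bar>belief_stage_payoff a b \<zeta> i j + w (\<zeta> v* P (b - a) i j)\<bar> \<le> M * mass a b + B" for i j
    using belief_stage_payoff_bound[OF ab(1) \<zeta>, of b i j] w[OF vP_prob[of "b - a" \<zeta> i j]] ab \<zeta> by auto
  have "shapley a b w \<zeta> \<le> mixed_value (\<lambda>(i::'i) (j::'j). 0) + (M * mass a b + B)"
    unfolding shapley_def using b
    by (intro mixed_value_mono shapley_cont[OF ab c \<zeta>]) (auto simp: abs_le_iff case_prod_beta')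
  moreover have "mixed_value (\<lambda>(i::'i) (j::'j). 0) \<le> shapley a b w \<zeta> + (M * mass a b + B)"
    unfolding shapley_def
  proof (intro mixed_value_mono shapley_cont[OF ab c \<zeta>])
    show "0 \<le> belief_stage_payoff a b \<zeta> i j + w (\<zeta> v* P (b - a) i j) + (M * mass a b + B)" for i j
      using b[of i j] by linarith
  qed (simp add: case_prod_beta')
  ultimately show ?thesis by (simp add: mixed_value_const)
qed

lemma stage_game_lipschitz:
  assumes ab: "0 \<le> a" "a \<le> b" and w: "l1_lipschitz L w" and L: "L \<ge> 0"
    and \<zeta>: "\<zeta> \<in> prob_vecs" "\<zeta>' \<in> prob_vecs"
  shows "belief_stage_payoff a b \<zeta> i j + w (\<zeta> v* P (b - a) i j)
      \<le> belief_stage_payoff a b \<zeta>' i j + w (\<zeta>' v* P (b - a) i j) + (M * mass a b + L) * l1 (\<zeta> - \<zeta>')"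
proof -
  have "\<bar>belief_stage_payoff a b \<zeta> i j - belief_stage_payoff a b \<zeta>' i j\<bar> \<le> M * mass a b * l1 (\<zeta> - \<zeta>')"
    unfolding belief_stage_payoff_def by (rule weighted_diff_le[OF stage_payoff_bound[OF ab(1)]])
  moreover have "\<bar>w (\<zeta> v* P (b - a) i j) - w (\<zeta>' v* P (b - a) i j)\<bar> \<le> L * l1 (\<zeta> v* P (b - a) i j - \<zeta>' v* P (b - a) i j)"
    using ab by (intro l1_lipschitzD[OF w] vP_prob \<zeta>) auto
  moreover have "L * l1 (\<zeta> v* P (b - a) i j - \<zeta>' v* P (b - a) i j) \<le> L * l1 (\<zeta> - \<zeta>')"
    using ab L by (intro mult_left_mono vP_l1) auto
  ultimately show ?thesis by (simp add: distrib_right)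
qed

text \<open>With L = M * tail b the new constant is M * tail a by \<open>mass_tail\<close>, so the
  form M * tail is reproduced from stage to stage and the constants never exceed M.\<close>

lemma shapley_lipschitz:
  assumes ab: "0 \<le> a" "a \<le> b" and w: "l1_lipschitz L w" and L: "L \<ge> 0"
  shows "l1_lipschitz (M * mass a b + L) (shapley a b w)"
proof -
  note wc = l1_lipschitz_continuous[OF w]
  have le: "shapley a b w \<zeta> \<le> shapley a b w \<zeta>' + (M * mass a b + L) * l1 (\<zeta> - \<zeta>')"
    if \<zeta>: "\<zeta> \<in> prob_vecs" "\<zeta>' \<in> prob_vecs" for \<zeta> \<zeta>'
    unfolding shapley_def
    by (rule mixed_value_mono[OF shapley_cont[OF ab wc \<zeta>(1)] shapley_cont[OF ab wc \<zeta>(2)]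
        stage_game_lipschitz[OF ab w L \<zeta>]])
  have "\<bar>shapley a b w \<zeta> - shapley a b w \<zeta>'\<bar> \<le> (M * mass a b + L) * l1 (\<zeta> - \<zeta>')"
    if \<zeta>: "\<zeta> \<in> prob_vecs" "\<zeta>' \<in> prob_vecs" for \<zeta> \<zeta>'
  proof -
    have "l1 (\<zeta>' - \<zeta>) = l1 (\<zeta> - \<zeta>')" by (simp add: l1_def abs_minus_commute)
    then show ?thesis using le[OF \<zeta>] le[OF \<zeta>(2,1)] by (simp add: abs_le_iff)
  qed
  then show ?thesis unfolding l1_lipschitz_def by blast
qed

end

lemma time_partition_mono: "time_partition s \<Longrightarrow> n \<le> m \<Longrightarrow> s n \<le> s m"
  by (simp add: time_partition_def strict_mono_less_eq)

lemma time_partition_nonneg: "time_partition s \<Longrightarrow> 0 \<le> s n"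
  using time_partition_mono[of s 0 n] by (simp add: time_partition_def)

context unobserved_game
begin

section \<open>The recursive equation\<close>

text \<open>Backward induction over \<open>m\<close> stages starting at stage \<open>n\<close>, with
  nothing paid afterwards.\<close>

primrec finite_value where
  "finite_value s 0 n = (\<lambda>\<zeta>. 0)"
| "finite_value s (Suc m) n = shapley (s n) (s (Suc n)) (finite_value s m (Suc n))"

context
  fixes s assumes s: "time_partition s"
begin

lemma time_nonneg: "0 \<le> s n" and time_step: "s n \<le> s (Suc n)"
  using time_partition_nonneg[OF s] time_partition_mono[OF s] by auto

lemma finite_value_lipschitz: "l1_lipschitz (M * tail (s n)) (finite_value s m n)"
proof (induction m arbitrary: n)
  case 0 then show ?case
    using M(1) by (auto simp: l1_lipschitz_def intro!: mult_nonneg_nonneg tail_nonneg time_nonneg)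
next
  case (Suc m)
  from shapley_lipschitz[OF time_nonneg time_step Suc[of "Suc n"]] M(1)
  have "l1_lipschitz (M * mass (s n) (s (Suc n)) + M * tail (s (Suc n))) (finite_value s (Suc m) n)"
    by (auto intro!: mult_nonneg_nonneg tail_nonneg time_nonneg)
  then show ?case by (simp add: mass_tail[OF time_nonneg[of n] time_step[of n]] distrib_left)
qed

lemma finite_value_bound: "\<zeta> \<in> prob_vecs \<Longrightarrow> \<bar>finite_value s m n \<zeta>\<bar> \<le> M * tail (s n)"
proof (induction m arbitrary: n \<zeta>)
  case 0 then show ?case using M(1) by (auto intro!: mult_nonneg_nonneg tail_nonneg time_nonneg)
next
  case (Suc m)
  from shapley_bound[OF time_nonneg time_step l1_lipschitz_continuous[OF finite_value_lipschitz] Suc.prems Suc.IH]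
  show ?case by (simp add: mass_tail[OF time_nonneg[of n] time_step[of n]] distrib_left)
qed

text \<open>The two games differ only by the terminal function at stage n + m, which is at most M
  times the tail there; by monotonicity the operator carries this error back without enlarging
  it.\<close>

lemma finite_value_diff:
  "\<zeta> \<in> prob_vecs \<Longrightarrow> \<bar>finite_value s (m + d) n \<zeta> - finite_value s m n \<zeta>\<bar> \<le> M * tail (s (n + m))"
proof (induction m arbitrary: n \<zeta>)
  case 0 then show ?case using finite_value_bound[of \<zeta> d n] by simp
next
  case (Suc m)
  note c = l1_lipschitz_continuous[OF finite_value_lipschitz]
  have "finite_value s (m + d) (Suc n) \<zeta> \<le> finite_value s m (Suc n) \<zeta> + M * tail (s (Suc n + m))"
    "finite_value s m (Suc n) \<zeta> \<le> finite_value s (m + d) (Suc n) \<zeta> + M * tail (s (Suc n + m))"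
    if "\<zeta> \<in> prob_vecs" for \<zeta> using Suc.IH[OF that, of "Suc n"] by (auto simp: abs_le_iff)
  from shapley_mono[OF time_nonneg[of n] time_step[of n] c c Suc.prems this(1)] shapley_mono[OF time_nonneg[of n] time_step[of n] c c Suc.prems this(2)]
  show ?case by (auto simp: abs_le_iff)
qed

lemma tail_shift: "(\<lambda>m. M * tail (s (n + m))) \<longlonglongrightarrow> 0"
proof -
  have "filterlim (\<lambda>m. s (n + m)) at_top sequentially"
  proof -
    have "filterlim s at_top sequentially" using s by (simp add: time_partition_def)
    moreover have "filterlim ((+) n) sequentially sequentially" by (rule filterlim_subseq) (simp add: strict_mono_def)
    ultimately show ?thesis by (rule filterlim_compose)
  qed
  from tendsto_mult_left[OF tail_tendsto[OF this time_nonneg], of M] show ?thesis by simp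
qed

text \<open>The operator \<open>shapley\<close> commutes with adding constants, so it does not
  contract. The truncated values are Cauchy because the weight left after the truncation time
  vanishes, and all estimates pass to the limit.\<close>

lemma recursive_value_exists:
  obtains W where "\<And>n. l1_lipschitz (M * tail (s n)) (W n)"
    "\<And>n \<zeta>. \<zeta> \<in> prob_vecs \<Longrightarrow> \<bar>W n \<zeta>\<bar> \<le> M * tail (s n)"
    "\<And>n \<zeta>. \<zeta> \<in> prob_vecs \<Longrightarrow> W n \<zeta> = shapley (s n) (s (Suc n)) (W (Suc n)) \<zeta>"
proof -
  define W where "W n \<zeta> = lim (\<lambda>m. finite_value s m n \<zeta>)" for n \<zeta>
  have lim: "(\<lambda>m. finite_value s m n \<zeta>) \<longlonglongrightarrow> W n \<zeta>" if \<zeta>: "\<zeta> \<in> prob_vecs" for n \<zeta>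
  proof -
    have "Cauchy (\<lambda>m. finite_value s m n \<zeta>)"
    proof (rule metric_CauchyI)
      fix e :: real assume "e > 0"
      then obtain N where N: "\<And>m. m \<ge> N \<Longrightarrow> \<bar>M * tail (s (n + m))\<bar> < e / 2"
        using LIMSEQ_D[OF tail_shift, of "e / 2" n] by auto
      have near: "\<bar>finite_value s m n \<zeta> - finite_value s N n \<zeta>\<bar> < e / 2" if "m \<ge> N" for m
        using finite_value_diff[OF \<zeta>, of N "m - N" n] N[of N] that by simp
      have "dist (finite_value s m n \<zeta>) (finite_value s m' n \<zeta>) < e" if "m \<ge> N" "m' \<ge> N" for m m'
        using near[OF that(1)] near[OF that(2)] unfolding dist_real_def by linarith
      then show "\<exists>N. \<forall>m\<ge>N. \<forall>m'\<ge>N. dist (finite_value s m n \<zeta>) (finite_value s m' n \<zeta>) < e" by blast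
    qed
    then show ?thesis unfolding W_def by (simp add: Cauchy_convergent_iff convergent_LIMSEQ_iff)
  qed
  have lip: "l1_lipschitz (M * tail (s n)) (W n)" for n
    unfolding l1_lipschitz_def
  proof (intro ballI)
    fix \<zeta> \<zeta>' :: "real ^ 'w" assume \<zeta>: "\<zeta> \<in> prob_vecs" "\<zeta>' \<in> prob_vecs"
    have "(\<lambda>m. \<bar>finite_value s m n \<zeta> - finite_value s m n \<zeta>'\<bar>) \<longlonglongrightarrow> \<bar>W n \<zeta> - W n \<zeta>'\<bar>"
      by (intro tendsto_intros lim \<zeta>)
    then show "\<bar>W n \<zeta> - W n \<zeta>'\<bar> \<le> M * tail (s n) * l1 (\<zeta> - \<zeta>')"
      by (rule LIMSEQ_le_const2) (use l1_lipschitzD[OF finite_value_lipschitz \<zeta>] in blast)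
  qed
  have bound: "\<bar>W n \<zeta>\<bar> \<le> M * tail (s n)" if "\<zeta> \<in> prob_vecs" for n \<zeta>
    by (rule LIMSEQ_le_const2[OF tendsto_rabs[OF lim[OF that]]]) (use finite_value_bound[OF that] in blast)
  have diff: "\<bar>finite_value s m n \<zeta> - W n \<zeta>\<bar> \<le> M * tail (s (n + m))" if \<zeta>: "\<zeta> \<in> prob_vecs" for m n \<zeta>
  proof -
    have "(\<lambda>d. finite_value s (d + m) n \<zeta>) \<longlonglongrightarrow> W n \<zeta>" by (rule LIMSEQ_ignore_initial_segment[OF lim[OF \<zeta>]])
    then have "(\<lambda>d. \<bar>finite_value s (d + m) n \<zeta> - finite_value s m n \<zeta>\<bar>) \<longlonglongrightarrow> \<bar>W n \<zeta> - finite_value s m n \<zeta>\<bar>"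
      by (intro tendsto_intros)
    from LIMSEQ_le_const2[OF this, of "M * tail (s (n + m))"] finite_value_diff[OF \<zeta>, of m _ n] show ?thesis
      by (auto simp: abs_minus_commute add.commute)
  qed
  have rec: "W n \<zeta> = shapley (s n) (s (Suc n)) (W (Suc n)) \<zeta>" if \<zeta>: "\<zeta> \<in> prob_vecs" for n \<zeta>
  proof -
    note cW = l1_lipschitz_continuous[OF lip] and cf = l1_lipschitz_continuous[OF finite_value_lipschitz]
    have le: "\<bar>finite_value s (Suc m) n \<zeta> - shapley (s n) (s (Suc n)) (W (Suc n)) \<zeta>\<bar> \<le> M * tail (s (Suc n + m))" for m
    proof -
      have "finite_value s m (Suc n) \<zeta> \<le> W (Suc n) \<zeta> + M * tail (s (Suc n + m))"
        "W (Suc n) \<zeta> \<le> finite_value s m (Suc n) \<zeta> + M * tail (s (Suc n + m))"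
        if "\<zeta> \<in> prob_vecs" for \<zeta> using diff[OF that, of m "Suc n"] by (auto simp: abs_le_iff)
      from shapley_mono[OF time_nonneg[of n] time_step[of n] cf cW \<zeta> this(1)] shapley_mono[OF time_nonneg[of n] time_step[of n] cW cf \<zeta> this(2)]
      show ?thesis by (auto simp: abs_le_iff)
    qed
    have "(\<lambda>m. finite_value s (Suc m) n \<zeta> - shapley (s n) (s (Suc n)) (W (Suc n)) \<zeta>) \<longlonglongrightarrow> 0"
      by (rule Lim_null_comparison[OF always_eventually tail_shift[of "Suc n"]]) (use le in simp)
    then have "(\<lambda>m. finite_value s (Suc m) n \<zeta>) \<longlonglongrightarrow> shapley (s n) (s (Suc n)) (W (Suc n)) \<zeta>"
      by (rule LIM_zero_cancel)
    moreover have "(\<lambda>m. finite_value s (Suc m) n \<zeta>) \<longlonglongrightarrow> W n \<zeta>" by (rule LIMSEQ_Suc[OF lim[OF \<zeta>]])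
    ultimately show ?thesis by (rule LIMSEQ_unique[rotated])
  qed
  from lip bound rec show thesis by (rule that)
qed

end

end

section \<open>The law of the play\<close>

lemma state_law_integral:
  fixes f :: "'w::finite \<Rightarrow> real"
  assumes "p \<in> prob_vecs"
  shows "(\<integral>z. f z \<partial>state_law p) = (\<Sum>z\<in>UNIV. p $ z * f z)"
  unfolding state_law_def using assms
  by (subst integral_density) (auto simp: prob_vecsD lebesgue_integral_count_space_finite)

lemma state_law_emeasure:
  "emeasure (state_law p) A = (\<Sum>z\<in>UNIV. ennreal (p $ z) * indicator A z)" for p :: "real ^ 'w::finite"
  by (simp add: state_law_def emeasure_density nn_integral_count_space_finite)

lemma prob_space_state_law:
  assumes "p \<in> prob_vecs" shows "prob_space (state_law (p :: real ^ 'w::finite))"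
proof
  have "(\<Sum>z\<in>UNIV. ennreal (p $ z)) = ennreal (\<Sum>z\<in>UNIV. p $ z)"
    using assms by (intro sum_ennreal) (simp add: prob_vecsD)
  then have "(\<Sum>z\<in>UNIV. ennreal (p $ z)) = 1" unfolding prob_vecsD(2)[OF assms] by simp
  moreover have "space (state_law p) = UNIV" by (simp add: state_law_def)
  ultimately show "emeasure (state_law p) (space (state_law p)) = 1" by (simp add: state_law_emeasure)
qed

lemma state_law_measurable:
  fixes p :: "'a \<Rightarrow> real ^ 'w::finite"
  assumes "\<And>z. (\<lambda>x. p x $ z) \<in> borel_measurable N" "\<And>x. x \<in> space N \<Longrightarrow> p x \<in> prob_vecs"
  shows "(\<lambda>x. state_law (p x)) \<in> N \<rightarrow>\<^sub>M prob_algebra (count_space UNIV)"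
proof (rule measurable_prob_algebraI)
  note [measurable] = assms(1)
  show "(\<lambda>x. state_law (p x)) \<in> N \<rightarrow>\<^sub>M subprob_algebra (count_space UNIV)"
  proof (rule measurable_subprob_algebra)
    show "subprob_space (state_law (p x))" if "x \<in> space N" for x
      using that by (intro prob_space_imp_subprob_space prob_space_state_law assms(2))
    show "sets (state_law (p x)) = sets (count_space UNIV)" for x by (simp add: state_law_def)
    show "(\<lambda>x. emeasure (state_law (p x)) A) \<in> borel_measurable N" for A
      unfolding state_law_emeasure by measurable
  qed
qed (use assms(2) prob_space_state_law in blast)

lemma (in prob_space) abs_integral_le:
  fixes f :: "'a \<Rightarrow> real"
  assumes "integrable M f" "\<And>x. \<bar>f x\<bar> \<le> c" shows "\<bar>\<integral>x. f x \<partial>M\<bar> \<le> c"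
proof -
  have "(\<integral>x. \<bar>f x\<bar> \<partial>M) \<le> c" using assms by (intro integral_le_const) auto
  then show ?thesis using integral_abs_bound[of M f] by linarith
qed

lemma measurable_component_compose:
  assumes "f \<in> N \<rightarrow>\<^sub>M K" "i \<in> I"
  shows "(\<lambda>x. f (x i)) \<in> (\<Pi>\<^sub>M l\<in>I. N) \<rightarrow>\<^sub>M K"
proof -
  have "(\<lambda>x. x i) \<in> (\<Pi>\<^sub>M l\<in>I. N) \<rightarrow>\<^sub>M N" by (rule measurable_component_singleton) fact
  then show ?thesis by (rule measurable_compose) fact
qed

text \<open>The integrand depends on the parameter as well as the measure does. Pushing
  \<open>K x\<close> forward to the pairs (x, y) makes the integrand a fixed function, integrated
  against a kernel.\<close>

lemma kernel_integral_measurable: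
  fixes f :: "'a \<Rightarrow> 'b \<Rightarrow> real"
  assumes f: "(\<lambda>(x, y). f x y) \<in> borel_measurable (A \<Otimes>\<^sub>M N)" and K[measurable]: "K \<in> A \<rightarrow>\<^sub>M subprob_algebra N"
  shows "(\<lambda>x. \<integral>y. f x y \<partial>K x) \<in> borel_measurable A"
proof -
  note measurable_distr2[measurable] and f[measurable]
  have "(\<lambda>x. integral\<^sup>L (distr (K x) (A \<Otimes>\<^sub>M N) (\<lambda>y. (x, y))) (\<lambda>(x, y). f x y)) \<in> borel_measurable A"
    by measurable
  then show ?thesis
  proof (rule measurable_cong[THEN iffD1, rotated])
    show "integral\<^sup>L (distr (K x) (A \<Otimes>\<^sub>M N) (\<lambda>y. (x, y))) (\<lambda>(x, y). f x y) = (\<integral>y. f x y \<partial>K x)"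
      if "x \<in> space A" for x
      using that by (subst integral_distr) (simp_all add: measurable_cong_sets[OF sets_kernel[OF K that] refl])
  qed
qed

text \<open>The times may start at any nonnegative \<open>s 0\<close>: the game from a later
  partition time is played on the shifted sequence, whose first time is no longer 0.\<close>

locale subgame = unobserved_game g k q
  for g :: "'w::finite \<Rightarrow> 'i::compact_metric_space \<Rightarrow> 'j::compact_metric_space \<Rightarrow> real" and k q +
  fixes s :: "nat \<Rightarrow> real" and \<zeta>0 :: "real ^ 'w"
  assumes s0: "0 \<le> s 0" and s_mono: "strict_mono s" and s_top: "filterlim s at_top sequentially"
    and \<zeta>0: "\<zeta>0 \<in> prob_vecs"
begin

lemma s_nonneg: "0 \<le> s n" and s_step: "s n \<le> s (Suc n)"
proof -
  have "s 0 \<le> s n" using s_mono by (simp add: strict_mono_less_eq)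
  then show "0 \<le> s n" using s0 by simp
  show "s n \<le> s (Suc n)" using s_mono by (simp add: strict_mono_less_eq)
qed

abbreviation act :: "('i \<times> 'j) measure" where "act \<equiv> borel \<Otimes>\<^sub>M borel"
abbreviation Acts where "Acts n \<equiv> (\<Pi>\<^sub>M l\<in>{0..<n::nat}. act)"

text \<open>No signal about the state is ever received, so there is no Bayesian updating: the belief
  is a deterministic function of the past actions, and both players can compute it.\<close>

primrec belief :: "nat \<Rightarrow> (nat \<Rightarrow> 'i \<times> 'j) \<Rightarrow> real ^ 'w" where
  "belief 0 a = \<zeta>0"
| "belief (Suc n) a = belief n a v* P (s (Suc n) - s n) (fst (a n)) (snd (a n))"

lemma belief_prob: "belief n a \<in> prob_vecs"
  by (induction n) (auto simp: \<zeta>0 s_step intro!: vP_prob)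

lemma belief_cong: "(\<And>l. l < n \<Longrightarrow> a l = b l) \<Longrightarrow> belief n a = belief n b"
  by (induction n) auto

lemma belief_measurable: "n \<le> m \<Longrightarrow> belief n \<in> borel_measurable (Acts m)"
proof (induction n)
  case 0 then show ?case by simp
next
  case (Suc n)
  have a: "(\<lambda>a. a n) \<in> Acts m \<rightarrow>\<^sub>M borel"
    using measurable_component_singleton[of n "{0..<m}" "\<lambda>_. act"] Suc by (simp add: borel_prod)
  have "continuous_on UNIV (\<lambda>x :: (real ^ 'w) \<times> ('i \<times> 'j). fst x v* P (s (Suc n) - s n) (fst (snd x)) (snd (snd x)))"
    unfolding vector_matrix_mult_def by (intro continuous_on_vec_lambda continuous_intros P_cont)
  from borel_measurable_continuous_Pair[OF Suc.IH a, where H = "\<lambda>b x. b v* P (s (Suc n) - s n) (fst x) (snd x)", OF _ this] Suc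
  show ?case by simp
qed

end

section \<open>Laws of finite and infinite plays under a fixed pair of strategies\<close>

locale play = subgame g k q s \<zeta>0
  for g :: "'w::finite \<Rightarrow> 'i::compact_metric_space \<Rightarrow> 'j::compact_metric_space \<Rightarrow> real" and k q s \<zeta>0 +
  fixes \<sigma> :: "nat \<Rightarrow> (nat \<Rightarrow> 'i \<times> 'j) \<Rightarrow> 'i measure" and \<tau> :: "nat \<Rightarrow> (nat \<Rightarrow> 'i \<times> 'j) \<Rightarrow> 'j measure"
  assumes \<sigma>: "\<sigma> \<in> strategies" and \<tau>: "\<tau> \<in> strategies"
begin

definition actions :: "nat \<Rightarrow> (nat \<Rightarrow> 'w \<times> 'i \<times> 'j) \<Rightarrow> nat \<Rightarrow> 'i \<times> 'j"
  where "actions n h = (\<lambda>l\<in>{0..<n}. snd (h l))"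
abbreviation Hist where "Hist n \<equiv> (\<Pi>\<^sub>M l\<in>{0..<n}. (stage_space :: ('w \<times> 'i \<times> 'j) measure))"

lemma actions_measurable: "actions n \<in> Hist n \<rightarrow>\<^sub>M Acts n"
  unfolding stage_space_def actions_def[abs_def]
  by (intro measurable_restrict measurable_component_compose[OF measurable_snd])

lemma strategies_measurable:
  "\<sigma> n \<in> Acts n \<rightarrow>\<^sub>M prob_algebra borel" "\<tau> n \<in> Acts n \<rightarrow>\<^sub>M prob_algebra borel"
  using \<sigma> \<tau> by (auto simp: strategies_def)

lemma strategies_regular:
  assumes "a \<in> space (Acts n)" shows "\<sigma> n a \<in> regular_probs" "\<tau> n a \<in> regular_probs"
  using measurable_space[OF strategies_measurable(1) assms] measurable_space[OF strategies_measurable(2) assms]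
  by (simp_all add: regular_probs_eq)

lemma mixed_measurable: "(\<lambda>a. \<sigma> n a \<Otimes>\<^sub>M \<tau> n a) \<in> Acts n \<rightarrow>\<^sub>M prob_algebra act"
  by (intro measurable_pair_prob strategies_measurable)

lemma P_entry_measurable: "(\<lambda>a. P h (fst a) (snd a) $ z $ z') \<in> borel_measurable act"
  unfolding borel_prod by (intro borel_measurable_continuous_onI continuous_intros P_cont)

lemma P_stage_measurable:
  "(\<lambda>x. P h (fst (snd x)) (snd (snd x)) $ fst x $ z') \<in> borel_measurable stage_space"
  unfolding stage_space_def
  by (rule measurable_pair_measure_countable1) (auto intro: P_entry_measurable)

lemma stage_payoff_measurable:
  "0 \<le> a \<Longrightarrow> (\<lambda>x. stage_payoff a b (fst x) (fst (snd x)) (snd (snd x))) \<in> borel_measurable stage_space"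
  unfolding stage_space_def
  by (rule measurable_pair_measure_countable1)
    (auto intro: continuous_Pair_measurable(1) stage_payoff_cont)

lemma next_state_probs_Suc:
  "next_state_probs q s \<zeta>0 (Suc m) h = P (s (Suc m) - s m) (fst (snd (h m))) (snd (snd (h m))) $ fst (h m)"
  by (simp add: next_state_probs_def case_prod_beta')

lemma next_state_probs_prob: "next_state_probs q s \<zeta>0 n h \<in> prob_vecs"
proof (cases n)
  case 0 then show ?thesis by (simp add: next_state_probs_def \<zeta>0)
next
  case (Suc m) then show ?thesis using s_step by (simp add: next_state_probs_Suc P_row)
qed

lemma next_state_probs_measurable: "(\<lambda>h. next_state_probs q s \<zeta>0 n h $ z) \<in> borel_measurable (Hist n)"
proof (cases n)
  case 0 then show ?thesis by (simp add: next_state_probs_def)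
next
  case (Suc m)
  then show ?thesis unfolding Suc next_state_probs_Suc
    by (intro measurable_component_compose[OF P_stage_measurable]) auto
qed

lemma stage_kernel_eq:
  "stage_kernel q s \<zeta>0 \<sigma> \<tau> n h =
    state_law (next_state_probs q s \<zeta>0 n h) \<Otimes>\<^sub>M (\<sigma> n (actions n h) \<Otimes>\<^sub>M \<tau> n (actions n h))"
  by (simp add: stage_kernel_def actions_def Let_def)

lemma stage_kernel_measurable:
  "stage_kernel q s \<zeta>0 \<sigma> \<tau> n \<in> Hist n \<rightarrow>\<^sub>M prob_algebra stage_space"
proof -
  have "stage_kernel q s \<zeta>0 \<sigma> \<tau> n \<in> Hist n \<rightarrow>\<^sub>M prob_algebra (count_space UNIV \<Otimes>\<^sub>M act)"
    unfolding stage_kernel_eq[abs_def]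
    by (intro measurable_pair_prob state_law_measurable next_state_probs_measurable next_state_probs_prob
      measurable_compose[OF actions_measurable strategies_measurable(1)]
      measurable_compose[OF actions_measurable strategies_measurable(2)])
  then show ?thesis by (simp only: stage_space_def)
qed

sublocale IT: Ionescu_Tulcea "stage_kernel q s \<zeta>0 \<sigma> \<tau>" "\<lambda>_. stage_space"
proof (rule Ionescu_Tulcea.intro, goal_cases)
  case (1 n)
  show ?case by (rule measurable_prob_algebraD[OF stage_kernel_measurable])
next
  case (2 n h)
  from measurable_space[OF stage_kernel_measurable 2] show ?case by (simp add: space_prob_algebra)
qed

abbreviation L where "L \<equiv> play_law q s \<zeta>0 \<sigma> \<tau>"
text \<open>The marginal of \<open>L\<close> on the first \<open>n\<close> stages
  (\<open>distr_L\<close>), where quantities that depend on finitely many stages are integrated. The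
  argument \<open>\<lambda>_. undefined\<close> is the only history of length 0.\<close>

abbreviation Q where "Q n \<equiv> IT.C 0 n (\<lambda>_. undefined)"

lemma L_eq: "L = IT.PF.lim" by (simp add: play_law_def)

lemma sets_L: "sets L = sets (\<Pi>\<^sub>M l\<in>UNIV. stage_space)" by (simp add: L_eq)

lemma Q_prob: "prob_space (Q n)" by (rule IT.prob_space_C) simp

lemma sets_Q: "sets (Q n) = sets (Hist n)" using IT.sets_C[of "\<lambda>_. undefined" 0 n] by simp

lemma distr_L: "distr L (Hist n) (\<lambda>h. restrict h {0..<n}) = Q n"
proof -
  have "IT.up_to {0..<n} = n"
    unfolding IT.up_to_def
  proof (rule Least_equality)
    fix m assume "\<forall>i\<ge>m. i \<notin> {0..<n}"
    then have "m \<notin> {0..<n}" by blast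
    then show "n \<le> m" by simp
  qed auto
  then have "IT.CI {0..<n} = distr (Q n) (Hist n) (\<lambda>h. restrict h {0..<n})" by (simp add: IT.CI_def)
  also have "\<dots> = Q n" using IT.distr_C[of n n "\<lambda>_. undefined" 0] by simp
  finally show ?thesis using IT.distr_lim[of "{0..<n}"] by (simp add: L_eq)
qed

lemma restrict_measurable_L: "(\<lambda>h. restrict h {0..<n}) \<in> L \<rightarrow>\<^sub>M Hist n"
  unfolding measurable_cong_sets[OF sets_L refl] by (intro measurable_restrict measurable_component_singleton) auto

lemma L_prob: "prob_space L"
proof (rule prob_space_distrD[OF restrict_measurable_L[of 0]])
  show "prob_space (distr L (Hist 0) (\<lambda>h. restrict h {0..<0}))" unfolding distr_L by (rule Q_prob)
qed

lemma L_integral: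
  fixes F :: "_ \<Rightarrow> real"
  assumes "F \<in> borel_measurable (Hist n)" "\<And>h. F (restrict h {0..<n}) = F h"
  shows "(\<integral>h. F h \<partial>L) = (\<integral>h. F h \<partial>Q n)" "F \<in> borel_measurable L"
proof -
  show "(\<integral>h. F h \<partial>L) = (\<integral>h. F h \<partial>Q n)"
    unfolding distr_L[of n, symmetric] by (subst integral_distr[OF restrict_measurable_L assms(1)]) (simp add: assms(2))
  show "F \<in> borel_measurable L"
    using measurable_compose[OF restrict_measurable_L assms(1)] by (simp add: assms(2))
qed

lemma upd_measurable:
  "(\<lambda>(h, x). fun_upd h n x) \<in> Hist n \<Otimes>\<^sub>M stage_space \<rightarrow>\<^sub>M Hist (Suc n)"
  unfolding case_prod_beta'
  by (rule measurable_fun_upd[where J = "{0..<n}"]) (auto simp: atLeast0_lessThan_Suc)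

text \<open>One step of the Ionescu-Tulcea construction: the kernel \<open>IT.eP n\<close> appends a
  stage drawn from the stage kernel to the history.\<close>

lemma Q_Suc:
  fixes F :: "_ \<Rightarrow> real"
  assumes F: "F \<in> borel_measurable (Hist (Suc n))" and bd: "\<And>h. \<bar>F h\<bar> \<le> B"
  shows "(\<integral>h. F h \<partial>Q (Suc n)) = (\<integral>h. (\<integral>x. F (h(n := x)) \<partial>stage_kernel q s \<zeta>0 \<sigma> \<tau> n h) \<partial>Q n)"
proof -
  interpret Q: prob_space "Q n" by (rule Q_prob)
  have QM: "measurable (Q n) N = measurable (Hist n) N" for N :: "'c measure" by (rule measurable_cong_sets[OF sets_Q refl])
  have sp: "space (Q n) = space (Hist n)" by (rule sets_eq_imp_space_eq[OF sets_Q])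
  have eP: "IT.eP n \<in> Q n \<rightarrow>\<^sub>M subprob_algebra (Hist (Suc n))" unfolding QM by (rule IT.measurable_eP)
  have "(\<integral>h. F h \<partial>Q (Suc n)) = (\<integral>h. F h \<partial>(Q n \<bind> IT.eP n))" by simp
  also have "\<dots> = (\<integral>h. (\<integral>h'. F h' \<partial>IT.eP n h) \<partial>Q n)"
  proof (rule integral_bind[OF F _ eP, where B' = 1])
    show "finite_measure (Q n)" by unfold_locales
    show "AE h in Q n. emeasure (IT.eP n h) (space (IT.eP n h)) \<le> ennreal 1"
      by (intro AE_I2) (simp add: sp prob_space.emeasure_space_1[OF IT.prob_space_eP])
  qed (rule bd)
  also have "\<dots> = (\<integral>h. (\<integral>x. F (h(n := x)) \<partial>stage_kernel q s \<zeta>0 \<sigma> \<tau> n h) \<partial>Q n)"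
  proof (rule Bochner_Integration.integral_cong[OF refl])
    fix h assume "h \<in> space (Q n)"
    then have h: "h \<in> space (Hist n)" by (simp add: sp)
    have "fun_upd h n \<in> stage_kernel q s \<zeta>0 \<sigma> \<tau> n h \<rightarrow>\<^sub>M Hist (Suc n)"
      unfolding measurable_cong_sets[OF IT.sets_P[OF h] refl]
      using measurable_compose[OF measurable_Pair1'[OF h] upd_measurable] by simp
    then show "(\<integral>h'. F h' \<partial>IT.eP n h) = (\<integral>x. F (h(n := x)) \<partial>stage_kernel q s \<zeta>0 \<sigma> \<tau> n h)"
      unfolding IT.eP_def using F by (subst integral_distr) auto
  qed
  finally show ?thesis .
qed

text \<open>Given the history, the current state and the action pair are independent, because the
  strategies do not look at the state.\<close>

lemma stage_kernel_integral:
  fixes f :: "'w \<times> 'i \<times> 'j \<Rightarrow> real"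
  assumes f: "f \<in> borel_measurable stage_space" and bd: "\<And>x. \<bar>f x\<bar> \<le> B" and h: "h \<in> space (Hist n)"
  shows "(\<integral>x. f x \<partial>stage_kernel q s \<zeta>0 \<sigma> \<tau> n h)
    = (\<Sum>z\<in>UNIV. next_state_probs q s \<zeta>0 n h $ z * (\<integral>a. f (z, a) \<partial>(\<sigma> n (actions n h) \<Otimes>\<^sub>M \<tau> n (actions n h))))"
proof -
  let ?p = "state_law (next_state_probs q s \<zeta>0 n h)" and ?a = "\<sigma> n (actions n h) \<Otimes>\<^sub>M \<tau> n (actions n h)"
  note pp = next_state_probs_prob[of n h]
  have a: "?a \<in> space (prob_algebra act)"
    by (rule measurable_space[OF mixed_measurable measurable_space[OF actions_measurable h]])
  interpret p: prob_space ?p by (rule prob_space_state_law[OF pp])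
  interpret a: prob_space ?a using a by (simp add: space_prob_algebra)
  interpret pa: pair_prob_space ?p ?a by unfold_locales
  have sets: "sets (?p \<Otimes>\<^sub>M ?a) = sets stage_space" unfolding stage_space_def
    using regular_probsD(2)[OF strategies_regular(1)] regular_probsD(2)[OF strategies_regular(2)]
      measurable_space[OF actions_measurable h]
    by (intro sets_pair_measure_cong) (auto simp: state_law_def)
  have int: "integrable (?p \<Otimes>\<^sub>M ?a) f"
    using f bd by (intro pa.integrable_const_bound[of _ B]) (auto simp: measurable_cong_sets[OF sets refl])
  have "(\<integral>x. f x \<partial>stage_kernel q s \<zeta>0 \<sigma> \<tau> n h) = (\<integral>x. f x \<partial>(?p \<Otimes>\<^sub>M ?a))"
    by (simp only: stage_kernel_eq)
  also have "\<dots> = (\<integral>z. (\<integral>a. f (z, a) \<partial>?a) \<partial>?p)" using pa.integral_fst'[OF int] by simp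
  finally show ?thesis by (simp add: state_law_integral[OF pp])
qed

lemma actions_upd: "actions (Suc n) (h(n := (z, a))) = (actions n h)(n := a)"
  by (auto simp: fun_eq_iff restrict_def actions_def)

lemma actions_last: "actions (Suc n) h n = snd (h n)"
  by (simp add: actions_def)

lemma act_upd_measurable:
  "(\<lambda>(\<alpha>, a). fun_upd \<alpha> n a) \<in> Acts n \<Otimes>\<^sub>M act \<rightarrow>\<^sub>M Acts (Suc n)"
  unfolding case_prod_beta'
  by (rule measurable_fun_upd[where J = "{0..<n}"]) (auto simp: atLeast0_lessThan_Suc)

lemma act_integral_measurable:
  fixes f :: "_ \<Rightarrow> real"
  assumes "f \<in> borel_measurable (Acts (Suc n))"
  shows "(\<lambda>\<alpha>. \<integral>a. f (\<alpha>(n := a)) \<partial>(\<sigma> n \<alpha> \<Otimes>\<^sub>M \<tau> n \<alpha>)) \<in> borel_measurable (Acts n)"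
proof (rule kernel_integral_measurable[where N = act])
  show "(\<lambda>(\<alpha>, a). f (\<alpha>(n := a))) \<in> borel_measurable (Acts n \<Otimes>\<^sub>M act)"
    using measurable_compose[OF act_upd_measurable assms] by (simp add: case_prod_beta')
  show "(\<lambda>\<alpha>. \<sigma> n \<alpha> \<Otimes>\<^sub>M \<tau> n \<alpha>) \<in> Acts n \<rightarrow>\<^sub>M subprob_algebra act"
    by (rule measurable_prob_algebraD[OF mixed_measurable])
qed

lemma act_integral_bound:
  fixes f :: "_ \<Rightarrow> real"
  assumes "\<alpha> \<in> space (Acts n)" "f \<in> borel_measurable (Acts (Suc n))" "\<And>x. \<bar>f x\<bar> \<le> B"
  shows "\<bar>\<integral>a. f (\<alpha>(n := a)) \<partial>(\<sigma> n \<alpha> \<Otimes>\<^sub>M \<tau> n \<alpha>)\<bar> \<le> B"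
    and "integrable (\<sigma> n \<alpha> \<Otimes>\<^sub>M \<tau> n \<alpha>) (\<lambda>a. f (\<alpha>(n := a)))"
proof -
  have a: "\<sigma> n \<alpha> \<Otimes>\<^sub>M \<tau> n \<alpha> \<in> space (prob_algebra act)"
    by (rule measurable_space[OF mixed_measurable assms(1)])
  interpret a: prob_space "\<sigma> n \<alpha> \<Otimes>\<^sub>M \<tau> n \<alpha>" using a by (simp add: space_prob_algebra)
  have sets: "sets (\<sigma> n \<alpha> \<Otimes>\<^sub>M \<tau> n \<alpha>) = sets act" using a by (simp add: space_prob_algebra)
  have m: "(\<lambda>a. f (\<alpha>(n := a))) \<in> borel_measurable (\<sigma> n \<alpha> \<Otimes>\<^sub>M \<tau> n \<alpha>)"
    unfolding measurable_cong_sets[OF sets refl]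
    using measurable_compose[OF measurable_compose[OF measurable_Pair1'[OF assms(1)] act_upd_measurable] assms(2)] by simp
  then show int: "integrable (\<sigma> n \<alpha> \<Otimes>\<^sub>M \<tau> n \<alpha>) (\<lambda>a. f (\<alpha>(n := a)))"
    using assms(3) by (intro a.integrable_const_bound[of _ B]) auto
  show "\<bar>\<integral>a. f (\<alpha>(n := a)) \<partial>(\<sigma> n \<alpha> \<Otimes>\<^sub>M \<tau> n \<alpha>)\<bar> \<le> B" by (rule a.abs_integral_le[OF int assms(3)])
qed

lemma Q_act_integrable:
  fixes \<phi> :: "_ \<Rightarrow> real"
  assumes "\<phi> \<in> borel_measurable (Hist n)" "\<And>h. h \<in> space (Hist n) \<Longrightarrow> \<bar>\<phi> h\<bar> \<le> B"
  shows "integrable (Q n) \<phi>"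
proof -
  interpret Q: prob_space "Q n" by (rule Q_prob)
  show ?thesis using assms
    by (intro Q.integrable_const_bound[of _ B])
      (auto simp: measurable_cong_sets[OF sets_Q refl] sets_eq_imp_space_eq[OF sets_Q])
qed

text \<open>The replacement of transition probabilities by the belief at stage \<open>n\<close> is
  an assumption here. The same computation thus serves as the inductive step of
  \<open>belief_cond\<close> and, once that is proved, as \<open>Q_Suc_belief\<close>.\<close>

lemma Q_Suc_state:
  fixes \<psi> :: "'w \<Rightarrow> (nat \<Rightarrow> 'i \<times> 'j) \<Rightarrow> real"
  assumes belief: "\<And>\<phi> z B. \<phi> \<in> borel_measurable (Acts n) \<Longrightarrow> (\<And>\<alpha>. \<alpha> \<in> space (Acts n) \<Longrightarrow> \<bar>\<phi> \<alpha>\<bar> \<le> B) \<Longrightarrow>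
      (\<integral>h. \<phi> (actions n h) * next_state_probs q s \<zeta>0 n h $ z \<partial>Q n)
      = (\<integral>h. \<phi> (actions n h) * belief n (actions n h) $ z \<partial>Q n)"
    and \<psi>: "\<And>z. \<psi> z \<in> borel_measurable (Acts (Suc n))" "\<And>z \<alpha>. \<bar>\<psi> z \<alpha>\<bar> \<le> B"
  shows "(\<integral>h. \<psi> (fst (h n)) (actions (Suc n) h) \<partial>Q (Suc n))
    = (\<integral>h. (\<integral>a. (\<Sum>z\<in>UNIV. belief n (actions n h) $ z * \<psi> z ((actions n h)(n := a)))
        \<partial>(\<sigma> n (actions n h) \<Otimes>\<^sub>M \<tau> n (actions n h))) \<partial>Q n)"
proof -
  let ?F = "\<lambda>h. \<psi> (fst (h n)) (actions (Suc n) h)"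
  let ?\<mu> = "\<lambda>\<alpha>. \<sigma> n \<alpha> \<Otimes>\<^sub>M \<tau> n \<alpha>"
  let ?\<Phi> = "\<lambda>z \<alpha>. \<integral>a. \<psi> z (\<alpha>(n := a)) \<partial>?\<mu> \<alpha>"
  have m: "(\<lambda>h. \<psi> z (actions (Suc n) h)) \<in> borel_measurable (Hist (Suc n))" for z
    by (rule measurable_compose[OF actions_measurable \<psi>(1)])
  have fn: "(\<lambda>h. fst (h n)) \<in> Hist (Suc n) \<rightarrow>\<^sub>M count_space UNIV"
    unfolding stage_space_def
    by (intro measurable_component_compose[OF measurable_fst]) auto
  have F: "?F \<in> borel_measurable (Hist (Suc n))"
    by (rule measurable_compose_countable'[OF m fn]) (auto intro: countable_finite)
  have sp: "space (Q n) = space (Hist n)" by (rule sets_eq_imp_space_eq[OF sets_Q])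
  have am: "actions n h \<in> space (Acts n)" if "h \<in> space (Hist n)" for h by (rule measurable_space[OF actions_measurable that])
  have \<Phi>m: "?\<Phi> z \<in> borel_measurable (Acts n)" for z by (rule act_integral_measurable[OF \<psi>(1)])
  have \<Phi>b: "\<bar>?\<Phi> z \<alpha>\<bar> \<le> B" if "\<alpha> \<in> space (Acts n)" for z \<alpha> by (rule act_integral_bound(1)[OF that \<psi>])
  have \<Phi>h: "(\<lambda>h. ?\<Phi> z (actions n h)) \<in> borel_measurable (Hist n)" for z
    by (rule measurable_compose[OF actions_measurable \<Phi>m])
  have B0: "B \<ge> 0" using \<psi>(2) abs_ge_zero order_trans by blast
  have le1: "\<bar>x * y\<bar> \<le> B" if "\<bar>x\<bar> \<le> B" "0 \<le> y" "y \<le> 1" for x y :: real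
    using mult_mono[OF that(1), of "\<bar>y\<bar>" 1] that B0 by (simp add: abs_mult)
  have i1: "integrable (Q n) (\<lambda>h. ?\<Phi> z (actions n h) * next_state_probs q s \<zeta>0 n h $ z)" for z
    by (rule Q_act_integrable[of _ _ B])
      (auto intro!: borel_measurable_times \<Phi>h next_state_probs_measurable le1 \<Phi>b am prob_vecsD[OF next_state_probs_prob])
  have bm: "(\<lambda>h. belief n (actions n h) $ z) \<in> borel_measurable (Hist n)" for z
    by (rule measurable_compose[OF measurable_compose[OF actions_measurable belief_measurable[OF order_refl]] ])
      (intro borel_measurable_continuous_onI continuous_intros)
  have i2: "integrable (Q n) (\<lambda>h. ?\<Phi> z (actions n h) * belief n (actions n h) $ z)" for z
    by (rule Q_act_integrable[of _ _ B])
      (auto intro!: borel_measurable_times \<Phi>h bm le1 \<Phi>b am prob_vecsD[OF belief_prob])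
  have "(\<integral>h. ?F h \<partial>Q (Suc n)) = (\<integral>h. (\<integral>x. ?F (h(n := x)) \<partial>stage_kernel q s \<zeta>0 \<sigma> \<tau> n h) \<partial>Q n)"
    by (rule Q_Suc[OF F]) (rule \<psi>(2))
  also have "\<dots> = (\<integral>h. (\<Sum>z\<in>UNIV. ?\<Phi> z (actions n h) * next_state_probs q s \<zeta>0 n h $ z) \<partial>Q n)"
  proof (rule Bochner_Integration.integral_cong[OF refl])
    fix h assume "h \<in> space (Q n)"
    then have h: "h \<in> space (Hist n)" by (simp add: sp)
    have "(\<lambda>x. ?F (h(n := x))) \<in> borel_measurable stage_space"
      using measurable_compose[OF measurable_compose[OF measurable_Pair1'[OF h] upd_measurable] F] by simp
    from stage_kernel_integral[OF this \<psi>(2) h]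
    show "(\<integral>x. ?F (h(n := x)) \<partial>stage_kernel q s \<zeta>0 \<sigma> \<tau> n h)
        = (\<Sum>z\<in>UNIV. ?\<Phi> z (actions n h) * next_state_probs q s \<zeta>0 n h $ z)"
      by (simp only: actions_upd fun_upd_same fst_conv mult.commute)
  qed
  also have "\<dots> = (\<Sum>z\<in>UNIV. \<integral>h. ?\<Phi> z (actions n h) * next_state_probs q s \<zeta>0 n h $ z \<partial>Q n)"
    by (rule Bochner_Integration.integral_sum) (rule i1)
  \<comment> \<open>For fixed \<open>z\<close>, averaging over the current actions leaves a bounded
    function of the past actions alone, which is a legitimate test function for the
    assumption.\<close>
  also have "\<dots> = (\<Sum>z\<in>UNIV. \<integral>h. ?\<Phi> z (actions n h) * belief n (actions n h) $ z \<partial>Q n)"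
    by (intro sum.cong refl belief[OF \<Phi>m \<Phi>b])
  also have "\<dots> = (\<integral>h. (\<Sum>z\<in>UNIV. ?\<Phi> z (actions n h) * belief n (actions n h) $ z) \<partial>Q n)"
    by (rule Bochner_Integration.integral_sum[symmetric]) (rule i2)
  also have "\<dots> = (\<integral>h. (\<integral>a. (\<Sum>z\<in>UNIV. belief n (actions n h) $ z * \<psi> z ((actions n h)(n := a))) \<partial>?\<mu> (actions n h)) \<partial>Q n)"
  proof (rule Bochner_Integration.integral_cong[OF refl])
    fix h assume "h \<in> space (Q n)"
    then have "actions n h \<in> space (Acts n)" using am sp by simp
    from act_integral_bound(2)[OF this \<psi>]
    show "(\<Sum>z\<in>UNIV. ?\<Phi> z (actions n h) * belief n (actions n h) $ z)
        = (\<integral>a. (\<Sum>z\<in>UNIV. belief n (actions n h) $ z * \<psi> z ((actions n h)(n := a))) \<partial>?\<mu> (actions n h))"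
      by (subst Bochner_Integration.integral_sum) (auto simp: mult.commute)
  qed
  finally show ?thesis .
qed

text \<open>The strategies see only the actions, so the belief is the conditional law of the state given the
  past actions: in expectations it may replace the transition probabilities out of the unobserved
  state.\<close>

lemma belief_cond:
  assumes "\<phi> \<in> borel_measurable (Acts n)" "\<And>\<alpha>. \<alpha> \<in> space (Acts n) \<Longrightarrow> \<bar>\<phi> \<alpha>\<bar> \<le> B"
  shows "(\<integral>h. \<phi> (actions n h) * next_state_probs q s \<zeta>0 n h $ z \<partial>Q n)
    = (\<integral>h. \<phi> (actions n h) * belief n (actions n h) $ z \<partial>Q n)"
  using assms
proof (induction n arbitrary: \<phi> z B)
  case 0 then show ?case by (simp add: next_state_probs_def)
next
  case (Suc n)
  \<comment> \<open>The bound on \<phi> is known only on the space of action histories; extension by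
    0 makes it global, as \<open>Q_Suc_state\<close> asks.\<close>
  define \<phi>' where "\<phi>' \<alpha> = (if \<alpha> \<in> space (Acts (Suc n)) then \<phi> \<alpha> else 0)" for \<alpha>
  have \<phi>m: "\<phi>' \<in> borel_measurable (Acts (Suc n))"
    using Suc.prems(1) by (subst measurable_cong[of _ _ \<phi>]) (auto simp: \<phi>'_def)
  have \<phi>b: "\<bar>\<phi>' \<alpha>\<bar> \<le> \<bar>B\<bar>" for \<alpha> using Suc.prems(2)[of \<alpha>] by (auto simp: \<phi>'_def)
  let ?P = "\<lambda>\<alpha>. P (s (Suc n) - s n) (fst (\<alpha> n)) (snd (\<alpha> n))"
  have Pm: "(\<lambda>\<alpha>. ?P \<alpha> $ z' $ z) \<in> borel_measurable (Acts (Suc n))" for z'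
    by (rule measurable_component_compose[OF P_entry_measurable]) simp
  have P1: "0 \<le> ?P \<alpha> $ z' $ z" "?P \<alpha> $ z' $ z \<le> 1" for \<alpha> z'
    using prob_vecsD[OF P_row] s_step[of n] by auto
  have le: "\<bar>\<phi>' \<alpha> * y\<bar> \<le> \<bar>B\<bar>" if "0 \<le> y" "y \<le> 1" for \<alpha> y
    using mult_mono[OF \<phi>b[of \<alpha>], of "\<bar>y\<bar>" 1] that by (simp add: abs_mult)
  have am: "actions (Suc n) h \<in> space (Acts (Suc n))" if "h \<in> space (Q (Suc n))" for h
    by (rule measurable_space[OF actions_measurable]) (use that sets_eq_imp_space_eq[OF sets_Q] in blast)
  have bm: "(\<lambda>\<alpha>. belief (Suc n) \<alpha> $ z) \<in> borel_measurable (Acts (Suc n))"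
    by (rule measurable_compose[OF belief_measurable[OF order_refl]])
      (intro borel_measurable_continuous_onI continuous_intros)
  note IH = Suc.IH
  have "(\<integral>h. \<phi> (actions (Suc n) h) * next_state_probs q s \<zeta>0 (Suc n) h $ z \<partial>Q (Suc n))
    = (\<integral>h. \<phi>' (actions (Suc n) h) * ?P (actions (Suc n) h) $ fst (h n) $ z \<partial>Q (Suc n))"
    by (rule Bochner_Integration.integral_cong[OF refl]) (simp only: \<phi>'_def am if_True next_state_probs_Suc actions_last)
  also have "\<dots> = (\<integral>h. (\<integral>a. (\<Sum>z'\<in>UNIV. belief n (actions n h) $ z' *
        (\<phi>' ((actions n h)(n := a)) * ?P ((actions n h)(n := a)) $ z' $ z))
        \<partial>(\<sigma> n (actions n h) \<Otimes>\<^sub>M \<tau> n (actions n h))) \<partial>Q n)"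
  proof (rule Q_Suc_state[where \<psi> = "\<lambda>z' \<alpha>. \<phi>' \<alpha> * ?P \<alpha> $ z' $ z" and B = "\<bar>B\<bar>"])
    show "(\<lambda>\<alpha>. \<phi>' \<alpha> * ?P \<alpha> $ z' $ z) \<in> borel_measurable (Acts (Suc n))" for z'
      by (intro borel_measurable_times \<phi>m Pm)
    show "\<bar>\<phi>' \<alpha> * ?P \<alpha> $ z' $ z\<bar> \<le> \<bar>B\<bar>" for z' \<alpha> by (intro le P1)
  qed (rule IH)
  also have "\<dots> = (\<integral>h. (\<integral>a. (\<Sum>z'\<in>UNIV. belief n (actions n h) $ z' *
        (\<phi>' ((actions n h)(n := a)) * belief (Suc n) ((actions n h)(n := a)) $ z))
        \<partial>(\<sigma> n (actions n h) \<Otimes>\<^sub>M \<tau> n (actions n h))) \<partial>Q n)"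
  proof (intro Bochner_Integration.integral_cong refl)
    fix h a
    let ?\<alpha> = "(actions n h)(n := a)"
    have b: "belief n ?\<alpha> = belief n (actions n h)" by (rule belief_cong) simp
    have "(\<Sum>z'\<in>UNIV. belief n (actions n h) $ z' * (\<phi>' ?\<alpha> * belief (Suc n) ?\<alpha> $ z)) = \<phi>' ?\<alpha> * belief (Suc n) ?\<alpha> $ z"
      by (simp only: sum_distrib_right[symmetric] prob_vecsD(2)[OF belief_prob] mult_1)
    also have "\<dots> = (\<Sum>z'\<in>UNIV. belief n (actions n h) $ z' * (\<phi>' ?\<alpha> * ?P ?\<alpha> $ z' $ z))"
      by (simp only: belief.simps b vP_entry sum_distrib_left mult_ac)
    finally show "(\<Sum>z'\<in>UNIV. belief n (actions n h) $ z' * (\<phi>' ?\<alpha> * ?P ?\<alpha> $ z' $ z))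
      = (\<Sum>z'\<in>UNIV. belief n (actions n h) $ z' * (\<phi>' ?\<alpha> * belief (Suc n) ?\<alpha> $ z))" ..
  qed
  \<comment> \<open>\<open>Q_Suc_state\<close> read backwards, for a \<psi> that ignores the state;
    the averaging over z' was put back in the previous step for this purpose.\<close>
  also have "\<dots> = (\<integral>h. \<phi>' (actions (Suc n) h) * belief (Suc n) (actions (Suc n) h) $ z \<partial>Q (Suc n))"
  proof (rule Q_Suc_state[where \<psi> = "\<lambda>z' \<alpha>. \<phi>' \<alpha> * belief (Suc n) \<alpha> $ z" and B = "\<bar>B\<bar>", symmetric])
    show "(\<lambda>\<alpha>. \<phi>' \<alpha> * belief (Suc n) \<alpha> $ z) \<in> borel_measurable (Acts (Suc n))"
      by (intro borel_measurable_times \<phi>m bm)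
    show "\<bar>\<phi>' \<alpha> * belief (Suc n) \<alpha> $ z\<bar> \<le> \<bar>B\<bar>" for \<alpha>
      by (intro le prob_vecsD(1,4)[OF belief_prob])
  qed (rule IH)
  also have "\<dots> = (\<integral>h. \<phi> (actions (Suc n) h) * belief (Suc n) (actions (Suc n) h) $ z \<partial>Q (Suc n))"
    by (rule Bochner_Integration.integral_cong[OF refl]) (simp only: \<phi>'_def am if_True)
  finally show ?case .
qed

lemma Q_Suc_belief:
  fixes \<psi> :: "'w \<Rightarrow> (nat \<Rightarrow> 'i \<times> 'j) \<Rightarrow> real"
  assumes "\<And>z. \<psi> z \<in> borel_measurable (Acts (Suc n))" "\<And>z \<alpha>. \<bar>\<psi> z \<alpha>\<bar> \<le> B"
  shows "(\<integral>h. \<psi> (fst (h n)) (actions (Suc n) h) \<partial>Q (Suc n))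
    = (\<integral>h. (\<integral>a. (\<Sum>z\<in>UNIV. belief n (actions n h) $ z * \<psi> z ((actions n h)(n := a)))
        \<partial>(\<sigma> n (actions n h) \<Otimes>\<^sub>M \<tau> n (actions n h))) \<partial>Q n)"
  by (rule Q_Suc_state[OF _ assms]) (rule belief_cond)

end

section \<open>Comparison of viscosity sub- and supersolutions\<close>

text \<open>The halves of \<open>viscosity_solution\<close> are kept apart because the upper and the
  lower limit of the values each satisfy one of them before they are known to agree.\<close>

definition viscosity_subsolution ::
    "(real \<Rightarrow> real ^ 'w::finite \<Rightarrow> real ^ 'w \<Rightarrow> real) \<Rightarrow> (real \<times> (real ^ 'w) \<Rightarrow> real) \<Rightarrow> bool" where
  "viscosity_subsolution H u \<longleftrightarrow>
     (\<forall>\<psi> G t \<zeta>. C1_test_function \<psi> G \<longrightarrow>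
        strict_max_on time_beliefs (\<lambda>p. u p - \<psi> p) (t, \<zeta>) \<longrightarrow>
        0 \<le> fst (G (t, \<zeta>)) + H t \<zeta> (snd (G (t, \<zeta>))))"

definition viscosity_supersolution ::
    "(real \<Rightarrow> real ^ 'w::finite \<Rightarrow> real ^ 'w \<Rightarrow> real) \<Rightarrow> (real \<times> (real ^ 'w) \<Rightarrow> real) \<Rightarrow> bool" where
  "viscosity_supersolution H u \<longleftrightarrow>
     (\<forall>\<psi> G t \<zeta>. C1_test_function \<psi> G \<longrightarrow>
        strict_min_on time_beliefs (\<lambda>p. u p - \<psi> p) (t, \<zeta>) \<longrightarrow>
        0 \<ge> fst (G (t, \<zeta>)) + H t \<zeta> (snd (G (t, \<zeta>))))"

lemma viscosity_subsolutionD: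
  "viscosity_subsolution H u \<Longrightarrow> C1_test_function \<psi> G \<Longrightarrow> strict_max_on time_beliefs (\<lambda>p. u p - \<psi> p) p \<Longrightarrow>
    0 \<le> fst (G p) + H (fst p) (snd p) (snd (G p))"
  unfolding viscosity_subsolution_def by (cases p) auto

lemma viscosity_supersolutionD:
  "viscosity_supersolution H u \<Longrightarrow> C1_test_function \<psi> G \<Longrightarrow> strict_min_on time_beliefs (\<lambda>p. u p - \<psi> p) p \<Longrightarrow>
    fst (G p) + H (fst p) (snd p) (snd (G p)) \<le> 0"
  unfolding viscosity_supersolution_def by (cases p) auto

lemma viscosity_solution_iff:
  "viscosity_solution H u \<longleftrightarrow>
    continuous_on time_beliefs u \<and> viscosity_subsolution H u \<and> viscosity_supersolution H u"
  unfolding viscosity_solution_def viscosity_subsolution_def viscosity_supersolution_def ..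

lemma compact_prob_vecs: "compact (prob_vecs :: (real ^ 'w::finite) set)"
proof -
  have "prob_vecs = (\<Inter>z. {\<zeta> :: real ^ 'w. 0 \<le> \<zeta> $ z}) \<inter> {\<zeta>. (\<Sum>z\<in>UNIV. \<zeta> $ z) = 1}"
    by (auto simp: prob_vecs_def)
  moreover have "closed \<dots>"
    by (intro closed_Int closed_INT ballI closed_Collect_le closed_Collect_eq continuous_intros)
  moreover have "norm \<zeta> \<le> 1" if "\<zeta> \<in> prob_vecs" for \<zeta> :: "real ^ 'w"
    using norm_le_l1_cart[of \<zeta>] that by (simp add: prob_vecs_def)
  ultimately show ?thesis by (auto simp: compact_eq_bounded_closed bounded_iff)
qed

lemma prob_vecs_nonempty: "(prob_vecs :: (real ^ 'w::finite) set) \<noteq> {}"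
proof -
  have "(\<chi> z. if z = undefined then 1 else 0) \<in> (prob_vecs :: (real ^ 'w) set)"
    by (simp add: prob_vecs_def)
  then show ?thesis by blast
qed

lemma convex_time_beliefs: "convex time_beliefs"
proof -
  have "convex (prob_vecs :: (real ^ 'w::finite) set)"
    by (rule convexI) (auto simp: prob_vecs_def sum.distrib sum_distrib_left[symmetric])
  then show ?thesis unfolding time_beliefs_def by (intro convex_Times) auto
qed

lemma vanishing_bounded:
  assumes cont: "continuous_on time_beliefs u" and van: "vanishes_at_infinity u"
  obtains B where "B \<ge> 0" "\<And>p. p \<in> time_beliefs \<Longrightarrow> \<bar>u p\<bar> \<le> B"
proof -
  obtain T where T: "T \<ge> 0" "\<And>t \<zeta>. t \<ge> T \<Longrightarrow> \<zeta> \<in> prob_vecs \<Longrightarrow> \<bar>u (t, \<zeta>)\<bar> \<le> 1"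
    using van unfolding vanishes_at_infinity_def by (meson zero_less_one)
  have "compact ({0..T} \<times> prob_vecs :: (real \<times> (real ^ 'w)) set)"
    by (intro compact_Times compact_prob_vecs) auto
  then have "bounded (u ` ({0..T} \<times> prob_vecs))"
    by (intro compact_imp_bounded compact_continuous_image continuous_on_subset[OF cont])
      (auto simp: time_beliefs_def)
  then obtain B where B: "\<And>p. p \<in> {0..T} \<times> prob_vecs \<Longrightarrow> \<bar>u p\<bar> \<le> B" unfolding bounded_iff by auto
  have "\<bar>u p\<bar> \<le> max B 1" if "p \<in> time_beliefs" for p
    using that B[of p] T(2)[of "fst p" "snd p"] by (cases "fst p \<le> T") (auto simp: time_beliefs_def le_max_iff_disj)
  then show thesis using that[of "max B 1"] by simp
qed

text \<open>One family for both sides of the doubling argument: the coupling penalty, the time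
  perturbation and a squared distance that makes the extremum strict. \<open>e\<close> may be
  negative, as it is on the supersolution side, and c / (1 + t) is smooth on the open set t > -1
  around the domain.\<close>

lemma C1_test_quadratic:
  fixes r a :: "real \<times> (real ^ 'w::finite)"
  assumes "e \<noteq> 0"
  shows "C1_test_function (\<lambda>p. (p - r) \<bullet> (p - r) / (2 * e) + c / (1 + fst p) + d * ((p - a) \<bullet> (p - a)))
    (\<lambda>p. (1 / e) *\<^sub>R (p - r) + (- c / (1 + fst p)\<^sup>2, 0) + (2 * d) *\<^sub>R (p - a))"
  unfolding C1_test_function_def
proof (intro exI[of _ "{p. -1 < fst p}"] conjI ballI)
  show "open {p :: real \<times> (real ^ 'w). - 1 < fst p}"
    by (intro open_Collect_less continuous_intros)
  show "time_beliefs \<subseteq> {p :: real \<times> (real ^ 'w). - 1 < fst p}" by (auto simp: time_beliefs_def)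
  show "continuous_on {p. - 1 < fst p} (\<lambda>p :: real \<times> (real ^ 'w).
      (1 / e) *\<^sub>R (p - r) + (- c / (1 + fst p)\<^sup>2, 0) + (2 * d) *\<^sub>R (p - a))"
    by (intro continuous_intros) auto
  fix p :: "real \<times> (real ^ 'w)" assume "p \<in> {p. - 1 < fst p}"
  then have p: "1 + fst p \<noteq> 0" by auto
  have sq: "((\<lambda>x. (x - y) \<bullet> (x - y)) has_derivative (\<lambda>h. 2 * (h \<bullet> (p - y)))) (at p)" for y
    by (auto intro!: derivative_eq_intros simp: inner_commute)
  have "((\<lambda>t. c / (1 + t)) has_real_derivative - c / (1 + fst p)\<^sup>2) (at (fst p))"
    using p by (auto intro!: derivative_eq_intros simp: power2_eq_square)
  from has_derivative_compose[OF has_derivative_fst[OF has_derivative_ident] this[unfolded has_field_derivative_def]]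
  have fr: "((\<lambda>x. c / (1 + fst x)) has_derivative (\<lambda>h. - c / (1 + fst p)\<^sup>2 * fst h)) (at p)" .
  have "((\<lambda>p. (p - r) \<bullet> (p - r) / (2 * e) + c / (1 + fst p) + d * ((p - a) \<bullet> (p - a))) has_derivative
      (\<lambda>h. 2 * (h \<bullet> (p - r)) / (2 * e) + - c / (1 + fst p)\<^sup>2 * fst h + d * (2 * (h \<bullet> (p - a))))) (at p)"
    by (intro has_derivative_add has_derivative_mult_right sq fr bounded_linear.has_derivative[OF bounded_linear_divide])
  then show "GDERIV (\<lambda>p. (p - r) \<bullet> (p - r) / (2 * e) + c / (1 + fst p) + d * ((p - a) \<bullet> (p - a))) p
      :> (1 / e) *\<^sub>R (p - r) + (- c / (1 + fst p)\<^sup>2, 0) + (2 * d) *\<^sub>R (p - a)"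
    unfolding gderiv_def by (rule has_derivative_eq_rhs)
      (auto simp only: fun_eq_iff inner_add_right inner_scaleR_right inner_Pair_0 mult_ac times_divide_eq_right times_divide_eq_left mult_divide_mult_cancel_left_if, simp)
qed

text \<open>The bounded term \<open>c / (1 + t)\<close> makes the subsolution inequality strict; vanishing at infinity keeps the
  maximum of the doubled function in a compact set.\<close>

lemma viscosity_comparison:
  fixes u v :: "real \<times> (real ^ 'w::finite) \<Rightarrow> real"
  assumes u: "continuous_on time_beliefs u" "vanishes_at_infinity u" "viscosity_subsolution H u"
    and v: "continuous_on time_beliefs v" "vanishes_at_infinity v" "viscosity_supersolution H v"
    and C: "C \<ge> 0" and H: "\<And>t s \<zeta> \<xi> p. t \<ge> 0 \<Longrightarrow> s \<ge> 0 \<Longrightarrow> \<zeta> \<in> prob_vecs \<Longrightarrow> \<xi> \<in> prob_vecs \<Longrightarrow>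
      H t \<zeta> p - H s \<xi> p \<le> C * (\<bar>t - s\<bar> + norm (\<zeta> - \<xi>)) + C * norm (\<zeta> - \<xi>) * norm p"
    and p0: "p0 \<in> time_beliefs"
  shows "u p0 \<le> v p0"
proof (rule ccontr)
  assume "\<not> u p0 \<le> v p0"
  \<comment> \<open>A quarter of the gap: the perturbation costs at most c at \<open>p0\<close> and
    leaves 3 * c, while late in time \<open>u\<close> and \<open>v\<close> are each at most c in
    absolute value, so that their difference is at most 2 * c.\<close>
  define c where "c = (u p0 - v p0) / 4"
  have c: "c > 0" "u p0 - v p0 = 4 * c" using \<open>\<not> u p0 \<le> v p0\<close> by (auto simp: c_def)
  obtain Bu where Bu: "Bu \<ge> 0" "\<And>p. p \<in> time_beliefs \<Longrightarrow> \<bar>u p\<bar> \<le> Bu" using vanishing_bounded[OF u(1,2)] by blast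
  obtain Bv where Bv: "Bv \<ge> 0" "\<And>p. p \<in> time_beliefs \<Longrightarrow> \<bar>v p\<bar> \<le> Bv" using vanishing_bounded[OF v(1,2)] by blast
  define B where "B = Bu + Bv + 1"
  have B: "B > 0" "\<And>p. p \<in> time_beliefs \<Longrightarrow> \<bar>u p\<bar> \<le> B" "\<And>p r. p \<in> time_beliefs \<Longrightarrow> r \<in> time_beliefs \<Longrightarrow> u p - v r \<le> B"
    using Bu Bv by (fastforce simp: B_def abs_le_iff)+
  have B4: "v p - v r \<le> 2 * B" if "p \<in> time_beliefs" "r \<in> time_beliefs" for p r
    using Bv(2)[OF that(1)] Bv(2)[OF that(2)] Bu(1) by (simp add: B_def abs_le_iff)
  obtain Tu where Tu: "Tu \<ge> 0" "\<And>t \<zeta>. t \<ge> Tu \<Longrightarrow> \<zeta> \<in> prob_vecs \<Longrightarrow> \<bar>u (t, \<zeta>)\<bar> \<le> c"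
    using u(2) c unfolding vanishes_at_infinity_def by meson
  obtain Tv where Tv: "Tv \<ge> 0" "\<And>t \<zeta>. t \<ge> Tv \<Longrightarrow> \<zeta> \<in> prob_vecs \<Longrightarrow> \<bar>v (t, \<zeta>)\<bar> \<le> c"
    using v(2) c unfolding vanishes_at_infinity_def by meson
  define T where "T = max Tu Tv"
  have T: "T \<ge> 0" and far: "u p - v r \<le> 2 * c"
    if "p \<in> time_beliefs" "r \<in> time_beliefs" "fst p \<ge> T" "fst r \<ge> T" for p r
    using Tu(1) Tu(2)[of "fst p" "snd p"] Tv(2)[of "fst r" "snd r"] that
    by (simp_all add: T_def time_beliefs_def mem_Times_iff abs_le_iff)
  have T: "T \<ge> 0" using Tu(1) by (simp add: T_def)
  define K where "K = ({0..T + 1} \<times> prob_vecs :: (real \<times> (real ^ 'w)) set)"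
  have K: "compact K" unfolding K_def by (intro compact_Times compact_prob_vecs) auto
  have KT: "K \<subseteq> time_beliefs" by (auto simp: K_def time_beliefs_def)
  have p0T: "fst p0 < T" using far[OF p0 p0] c by (auto simp: not_le[symmetric])
  then have p0K: "p0 \<in> K" using p0 by (auto simp: K_def time_beliefs_def)
  \<comment> \<open>For t \<le> T + 1 the perturbation contributes a slope of at least
    \<open>c / (T + 2)\<^sup>2\<close>; \<kappa> is chosen so that the total error 4 * C * \<kappa>
    of the Hamiltonian stays below it.\<close>
  define \<kappa> where "\<kappa> = c / (T + 2)\<^sup>2 / (4 * C + 1)"
  have \<kappa>: "\<kappa> > 0" using c T C unfolding \<kappa>_def by (intro divide_pos_pos) auto
  have C4: "4 * C + 1 \<noteq> 0" using C by simp
  have "4 * C * \<kappa> < (4 * C + 1) * \<kappa>" using \<kappa> by (simp add: distrib_right)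
  also have "(4 * C + 1) * \<kappa> = c / (T + 2)\<^sup>2" unfolding \<kappa>_def using nonzero_mult_div_cancel_left[OF C4, of "c / (T + 2)\<^sup>2"] by (simp only: times_divide_eq_right)
  finally have \<kappa>C: "4 * C * \<kappa> < c / (T + 2)\<^sup>2" .
  have "uniformly_continuous_on K v" by (intro compact_uniformly_continuous K continuous_on_subset[OF v(1) KT])
  then obtain \<delta> where \<delta>: "\<delta> > 0" "\<And>p r. p \<in> K \<Longrightarrow> r \<in> K \<Longrightarrow> dist p r < \<delta> \<Longrightarrow> \<bar>v p - v r\<bar> < \<kappa>"
    unfolding uniformly_continuous_on_def using \<kappa> by (metis dist_real_def)
  \<comment> \<open>Target for the distance between the two points: within the modulus of continuity
    of \<open>v\<close>, within the error budget \<kappa>, and at most 1 so that a pair beyond T + 1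
    lies entirely beyond T.\<close>
  define m where "m = min \<delta> (min \<kappa> 1)"
  have m: "m > 0" "m \<le> \<delta>" "m \<le> \<kappa>" "m \<le> 1" using \<delta> \<kappa> by (auto simp: m_def)
  \<comment> \<open>The coupling penalty at a maximum is bounded by the oscillation of
    \<open>v\<close>, at most 2 * B; this weight forces the two points within distance m.\<close>
  define e where "e = m\<^sup>2 / (8 * B)"
  have e: "e > 0" "4 * B * e < m\<^sup>2" using m B by (auto simp: e_def)
  define \<Phi> where "\<Phi> p r = u p - v r - (p - r) \<bullet> (p - r) / (2 * e) - c / (1 + fst p)" for p r :: "real \<times> (real ^ 'w)"
  have "continuous_on (K \<times> K) (\<lambda>x. \<Phi> (fst x) (snd x))"
    unfolding \<Phi>_def using e KT
    by (intro continuous_intros continuous_on_compose2[OF u(1)] continuous_on_compose2[OF v(1)])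
      (auto simp: K_def)
  with compact_Times[OF K K] p0K obtain x where x: "x \<in> K \<times> K"
    "\<And>y. y \<in> K \<times> K \<Longrightarrow> \<Phi> (fst y) (snd y) \<le> \<Phi> (fst x) (snd x)"
    using continuous_attains_sup[of "K \<times> K" "\<lambda>x. \<Phi> (fst x) (snd x)"] by blast
  obtain p r where pr: "p \<in> K" "r \<in> K" and maxK: "\<And>p' r'. p' \<in> K \<Longrightarrow> r' \<in> K \<Longrightarrow> \<Phi> p' r' \<le> \<Phi> p r"
    using x by (metis SigmaI fst_conv mem_Times_iff snd_conv)
  have prT: "p \<in> time_beliefs" "r \<in> time_beliefs" using pr KT by auto
  have "c / (1 + fst p0) \<le> c" using c p0 by (auto simp: time_beliefs_def divide_le_eq)
  then have "\<Phi> p0 p0 \<ge> 3 * c" using c by (simp add: \<Phi>_def)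
  with maxK[OF p0K p0K] have big: "\<Phi> p r \<ge> 3 * c" by simp
  \<comment> \<open>The maximum over K is global. A better pair would have times within 1 of each
    other by the penalty; were one of them at least T + 1, both would be at least T, where the
    difference is at most 2 * c.\<close>
  have maxT: "\<Phi> p' r' \<le> \<Phi> p r" if p': "p' \<in> time_beliefs" and r': "r' \<in> time_beliefs" for p' r'
  proof (rule ccontr)
    assume "\<not> \<Phi> p' r' \<le> \<Phi> p r"
    then have gt: "\<Phi> p' r' > 2 * c" using big c by simp
    have pos: "c / (1 + fst p') \<ge> 0" using c p' by (auto simp: time_beliefs_def)
    have sq: "(p' - r') \<bullet> (p' - r') / (2 * e) \<ge> 0" using e by simp
    have uv: "u p' - v r' > 2 * c" using gt pos sq unfolding \<Phi>_def by linarith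
    have "(p' - r') \<bullet> (p' - r') / (2 * e) < B" using gt pos c B(3)[OF p' r'] unfolding \<Phi>_def by linarith
    then have "(p' - r') \<bullet> (p' - r') < 2 * e * B" using e by (simp add: pos_divide_less_eq mult_ac)
    also have "\<dots> \<le> 4 * B * e" using e B by simp
    also have "\<dots> < m\<^sup>2" using e by simp
    finally have "norm (p' - r') < m" using m by (simp add: dot_square_norm power2_less_imp_less)
    then have "\<bar>fst p' - fst r'\<bar> < 1" using norm_fst_le[of "fst p' - fst r'" "snd p' - snd r'"] m
      by (auto simp: fst_diff snd_diff minus_prod_def)
    moreover have "fst p' < T + 1 \<and> fst r' < T + 1"
    proof (rule ccontr)
      assume "\<not> ?thesis"
      then have "fst p' \<ge> T" "fst r' \<ge> T" using calculation by auto
      from far[OF p' r' this] uv show False by simp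
    qed
    ultimately have "p' \<in> K" "r' \<in> K" using p' r' by (auto simp: K_def time_beliefs_def)
    with maxK \<open>\<not> \<Phi> p' r' \<le> \<Phi> p r\<close> show False by blast
  qed
  define D where "D = norm (p - r)"
  have D0: "D \<ge> 0" by (simp add: D_def)
  \<comment> \<open>Comparison with the pair (p, p) leaves the perturbation unchanged and bounds the
    penalty by the variation of \<open>v\<close> alone.\<close>
  have "D\<^sup>2 / (2 * e) \<le> v p - v r"
    using maxT[OF prT(1) prT(1)] by (simp add: \<Phi>_def D_def dot_square_norm)
  then have D2: "D\<^sup>2 \<le> 2 * e * (v p - v r)" using e by (simp add: pos_divide_le_eq mult_ac)
  also have "\<dots> \<le> 2 * e * (2 * B)" using B4[OF prT] e by (intro mult_left_mono) auto
  also have "\<dots> < m\<^sup>2" using e by (simp add: mult_ac)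
  finally have Dm: "D < m" using m by (simp add: power2_less_imp_less)
  \<comment> \<open>Second pass: now that the points are close, uniform continuity makes the penalty
    itself small. This is what controls the product of the belief distance and the gradient in the
    estimate for \<open>H\<close>.\<close>
  then have "\<bar>v p - v r\<bar> < \<kappa>" using \<delta>(2)[OF pr] m by (simp add: D_def dist_norm)
  then have "2 * e * (v p - v r) \<le> 2 * e * \<kappa>" using e by (intro mult_left_mono) auto
  with D2 have "D\<^sup>2 \<le> 2 * e * \<kappa>" by (rule order_trans)
  then have D2e: "D\<^sup>2 / e \<le> 2 * \<kappa>" using e by (simp add: pos_divide_le_eq mult_ac)
  let ?\<psi> = "\<lambda>x. (x - r) \<bullet> (x - r) / (2 * e) + c / (1 + fst x) + 1 * ((x - p) \<bullet> (x - p))"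
  have "strict_max_on time_beliefs (\<lambda>x. u x - ?\<psi> x) p"
    unfolding strict_max_on_def
  proof (intro conjI ballI impI prT)
    fix x assume x: "x \<in> time_beliefs" "x \<noteq> p"
    have "(x - p) \<bullet> (x - p) > 0" "(p - p) \<bullet> (p - p) = 0" using x by simp_all
    then show "u x - ?\<psi> x < u p - ?\<psi> p" using maxT[OF x(1) prT(2)] unfolding \<Phi>_def by linarith
  qed
  from viscosity_subsolutionD[OF u(3) C1_test_quadratic this] e
  have sub: "0 \<le> (1 / e) * (fst p - fst r) - c / (1 + fst p)\<^sup>2 + H (fst p) (snd p) ((1 / e) *\<^sub>R (snd p - snd r))"
    by simp
  let ?\<chi> = "\<lambda>x. (x - p) \<bullet> (x - p) / (2 * (- e)) + 0 / (1 + fst x) + (- 1) * ((x - r) \<bullet> (x - r))"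
  have "strict_min_on time_beliefs (\<lambda>x. v x - ?\<chi> x) r"
    unfolding strict_min_on_def
  proof (intro conjI ballI impI prT)
    fix x assume x: "x \<in> time_beliefs" "x \<noteq> r"
    have pos: "(x - r) \<bullet> (x - r) > 0" "(r - r) \<bullet> (r - r) = 0" using x by simp_all
    have \<chi>: "?\<chi> y = - ((p - y) \<bullet> (p - y) / (2 * e)) - (y - r) \<bullet> (y - r)" for y
    proof -
      have "(y - p) \<bullet> (y - p) = (p - y) \<bullet> (p - y)" by (simp add: inner_diff inner_commute algebra_simps)
      then show ?thesis by simp
    qed
    show "v r - ?\<chi> r < v x - ?\<chi> x"
      unfolding \<chi> using pos maxT[OF prT(1) x(1), unfolded \<Phi>_def] by linarith
  qed
  note super = viscosity_supersolutionD[OF v(3) C1_test_quadratic this]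
  \<comment> \<open>Both test functions have gradient (p - r) / e at their contact points, apart
    from the time slope of the perturbation at \<open>p\<close>; subtracting the two inequalities
    isolates that slope.\<close>
  have flip: "(1 / - e) *\<^sub>R (r - p) = (1 / e) *\<^sub>R (p - r)" by (simp add: algebra_simps)
  have super: "0 \<ge> (1 / e) * (fst p - fst r) + H (fst r) (snd r) ((1 / e) *\<^sub>R (snd p - snd r))"
    using super e unfolding flip by simp
  have fs: "\<bar>fst p - fst r\<bar> \<le> D" "norm (snd p - snd r) \<le> D"
    using norm_fst_le[of "fst p - fst r" "snd p - snd r"] norm_snd_le[of "snd p - snd r" "fst p - fst r"]
    by (auto simp: D_def minus_prod_def)
  have "c / (T + 2)\<^sup>2 \<le> c / (1 + fst p)\<^sup>2"
    using pr c T by (intro divide_left_mono mult_pos_pos power_mono) (auto simp: K_def)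
  also have "\<dots> \<le> H (fst p) (snd p) ((1 / e) *\<^sub>R (snd p - snd r)) - H (fst r) (snd r) ((1 / e) *\<^sub>R (snd p - snd r))"
    using sub super by linarith
  also have "\<dots> \<le> C * (\<bar>fst p - fst r\<bar> + norm (snd p - snd r)) + C * norm (snd p - snd r) * norm ((1 / e) *\<^sub>R (snd p - snd r))"
    using prT by (intro H) (auto simp: time_beliefs_def)
  also have "\<dots> \<le> C * (D + D) + C * D * (D / e)"
  proof (intro add_mono mult_left_mono C fs mult_mono)
    show "norm ((1 / e) *\<^sub>R (snd p - snd r)) \<le> D / e" using fs(2) e by (simp add: divide_right_mono)
  qed (use C D0 in auto)
  also have "\<dots> = 2 * C * D + C * (D\<^sup>2 / e)" by (simp add: power2_eq_square)
  also have "\<dots> \<le> 2 * C * \<kappa> + C * (2 * \<kappa>)"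
    using C Dm m D2e by (intro add_mono mult_left_mono) auto
  also have "\<dots> < c / (T + 2)\<^sup>2" using \<kappa>C by simp
  finally show False by simp
qed

section \<open>Verification\<close>

text \<open>An action chosen at the centre of a ball of radius \<open>d\<close> is good on the whole
  ball. Taking the first centre of a finite net that is in range gives a Borel step function of the
  belief.\<close>

lemma measurable_selection:
  fixes Good :: "real ^ 'w::finite \<Rightarrow> 'x::compact_metric_space measure \<Rightarrow> bool"
  assumes d: "d > 0"
    and ex: "\<And>c. c \<in> prob_vecs \<Longrightarrow> \<exists>x\<in>regular_probs. \<forall>\<zeta>\<in>prob_vecs. dist c \<zeta> < d \<longrightarrow> Good \<zeta> x"
  obtains \<xi> where "\<xi> \<in> borel \<rightarrow>\<^sub>M prob_algebra borel" "\<And>\<zeta>. \<zeta> \<in> prob_vecs \<Longrightarrow> Good \<zeta> (\<xi> \<zeta>)"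
proof -
  have "\<exists>C. finite C \<and> C \<subseteq> prob_vecs \<and> (prob_vecs :: (real ^ 'w) set) \<subseteq> (\<Union>c\<in>C. ball c d)"
    using seq_compact_imp_totally_bounded[OF compact_imp_seq_compact[OF compact_prob_vecs[where 'w = 'w]]] d by blast
  then obtain C :: "(real ^ 'w) set" where C: "finite C" "C \<subseteq> prob_vecs" "prob_vecs \<subseteq> (\<Union>c\<in>C. ball c d)"
    by (elim exE conjE)
  have C0: "C \<noteq> {}" using C(3) prob_vecs_nonempty by auto
  have "\<forall>c\<in>prob_vecs. \<exists>x. x \<in> regular_probs \<and> (\<forall>\<zeta>\<in>prob_vecs. dist c \<zeta> < d \<longrightarrow> Good \<zeta> x)"
    using ex by (simp only: Bex_def) blast
  from bchoice[OF this] obtain X where X: "\<And>c. c \<in> prob_vecs \<Longrightarrow> X c \<in> regular_probs"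
    "\<And>c \<zeta>. c \<in> prob_vecs \<Longrightarrow> \<zeta> \<in> prob_vecs \<Longrightarrow> dist c \<zeta> < d \<Longrightarrow> Good \<zeta> (X c)"
    by auto
  \<comment> \<open>The finite net enumerated by all of nat, with repetitions, so that the least
    index in range is defined for every belief of the simplex.\<close>
  define cs where "cs = from_nat_into C"
  have cs: "cs n \<in> prob_vecs" for n using from_nat_into[OF C0] C(2) by (auto simp: cs_def)
  define N where "N \<zeta> = (LEAST n. dist (cs n) \<zeta> < d)" for \<zeta>
  show thesis
  proof (rule that)
    have "N \<in> borel \<rightarrow>\<^sub>M count_space UNIV" unfolding N_def
    proof (rule measurable_Least)
      have "{\<zeta>. dist (cs n) \<zeta> < d} \<in> sets borel" for n
        by (intro borel_open open_Collect_less continuous_intros)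
      then show "Measurable.pred borel (\<lambda>\<zeta>. dist (cs n) \<zeta> < d)" for n by (simp add: pred_def)
    qed
    moreover have "(\<lambda>n. X (cs n)) \<in> count_space UNIV \<rightarrow>\<^sub>M prob_algebra borel"
      using X(1)[OF cs] by (simp add: regular_probs_eq)
    ultimately show "(\<lambda>\<zeta>. X (cs (N \<zeta>))) \<in> borel \<rightarrow>\<^sub>M prob_algebra borel" by (rule measurable_compose)
    fix \<zeta> :: "real ^ 'w" assume \<zeta>: "\<zeta> \<in> prob_vecs"
    then obtain c where "c \<in> C" "dist c \<zeta> < d" using C(3) by auto
    then have "\<exists>n. dist (cs n) \<zeta> < d"
      using from_nat_into_surj[OF countable_finite[OF C(1)]] unfolding cs_def by metis
    then have "dist (cs (N \<zeta>)) \<zeta> < d" unfolding N_def by (rule LeastI_ex)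
    then show "Good \<zeta> (X (cs (N \<zeta>)))" by (rule X(2)[OF cs \<zeta>])
  qed
qed

lemma stage_eq:
  fixes s :: "nat \<Rightarrow> real"
  assumes s: "strict_mono s" and t: "t \<in> {s m..<s (Suc m)}"
  shows "stage s t = m"
  unfolding stage_def
proof (rule Greatest_equality)
  show "s m \<le> t" using t by simp
  fix n assume "s n \<le> t"
  then have "s n < s (Suc m)" using t by simp
  then show "n \<le> m" using s by (simp add: strict_mono_less)
qed

lemma find_stage:
  fixes s :: "nat \<Rightarrow> real"
  assumes s_top: "filterlim s at_top sequentially" and "s 0 \<le> t"
  obtains m where "t \<in> {s m..<s (Suc m)}"
proof -
  have "eventually (\<lambda>n. t < s n) sequentially" using s_top by (simp add: filterlim_at_top_dense)
  then have ex: "\<exists>n. t < s n" by (auto simp: eventually_sequentially)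
  define n where "n = (LEAST n. t < s n)"
  have n: "t < s n" unfolding n_def using ex by (rule LeastI_ex)
  then have "n \<noteq> 0" using assms by (intro notI) simp
  then obtain m where m: "n = Suc m" by (cases n) auto
  then have "\<not> t < s m" using not_less_Least[of m "\<lambda>n. t < s n"] by (simp add: n_def)
  with n m that[of m] show thesis by simp
qed

lemma stage_bounds:
  assumes "time_partition \<pi>" "0 \<le> t"
  shows "\<pi> (stage \<pi> t) \<le> t" "t < \<pi> (Suc (stage \<pi> t))"
proof -
  obtain m where "t \<in> {\<pi> m..<\<pi> (Suc m)}"
    using find_stage[of \<pi> t] assms by (auto simp: time_partition_def)
  moreover from stage_eq[OF _ this] have "stage \<pi> t = m" using assms by (simp add: time_partition_def)
  ultimately show "\<pi> (stage \<pi> t) \<le> t" "t < \<pi> (Suc (stage \<pi> t))" by auto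
qed

lemma geometric_sum_le: "e \<ge> 0 \<Longrightarrow> (\<Sum>m<N. e * (1 / 2) ^ Suc m) \<le> (e :: real)"
proof -
  assume e: "e \<ge> 0"
  have "(\<Sum>m<N. e * (1 / 2) ^ Suc m) = e * (1 - (1 / 2) ^ N)" by (induction N) (auto simp: algebra_simps)
  also have "\<dots> \<le> e * 1" using e by (intro mult_left_mono) auto
  finally show ?thesis by simp
qed

section \<open>Payoff along a play and its truncation\<close>

context play
begin

lemma payoff_at_eq:
  "t \<in> {s m..<s (Suc m)} \<Longrightarrow>
    payoff_at g q s h t = flow_payoff (t - s m) (fst (h m)) (fst (snd (h m))) (snd (snd (h m)))"
  by (simp only: payoff_at_def stage_eq[OF s_mono] flow_payoff_def case_prod_beta)

abbreviation "R m h \<equiv> stage_payoff (s m) (s (Suc m)) (fst (h m)) (fst (snd (h m))) (snd (snd (h m)))"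

lemma payoff_integrable_stage:
  "set_integrable lborel {s m..<s (Suc m)} (\<lambda>t. payoff_at g q s h t * k t)"
  "(LINT t:{s m..<s (Suc m)}|lborel. payoff_at g q s h t * k t) = R m h"
proof -
  have eq: "indicator {s m..<s (Suc m)} t *\<^sub>R (payoff_at g q s h t * k t) = indicator {s m..<s (Suc m)} t *\<^sub>R
      (flow_payoff (t - s m) (fst (h m)) (fst (snd (h m))) (snd (snd (h m))) * k t)" for t
  proof (cases "t \<in> {s m..<s (Suc m)}")
    case True then show ?thesis by (simp only: payoff_at_eq)
  next
    case False then show ?thesis by (simp add: indicator_def del: atLeastLessThan_iff)
  qed
  show "set_integrable lborel {s m..<s (Suc m)} (\<lambda>t. payoff_at g q s h t * k t)"
    using flow_integrable_stage[OF s_nonneg] unfolding set_integrable_def eq .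
  show "(LINT t:{s m..<s (Suc m)}|lborel. payoff_at g q s h t * k t) = R m h"
    unfolding stage_payoff_def set_lebesgue_integral_def eq ..
qed

lemma s_le: "m \<le> n \<Longrightarrow> s m \<le> s n"
  using s_mono by (simp add: strict_mono_less_eq)

lemma payoff_integrable_upto:
  "set_integrable lborel {s 0..<s N} (\<lambda>t. payoff_at g q s h t * k t) \<and>
   (LINT t:{s 0..<s N}|lborel. payoff_at g q s h t * k t) = (\<Sum>m<N. R m h)"
proof (induction N)
  case 0 then show ?case by (simp add: set_integrable_def set_lebesgue_integral_def)
next
  case (Suc N)
  have un: "{s 0..<s (Suc N)} = {s 0..<s N} \<union> {s N..<s (Suc N)}"
    using s_le[of 0 N] s_step[of N] by auto
  have dis: "{s 0..<s N} \<inter> {s N..<s (Suc N)} = {}" by auto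
  show ?case unfolding un
    using set_integrable_Un[OF conjunct1[OF Suc.IH] payoff_integrable_stage(1)]
      set_integral_Un[OF dis conjunct1[OF Suc.IH] payoff_integrable_stage(1)] Suc.IH
    by (simp add: payoff_integrable_stage(2))
qed

lemma payoff_bound:
  assumes t: "s 0 \<le> t" shows "\<bar>payoff_at g q s h t * k t\<bar> \<le> M * k t"
proof -
  obtain m where m: "t \<in> {s m..<s (Suc m)}" by (rule find_stage[OF s_top t])
  have "\<bar>payoff_at g q s h t\<bar> \<le> M" unfolding payoff_at_eq[OF m] using m by (intro flow_payoff_bound) simp
  moreover have "k t \<ge> 0" using t s0 by (simp add: k_nonneg)
  ultimately show ?thesis by (simp add: abs_mult mult_right_mono)
qed

text \<open>The integrand changes form at infinitely many times; it is measurable as a limit of its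
  truncations, which agree with it from some index on, and \<open>M * k\<close> dominates
  it.\<close>

lemma payoff_integrable: "set_integrable lborel {s 0..} (\<lambda>t. payoff_at g q s h t * k t)"
  unfolding set_integrable_def
proof (rule Bochner_Integration.integrable_bound)
  have "set_integrable lborel {s 0..} k" using s0 by (intro k_integrable_on) auto
  then show "integrable lborel (\<lambda>t. M * (indicator {s 0..} t *\<^sub>R k t))"
    unfolding set_integrable_def by (rule integrable_mult_right)
  show "(\<lambda>t. indicator {s 0..} t *\<^sub>R (payoff_at g q s h t * k t)) \<in> borel_measurable lborel"
  proof (rule borel_measurable_LIMSEQ_real)
    show "(\<lambda>t. indicator {s 0..<s N} t *\<^sub>R (payoff_at g q s h t * k t)) \<in> borel_measurable lborel" for N
      using payoff_integrable_upto[of N h] unfolding set_integrable_def by (intro borel_measurable_integrable) simp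
    fix t :: real
    have "eventually (\<lambda>N. t < s N) sequentially" using s_top by (simp add: filterlim_at_top_dense)
    then have "eventually (\<lambda>N. indicator {s 0..<s N} t *\<^sub>R (payoff_at g q s h t * k t) =
        indicator {s 0..} t *\<^sub>R (payoff_at g q s h t * k t)) sequentially"
      by eventually_elim (auto split: split_indicator)
    then show "(\<lambda>N. indicator {s 0..<s N} t *\<^sub>R (payoff_at g q s h t * k t))
        \<longlonglongrightarrow> indicator {s 0..} t *\<^sub>R (payoff_at g q s h t * k t)"
      by (rule tendsto_eventually)
  qed
  show "AE t in lborel. norm (indicator {s 0..} t *\<^sub>R (payoff_at g q s h t * k t)) \<le> norm (M * (indicator {s 0..} t *\<^sub>R k t))"
  proof (rule AE_I2)
    fix t
    show "norm (indicator {s 0..} t *\<^sub>R (payoff_at g q s h t * k t)) \<le> norm (M * (indicator {s 0..} t *\<^sub>R k t))"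
      using payoff_bound[of t h] by (cases "t \<ge> s 0") auto
  qed
qed

abbreviation "T h \<equiv> (LINT t:{s 0..}|lborel. payoff_at g q s h t * k t)"

lemma play_payoff_near: "\<bar>T h - (\<Sum>m<N. R m h)\<bar> \<le> M * tail (s N)"
proof -
  have un: "{s 0..} = {s 0..<s N} \<union> {s N..}" using s_le[of 0 N] by auto
  have dis: "{s 0..<s N} \<inter> {s N..} = {}" by auto
  have i: "set_integrable lborel {s N..} (\<lambda>t. payoff_at g q s h t * k t)"
    by (rule set_integrable_subset[OF payoff_integrable]) (use s_le[of 0 N] in auto)
  have "T h = (\<Sum>m<N. R m h) + (LINT t:{s N..}|lborel. payoff_at g q s h t * k t)"
    unfolding un using set_integral_Un[OF dis conjunct1[OF payoff_integrable_upto] i] payoff_integrable_upto by simp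
  moreover have "\<bar>LINT t:{s N..}|lborel. payoff_at g q s h t * k t\<bar> \<le> (LINT t:{s N..}|lborel. \<bar>payoff_at g q s h t * k t\<bar>)"
    using set_integral_norm_bound[OF i] by simp
  moreover have "\<dots> \<le> (LINT t:{s N..}|lborel. M * k t)"
  proof (rule set_integral_mono)
    show "set_integrable lborel {s N..} (\<lambda>t. M * k t)"
      by (intro set_integrable_mult_right k_integrable_on) (use s_nonneg[of N] in auto)
    show "\<bar>payoff_at g q s h t * k t\<bar> \<le> M * k t" if "t \<in> {s N..}" for t
      using that s_le[of 0 N] by (intro payoff_bound) auto
  qed (rule set_integrable_abs[OF i])
  ultimately show ?thesis by (simp add: tail_def)
qed

lemma R_bound: "\<bar>R m h\<bar> \<le> M"
proof -
  have "mass (s m) (s (Suc m)) \<le> 1"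
    using mass_tail[OF s_nonneg s_step, of m] tail_le_1[OF s_nonneg, of m] tail_nonneg[OF s_nonneg, of "Suc m"] by linarith
  then have "M * mass (s m) (s (Suc m)) \<le> M * 1" using M(1) by (intro mult_left_mono)
  with stage_payoff_bound[OF s_nonneg, of m "s (Suc m)" "fst (h m)" "fst (snd (h m))" "snd (snd (h m))"]
  show ?thesis by simp
qed

lemma R_measurable: "m < N \<Longrightarrow> R m \<in> borel_measurable (Hist N)"
  by (rule measurable_component_compose[OF stage_payoff_measurable[OF s_nonneg]]) simp

lemma R_L: "R m \<in> borel_measurable L" "(\<integral>h. R m h \<partial>L) = (\<integral>h. R m h \<partial>Q (Suc m))"
  using L_integral[of "R m" "Suc m"] R_measurable[of m "Suc m"] by auto

lemma R_integrable: "integrable L (R m)"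
proof -
  interpret L: prob_space L by (rule L_prob)
  show ?thesis using R_bound R_L(1) by (intro L.integrable_const_bound[of _ M]) auto
qed

text \<open>The payoff of a whole play is the limit of sums over finitely many stages, which gives
  its measurability in the play together with the error bound.\<close>

lemma total_payoff_near: "\<bar>total_payoff g k q s \<zeta>0 \<sigma> \<tau> - (\<Sum>m<N. \<integral>h. R m h \<partial>L)\<bar> \<le> M * tail (s N)"
proof -
  interpret L: prob_space L by (rule L_prob)
  have lim: "(\<lambda>N. \<Sum>m<N. R m h) \<longlonglongrightarrow> T h" for h
  proof -
    have "(\<lambda>N. M * tail (s N)) \<longlonglongrightarrow> 0" using tendsto_mult_left[OF tail_tendsto[OF s_top s_nonneg], of M] by simp
    then have "(\<lambda>N. (\<Sum>m<N. R m h) - T h) \<longlonglongrightarrow> 0"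
      by (rule Lim_null_comparison[rotated]) (auto intro!: always_eventually simp: abs_minus_commute play_payoff_near)
    then show ?thesis by (rule LIM_zero_cancel)
  qed
  have Tm: "T \<in> borel_measurable L"
    by (rule borel_measurable_LIMSEQ_real[OF lim]) (intro borel_measurable_sum R_L)
  have "\<bar>T h\<bar> \<le> M * tail (s 0)" for h using play_payoff_near[of h 0] by simp
  then have Ti: "integrable L T" by (intro L.integrable_const_bound[OF _ Tm]) auto
  have Si: "integrable L (\<lambda>h. \<Sum>m<N. R m h)" by (intro Bochner_Integration.integrable_sum R_integrable)
  have "total_payoff g k q s \<zeta>0 \<sigma> \<tau> - (\<Sum>m<N. \<integral>h. R m h \<partial>L) = (\<integral>h. T h - (\<Sum>m<N. R m h) \<partial>L)"
    unfolding total_payoff_def using Ti Si by (simp add: Bochner_Integration.integral_sum[OF R_integrable] Bochner_Integration.integral_diff)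
  also have "\<bar>\<dots>\<bar> \<le> M * tail (s N)"
  proof -
    have i: "integrable L (\<lambda>h. T h - (\<Sum>m<N. R m h))" using Ti Si by (rule Bochner_Integration.integrable_diff)
    show ?thesis by (rule L.abs_integral_le[OF i play_payoff_near])
  qed
  finally show ?thesis .
qed

text \<open>One of the two tails stands for the truncation of the payoff, the other for the
  continuation value dropped at stage \<open>N\<close>.\<close>

lemma sums_approx:
  assumes "\<And>N. x \<le> y + M * tail (s N) + M * tail (s N)" shows "x \<le> (y :: real)"
proof -
  have "(\<lambda>N. M * tail (s N)) \<longlonglongrightarrow> 0" using tendsto_mult_left[OF tail_tendsto[OF s_top s_nonneg], of M] by simp
  from tendsto_add[OF tendsto_add[OF tendsto_const[of y] this] this]
  have "(\<lambda>N. y + M * tail (s N) + M * tail (s N)) \<longlonglongrightarrow> y" by simp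
  from LIMSEQ_le_const[OF this] assms show ?thesis by blast
qed

section \<open>Expected payoff compared with candidate value functions \<open>w\<close>\<close>

context
  fixes w :: "nat \<Rightarrow> real ^ 'w \<Rightarrow> real"
  assumes w_cont: "\<And>n. continuous_on prob_vecs (w n)"
    and w_bound: "\<And>n \<zeta>. \<zeta> \<in> prob_vecs \<Longrightarrow> \<bar>w n \<zeta>\<bar> \<le> M * tail (s n)"
begin

definition "w_along n h = w n (belief n (actions n h))"

definition "stage_value n \<alpha> = mixed_ext (\<lambda>i j. belief_stage_payoff (s n) (s (Suc n)) (belief n \<alpha>) i j
    + w (Suc n) (belief n \<alpha> v* P (s (Suc n) - s n) i j)) (\<sigma> n \<alpha>) (\<tau> n \<alpha>)"

lemma w_belief_measurable: "n \<le> m \<Longrightarrow> (\<lambda>\<alpha>. w n (belief n \<alpha>)) \<in> borel_measurable (Acts m)"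
proof -
  assume nm: "n \<le> m"
  \<comment> \<open>Continuity of \<open>w n\<close> is known only on the simplex, a closed set
    which the belief never leaves; extension by 0 gives a Borel function.\<close>
  have "(\<lambda>\<zeta>. if \<zeta> \<in> prob_vecs then w n \<zeta> else 0) \<in> borel_measurable borel"
    by (rule borel_measurable_continuous_on_if)
      (auto intro: w_cont borel_closed compact_imp_closed compact_prob_vecs)
  from measurable_compose[OF belief_measurable[OF nm] this] show ?thesis by (simp add: belief_prob)
qed

lemma w_le_M: "\<zeta> \<in> prob_vecs \<Longrightarrow> \<bar>w n \<zeta>\<bar> \<le> M"
  using w_bound[of \<zeta> n] mult_left_le[OF tail_le_1[OF s_nonneg[of n]] M(1)] by simp

lemma actions_restrict: "actions n (restrict h {0..<n}) = actions n h"
  by (auto simp: actions_def fun_eq_iff)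

lemma w_along_measurable: "w_along n \<in> borel_measurable (Hist n)"
  unfolding w_along_def[abs_def]
  by (rule measurable_compose[OF actions_measurable w_belief_measurable[OF order_refl]])

lemma w_along_L: "(\<integral>h. w_along n h \<partial>L) = (\<integral>h. w_along n h \<partial>Q n)" "w_along n \<in> borel_measurable L"
  using L_integral[of "w_along n" n] w_along_measurable by (auto simp: w_along_def actions_restrict)

lemma w_along_bound: "\<bar>w_along n h\<bar> \<le> M * tail (s n)" "\<bar>w_along n h\<bar> \<le> M"
  unfolding w_along_def by (intro w_bound w_le_M belief_prob)+

lemma w_along_integrable: "integrable (Q n) (w_along n)"
  using w_along_measurable w_along_bound(2) by (rule Q_act_integrable)

text \<open>Matches the integral produced by \<open>Q_Suc_belief\<close> with the mixed extension of
  the stage game: the continuation does not depend on the hidden state, so the belief weights sum to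
  1 in front of it.\<close>

lemma stage_value_regular:
  assumes "\<alpha> \<in> space (Acts n)"
  shows "(\<integral>a. (\<Sum>z\<in>UNIV. belief n \<alpha> $ z * (stage_payoff (s n) (s (Suc n)) z (fst ((\<alpha>(n := a)) n)) (snd ((\<alpha>(n := a)) n))
      + w (Suc n) (belief (Suc n) (\<alpha>(n := a))))) \<partial>(\<sigma> n \<alpha> \<Otimes>\<^sub>M \<tau> n \<alpha>)) = stage_value n \<alpha>"
proof -
  have b: "belief n (\<alpha>(n := a)) = belief n \<alpha>" for a by (rule belief_cong) simp
  show ?thesis unfolding stage_value_def mixed_ext_def
    by (rule Bochner_Integration.integral_cong[OF refl])
      (simp add: b belief_stage_payoff_def distrib_left sum.distrib sum_distrib_right[symmetric] prob_vecsD(2)[OF belief_prob])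
qed

text \<open>The point where the hidden state disappears: the expected stage payoff plus continuation
  becomes an expectation of the stage game at the current belief.\<close>

lemma stage_step:
  "(\<integral>h. R n h \<partial>L) + (\<integral>h. w_along (Suc n) h \<partial>L) = (\<integral>h. stage_value n (actions n h) \<partial>Q n)"
  "integrable (Q n) (\<lambda>h. stage_value n (actions n h))"
proof -
  let ?\<psi> = "\<lambda>z \<alpha>. stage_payoff (s n) (s (Suc n)) z (fst (\<alpha> n)) (snd (\<alpha> n)) + w (Suc n) (belief (Suc n) \<alpha>)"
  let ?F = "\<lambda>\<alpha>. \<Sum>z\<in>UNIV. belief n \<alpha> $ z * ?\<psi> z \<alpha>"
  have bb: "belief n (\<alpha>(n := a)) = belief n \<alpha>" for \<alpha> a by (rule belief_cong) simp
  have m1: "(\<lambda>\<alpha>. stage_payoff (s n) (s (Suc n)) z (fst (\<alpha> n)) (snd (\<alpha> n))) \<in> borel_measurable (Acts (Suc n))" for z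
    by (rule measurable_component_compose[OF continuous_Pair_measurable(1)[OF stage_payoff_cont[OF s_nonneg]]]) simp
  have \<psi>m: "?\<psi> z \<in> borel_measurable (Acts (Suc n))" for z
    by (intro borel_measurable_add m1 w_belief_measurable[OF order_refl])
  have \<psi>b: "\<bar>?\<psi> z \<alpha>\<bar> \<le> 2 * M" for z \<alpha>
    using R_bound[of n "\<lambda>_. (z, \<alpha> n)"] w_le_M[OF belief_prob, of "Suc n" "Suc n" \<alpha>]
    unfolding fst_conv snd_conv by linarith
  have bm: "(\<lambda>\<alpha>. belief n \<alpha> $ z) \<in> borel_measurable (Acts (Suc n))" for z
    by (rule measurable_compose[OF belief_measurable]) (auto intro!: borel_measurable_continuous_onI continuous_intros)
  have Fm: "?F \<in> borel_measurable (Acts (Suc n))" by (intro borel_measurable_sum borel_measurable_times bm \<psi>m)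
  have Fb: "\<bar>?F \<alpha>\<bar> \<le> 2 * M" for \<alpha> by (rule weighted_abs_le[OF belief_prob \<psi>b])
  have sv: "(\<integral>a. ?F (\<alpha>(n := a)) \<partial>(\<sigma> n \<alpha> \<Otimes>\<^sub>M \<tau> n \<alpha>)) = stage_value n \<alpha>" if "\<alpha> \<in> space (Acts n)" for \<alpha>
    using stage_value_regular[OF that] by (simp only: bb)
  have sp: "space (Q n) = space (Hist n)" by (rule sets_eq_imp_space_eq[OF sets_Q])
  have am: "actions n h \<in> space (Acts n)" if "h \<in> space (Hist n)" for h by (rule measurable_space[OF actions_measurable that])
  have Gm: "(\<lambda>h. (\<integral>a. ?F ((actions n h)(n := a)) \<partial>(\<sigma> n (actions n h) \<Otimes>\<^sub>M \<tau> n (actions n h)))) \<in> borel_measurable (Hist n)"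
    by (rule measurable_compose[OF actions_measurable act_integral_measurable[OF Fm]])
  have "integrable (Q n) (\<lambda>h. (\<integral>a. ?F ((actions n h)(n := a)) \<partial>(\<sigma> n (actions n h) \<Otimes>\<^sub>M \<tau> n (actions n h))))"
    by (rule Q_act_integrable[OF Gm]) (rule act_integral_bound(1)[OF am Fm Fb])
  then show "integrable (Q n) (\<lambda>h. stage_value n (actions n h))"
    by (rule Bochner_Integration.integrable_cong[THEN iffD1, OF refl, rotated]) (rule sv[OF am], simp add: sp)
  have wi: "integrable (Q (Suc n)) (w_along (Suc n))" by (rule w_along_integrable)
  have Ri: "integrable (Q (Suc n)) (R n)"
    by (rule Q_act_integrable[OF R_measurable[OF lessI] R_bound])
  have "(\<integral>h. R n h \<partial>L) + (\<integral>h. w_along (Suc n) h \<partial>L) = (\<integral>h. R n h + w_along (Suc n) h \<partial>Q (Suc n))"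
    unfolding R_L(2) w_along_L(1) by (rule Bochner_Integration.integral_add[symmetric, OF Ri wi])
  also have "\<dots> = (\<integral>h. ?\<psi> (fst (h n)) (actions (Suc n) h) \<partial>Q (Suc n))"
    by (simp only: w_along_def actions_last)
  also have "\<dots> = (\<integral>h. (\<integral>a. (\<Sum>z\<in>UNIV. belief n (actions n h) $ z * ?\<psi> z ((actions n h)(n := a)))
        \<partial>(\<sigma> n (actions n h) \<Otimes>\<^sub>M \<tau> n (actions n h))) \<partial>Q n)"
    by (rule Q_Suc_belief[OF \<psi>m \<psi>b])
  also have "\<dots> = (\<integral>h. stage_value n (actions n h) \<partial>Q n)"
    by (rule Bochner_Integration.integral_cong[OF refl]) (rule stage_value_regular[OF am], simp add: sp)
  finally show "(\<integral>h. R n h \<partial>L) + (\<integral>h. w_along (Suc n) h \<partial>L) = (\<integral>h. stage_value n (actions n h) \<partial>Q n)" .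
qed

lemma w_along_0: "(\<integral>h. w_along 0 h \<partial>L) = w 0 \<zeta>0"
proof -
  interpret L: prob_space L by (rule L_prob)
  show ?thesis by (simp add: w_along_def L.prob_space)
qed

lemma w_along_L_bound: "\<bar>\<integral>h. w_along n h \<partial>L\<bar> \<le> M * tail (s n)"
proof -
  interpret L: prob_space L by (rule L_prob)
  have i: "integrable L (w_along n)" using w_along_L(2) w_along_bound(2) by (intro L.integrable_const_bound[of _ M]) auto
  show ?thesis by (rule L.abs_integral_le[OF i w_along_bound(1)])
qed

text \<open>The continuation terms of successive stages cancel. What separates the payoff from
  \<open>w 0 \<zeta>0\<close> is a sum of stage gains and a last continuation, so stagewise
  near-optimality is enough.\<close>

lemma play_telescope:
  "(\<Sum>m<N. \<integral>h. R m h \<partial>L) + (\<integral>h. w_along N h \<partial>L)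
    = w 0 \<zeta>0 + (\<Sum>m<N. \<integral>h. stage_value m (actions m h) - w_along m h \<partial>Q m)"
proof (induction N)
  case 0 then show ?case by (simp add: w_along_0)
next
  case (Suc N)
  have "(\<integral>h. stage_value N (actions N h) - w_along N h \<partial>Q N)
      = (\<integral>h. R N h \<partial>L) + (\<integral>h. w_along (Suc N) h \<partial>L) - (\<integral>h. w_along N h \<partial>L)"
    unfolding stage_step(1) w_along_L(1)[of N]
    by (rule Bochner_Integration.integral_diff[OF stage_step(2) w_along_integrable])
  with Suc show ?case unfolding sum.lessThan_Suc by linarith
qed

lemma stage_gain_integrable: "integrable (Q n) (\<lambda>h. stage_value n (actions n h) - w_along n h)"
  by (rule Bochner_Integration.integrable_diff[OF stage_step(2) w_along_integrable])

lemma actions_in_space: "h \<in> space (Q n) \<Longrightarrow> actions n h \<in> space (Acts n)"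
  by (rule measurable_space[OF actions_measurable]) (simp add: sets_eq_imp_space_eq[OF sets_Q])

text \<open>The permitted losses \<open>e * (1 / 2) ^ Suc n\<close> add up to at most
  \<open>e\<close> over infinitely many stages, and both tails vanish as N grows.\<close>

lemma verification_lower:
  assumes e: "e \<ge> 0" and opt: "\<And>n \<alpha>. \<alpha> \<in> space (Acts n) \<Longrightarrow> w n (belief n \<alpha>) - e * (1 / 2) ^ Suc n \<le> stage_value n \<alpha>"
  shows "w 0 \<zeta>0 - e \<le> total_payoff g k q s \<zeta>0 \<sigma> \<tau>"
proof (rule sums_approx)
  fix N
  have "- (e * (1 / 2) ^ Suc n) \<le> (\<integral>h. stage_value n (actions n h) - w_along n h \<partial>Q n)" for n
    using opt[OF actions_in_space, of _ n]
    by (intro prob_space.integral_ge_const[OF Q_prob stage_gain_integrable] AE_I2)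
      (fastforce simp: w_along_def)
  then have "(\<Sum>n<N. - (e * (1 / 2) ^ Suc n)) \<le> (\<Sum>n<N. \<integral>h. stage_value n (actions n h) - w_along n h \<partial>Q n)"
    by (intro sum_mono)
  then show "w 0 \<zeta>0 - e \<le> total_payoff g k q s \<zeta>0 \<sigma> \<tau> + M * tail (s N) + M * tail (s N)"
    using geometric_sum_le[OF e, of N] play_telescope[of N] w_along_L_bound[of N] total_payoff_near[of N]
    unfolding sum_negf by linarith
qed

lemma verification_upper:
  assumes e: "e \<ge> 0" and opt: "\<And>n \<alpha>. \<alpha> \<in> space (Acts n) \<Longrightarrow> stage_value n \<alpha> \<le> w n (belief n \<alpha>) + e * (1 / 2) ^ Suc n"
  shows "total_payoff g k q s \<zeta>0 \<sigma> \<tau> \<le> w 0 \<zeta>0 + e"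
proof (rule sums_approx)
  fix N
  have "(\<integral>h. stage_value n (actions n h) - w_along n h \<partial>Q n) \<le> e * (1 / 2) ^ Suc n" for n
    using opt[OF actions_in_space, of _ n]
    by (intro prob_space.integral_le_const[OF Q_prob stage_gain_integrable] AE_I2)
      (fastforce simp: w_along_def)
  then have "(\<Sum>n<N. \<integral>h. stage_value n (actions n h) - w_along n h \<partial>Q n) \<le> (\<Sum>n<N. e * (1 / 2) ^ Suc n)"
    by (intro sum_mono)
  then show "total_payoff g k q s \<zeta>0 \<sigma> \<tau> \<le> w 0 \<zeta>0 + e + M * tail (s N) + M * tail (s N)"
    using geometric_sum_le[OF e, of N] play_telescope[of N] w_along_L_bound[of N] total_payoff_near[of N]
    by linarith
qed

end

end

section \<open>Near-optimal strategies and the value of the discretized game\<close>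

context unobserved_game
begin

text \<open>An action that is optimal up to e / 3 at one belief stays optimal up to e at nearby
  beliefs, since the payoff of the stage game and its value each move by at most e / 3.\<close>

lemma near_optimal_selection:
  assumes ab: "0 \<le> a" "a \<le> b" and w: "l1_lipschitz L w" and L: "L \<ge> 0" and e: "e > 0"
  defines "F \<equiv> \<lambda>\<zeta> i j. belief_stage_payoff a b \<zeta> i j + w (\<zeta> v* P (b - a) i j)"
  shows "\<exists>\<xi>. \<xi> \<in> borel \<rightarrow>\<^sub>M prob_algebra borel \<and>
      (\<forall>\<zeta>\<in>prob_vecs. \<forall>y\<in>regular_probs. shapley a b w \<zeta> - e \<le> mixed_ext (F \<zeta>) (\<xi> \<zeta>) y)"
    and "\<exists>\<xi>. \<xi> \<in> borel \<rightarrow>\<^sub>M prob_algebra borel \<and>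
      (\<forall>\<zeta>\<in>prob_vecs. \<forall>x\<in>regular_probs. mixed_ext (F \<zeta>) x (\<xi> \<zeta>) \<le> shapley a b w \<zeta> + e)"
proof -
  define \<Lambda> where "\<Lambda> = M * mass a b + L"
  have \<Lambda>: "\<Lambda> \<ge> 0" using L M(1) mass_nonneg[OF ab(1)] by (simp add: \<Lambda>_def)
  \<comment> \<open>The l1 distance is at most CARD('w) times the Euclidean one, in which balls are
    taken; the summand 1 keeps the divisor positive when \<Lambda> = 0.\<close>
  define d where "d = e / (3 * (\<Lambda> * CARD('w) + 1))"
  have den: "3 * (\<Lambda> * CARD('w) + 1) > 0" using \<Lambda> by (intro mult_pos_pos) (auto intro: add_nonneg_pos)
  then have d: "d > 0" using e by (simp add: d_def)
  have c: "continuous_on UNIV (\<lambda>(i, j). F \<zeta> i j)" if "\<zeta> \<in> prob_vecs" for \<zeta>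
    unfolding F_def by (rule shapley_cont[OF ab l1_lipschitz_continuous[OF w] that])
  have near: "F \<zeta> i j \<le> F \<zeta>' i j + e / 3" if "\<zeta> \<in> prob_vecs" "\<zeta>' \<in> prob_vecs" "dist \<zeta> \<zeta>' < d" for \<zeta> \<zeta>' i j
  proof -
    have "\<Lambda> * l1 (\<zeta> - \<zeta>') \<le> \<Lambda> * (CARD('w) * d)"
      using that(3) l1_le_norm[of "\<zeta> - \<zeta>'"] \<Lambda>
      by (intro mult_left_mono order_trans[OF l1_le_norm]) (auto simp: dist_norm)
    also have "\<dots> \<le> (\<Lambda> * CARD('w) + 1) * d" using d by (simp add: distrib_right)
    also have "\<dots> = e / 3" unfolding d_def using den by (simp add: field_simps)
    finally show ?thesis
      using stage_game_lipschitz[OF ab w L that(1,2), of i j] unfolding F_def \<Lambda>_def by linarith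
  qed
  have val: "is_value regular_probs regular_probs (mixed_ext (F \<zeta>)) (shapley a b w \<zeta>)" if "\<zeta> \<in> prob_vecs" for \<zeta>
    using is_value_mixed_value[OF c[OF that]] by (simp add: shapley_def F_def)
  have vnear: "shapley a b w \<zeta> \<le> shapley a b w \<zeta>' + e / 3" if "\<zeta> \<in> prob_vecs" "\<zeta>' \<in> prob_vecs" "dist \<zeta> \<zeta>' < d" for \<zeta> \<zeta>'
    using mixed_value_mono[OF c[OF that(1)] c[OF that(2)] near[OF that]] by (simp add: shapley_def F_def)
  have e3: "e / 3 > 0" using e by simp
  have ex1: "\<exists>x\<in>regular_probs. \<forall>\<zeta>\<in>prob_vecs. dist \<zeta>' \<zeta> < d \<longrightarrow>
      (\<forall>y\<in>regular_probs. shapley a b w \<zeta> - e \<le> mixed_ext (F \<zeta>) x y)" if \<zeta>': "\<zeta>' \<in> prob_vecs" for \<zeta>'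
  proof -
    obtain x where x: "x \<in> regular_probs" "\<And>y. y \<in> regular_probs \<Longrightarrow> shapley a b w \<zeta>' - e / 3 \<le> mixed_ext (F \<zeta>') x y"
      using is_value_maximizer[OF val[OF \<zeta>'] e3] by blast
    have "shapley a b w \<zeta> - e \<le> mixed_ext (F \<zeta>) x y"
      if \<zeta>: "\<zeta> \<in> prob_vecs" "dist \<zeta>' \<zeta> < d" and y: "y \<in> regular_probs" for \<zeta> y
    proof -
      have "dist \<zeta> \<zeta>' < d" using \<zeta>(2) by (simp add: dist_commute)
      from vnear[OF \<zeta>(1) \<zeta>' this] mixed_ext_mono[OF c[OF \<zeta>'] c[OF \<zeta>(1)] near[OF \<zeta>' \<zeta>] x(1) y] x(2)[OF y]
      show ?thesis by linarith
    qed
    with x(1) show ?thesis by blast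
  qed
  from measurable_selection[where Good = "\<lambda>\<zeta> x. \<forall>y\<in>regular_probs. shapley a b w \<zeta> - e \<le> mixed_ext (F \<zeta>) x y", OF d ex1]
  show "\<exists>\<xi>. \<xi> \<in> borel \<rightarrow>\<^sub>M prob_algebra borel \<and>
      (\<forall>\<zeta>\<in>prob_vecs. \<forall>y\<in>regular_probs. shapley a b w \<zeta> - e \<le> mixed_ext (F \<zeta>) (\<xi> \<zeta>) y)" by metis
  have ex2: "\<exists>y\<in>regular_probs. \<forall>\<zeta>\<in>prob_vecs. dist \<zeta>' \<zeta> < d \<longrightarrow>
      (\<forall>x\<in>regular_probs. mixed_ext (F \<zeta>) x y \<le> shapley a b w \<zeta> + e)" if \<zeta>': "\<zeta>' \<in> prob_vecs" for \<zeta>'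
  proof -
    obtain y where y: "y \<in> regular_probs" "\<And>x. x \<in> regular_probs \<Longrightarrow> mixed_ext (F \<zeta>') x y \<le> shapley a b w \<zeta>' + e / 3"
      using is_value_minimizer[OF val[OF \<zeta>'] e3] by blast
    have "mixed_ext (F \<zeta>) x y \<le> shapley a b w \<zeta> + e"
      if \<zeta>: "\<zeta> \<in> prob_vecs" "dist \<zeta>' \<zeta> < d" and x: "x \<in> regular_probs" for \<zeta> x
    proof -
      have "dist \<zeta> \<zeta>' < d" using \<zeta>(2) by (simp add: dist_commute)
      from vnear[OF \<zeta>' \<zeta>] mixed_ext_mono[OF c[OF \<zeta>(1)] c[OF \<zeta>'] near[OF \<zeta>(1) \<zeta>' this] x y(1)] y(2)[OF x]
      show ?thesis by linarith
    qed
    with y(1) show ?thesis by blast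
  qed
  from measurable_selection[where Good = "\<lambda>\<zeta> y. \<forall>x\<in>regular_probs. mixed_ext (F \<zeta>) x y \<le> shapley a b w \<zeta> + e", OF d ex2]
  show "\<exists>\<xi>. \<xi> \<in> borel \<rightarrow>\<^sub>M prob_algebra borel \<and>
      (\<forall>\<zeta>\<in>prob_vecs. \<forall>x\<in>regular_probs. mixed_ext (F \<zeta>) x (\<xi> \<zeta>) \<le> shapley a b w \<zeta> + e)" by metis
qed

end

context subgame
begin

text \<open>The near-optimal strategies use the past only through the belief, yet their guarantees
  hold against arbitrary strategies, because the stage inequality is required for every mixed action
  of the opponent.\<close>

lemma subgame_value:
  assumes w: "\<And>n. l1_lipschitz (M * tail (s n)) (w n)"
    and w_bound: "\<And>n \<zeta>. \<zeta> \<in> prob_vecs \<Longrightarrow> \<bar>w n \<zeta>\<bar> \<le> M * tail (s n)"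
    and rec: "\<And>n \<zeta>. \<zeta> \<in> prob_vecs \<Longrightarrow> w n \<zeta> = shapley (s n) (s (Suc n)) (w (Suc n)) \<zeta>"
  shows "is_value strategies strategies (total_payoff g k q s \<zeta>0) (w 0 \<zeta>0)"
proof (rule is_valueI)
  fix e :: real assume e: "e > 0"
  have L: "M * tail (s n) \<ge> 0" for n using M(1) tail_nonneg[OF s_nonneg] by simp
  have en: "e * (1 / 2) ^ Suc n > 0" for n using e by simp
  note c = l1_lipschitz_continuous[OF w]
  let ?F = "\<lambda>n \<zeta> i j. belief_stage_payoff (s n) (s (Suc n)) \<zeta> i j + w (Suc n) (\<zeta> v* P (s (Suc n) - s n) i j)"
  have "\<forall>n. \<exists>\<xi>. \<xi> \<in> borel \<rightarrow>\<^sub>M prob_algebra borel \<and>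
      (\<forall>\<zeta>\<in>prob_vecs. \<forall>y\<in>regular_probs. w n \<zeta> - e * (1 / 2) ^ Suc n \<le> mixed_ext (?F n \<zeta>) (\<xi> \<zeta>) y)"
  proof (rule allI, goal_cases)
    case (1 n)
    show ?case using near_optimal_selection(1)[OF s_nonneg[of n] s_step[of n] w[of "Suc n"] L[of "Suc n"] en[of n]] rec[of _ n] by simp
  qed
  from choice[OF this] obtain \<xi> where \<xi>': "\<forall>n. \<xi> n \<in> borel \<rightarrow>\<^sub>M prob_algebra borel \<and>
      (\<forall>\<zeta>\<in>prob_vecs. \<forall>y\<in>regular_probs. w n \<zeta> - e * (1 / 2) ^ Suc n \<le> mixed_ext (?F n \<zeta>) (\<xi> n \<zeta>) y)" by (elim exE)
  have \<xi>: "\<xi> n \<in> borel \<rightarrow>\<^sub>M prob_algebra borel" for n using \<xi>' by simp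
  have \<xi>2: "w n \<zeta> - e * (1 / 2) ^ Suc n \<le> mixed_ext (?F n \<zeta>) (\<xi> n \<zeta>) y"
    if "\<zeta> \<in> prob_vecs" "y \<in> regular_probs" for n \<zeta> y
    using \<xi>'[THEN spec, THEN conjunct2, THEN bspec, OF that(1), THEN bspec, OF that(2)] .
  define \<sigma> where "\<sigma> n \<alpha> = \<xi> n (belief n \<alpha>)" for n \<alpha>
  have \<sigma>: "\<sigma> \<in> strategies" unfolding strategies_def \<sigma>_def[abs_def]
    using measurable_compose[OF belief_measurable[OF order_refl] \<xi>] by simp
  have "w 0 \<zeta>0 - e \<le> total_payoff g k q s \<zeta>0 \<sigma> \<tau>" if \<tau>: "\<tau> \<in> strategies" for \<tau>
  proof -
    interpret play g k q s \<zeta>0 \<sigma> \<tau> by unfold_locales (rule \<sigma> \<tau>)+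
    show ?thesis
      using e \<xi>2[OF belief_prob strategies_regular(2)]
      by (intro verification_lower[OF c w_bound]) (simp_all add: stage_value_def[OF c w_bound] \<sigma>_def)
  qed
  with \<sigma> show "\<exists>\<sigma>\<in>strategies. \<forall>\<tau>\<in>strategies. w 0 \<zeta>0 - e \<le> total_payoff g k q s \<zeta>0 \<sigma> \<tau>" by blast
  have "\<forall>n. \<exists>\<xi>. \<xi> \<in> borel \<rightarrow>\<^sub>M prob_algebra borel \<and>
      (\<forall>\<zeta>\<in>prob_vecs. \<forall>x\<in>regular_probs. mixed_ext (?F n \<zeta>) x (\<xi> \<zeta>) \<le> w n \<zeta> + e * (1 / 2) ^ Suc n)"
  proof (rule allI, goal_cases)
    case (1 n)
    show ?case using near_optimal_selection(2)[OF s_nonneg[of n] s_step[of n] w[of "Suc n"] L[of "Suc n"] en[of n]] rec[of _ n] by simp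
  qed
  from choice[OF this] obtain \<eta> where \<eta>': "\<forall>n. \<eta> n \<in> borel \<rightarrow>\<^sub>M prob_algebra borel \<and>
      (\<forall>\<zeta>\<in>prob_vecs. \<forall>x\<in>regular_probs. mixed_ext (?F n \<zeta>) x (\<eta> n \<zeta>) \<le> w n \<zeta> + e * (1 / 2) ^ Suc n)" by (elim exE)
  have \<eta>: "\<eta> n \<in> borel \<rightarrow>\<^sub>M prob_algebra borel" for n using \<eta>' by simp
  have \<eta>2: "mixed_ext (?F n \<zeta>) x (\<eta> n \<zeta>) \<le> w n \<zeta> + e * (1 / 2) ^ Suc n"
    if "\<zeta> \<in> prob_vecs" "x \<in> regular_probs" for n \<zeta> x
    using \<eta>'[THEN spec, THEN conjunct2, THEN bspec, OF that(1), THEN bspec, OF that(2)] .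
  define \<tau> where "\<tau> n \<alpha> = \<eta> n (belief n \<alpha>)" for n \<alpha>
  have \<tau>: "\<tau> \<in> strategies" unfolding strategies_def \<tau>_def[abs_def]
    using measurable_compose[OF belief_measurable[OF order_refl] \<eta>] by simp
  have "total_payoff g k q s \<zeta>0 \<sigma> \<tau> \<le> w 0 \<zeta>0 + e" if \<sigma>: "\<sigma> \<in> strategies" for \<sigma>
  proof -
    interpret play g k q s \<zeta>0 \<sigma> \<tau> by unfold_locales (rule \<sigma> \<tau>)+
    show ?thesis
      using e \<eta>2[OF belief_prob strategies_regular(1)]
      by (intro verification_upper[OF c w_bound]) (simp_all add: stage_value_def[OF c w_bound] \<tau>_def)
  qed
  with \<tau> show "\<exists>\<tau>\<in>strategies. \<forall>\<sigma>\<in>strategies. total_payoff g k q s \<zeta>0 \<sigma> \<tau> \<le> w 0 \<zeta>0 + e" by blast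
qed

end

context unobserved_game
begin

text \<open>The game from stage n is a \<open>subgame\<close> on shifted times, whose recursion is
  solved by the shifted sequence \<open>W (n + l)\<close>. One solution W thus identifies all the
  values of a partition, and its properties pass to \<open>V_grid\<close>.\<close>

lemma partition_value:
  assumes s: "time_partition s"
  shows "\<zeta> \<in> prob_vecs \<Longrightarrow> is_value strategies strategies (payoff_from g k q s n \<zeta>) (V_grid g k q s n \<zeta>)"
    and "l1_lipschitz (M * tail (s n)) (V_grid g k q s n)"
    and "\<zeta> \<in> prob_vecs \<Longrightarrow> \<bar>V_grid g k q s n \<zeta>\<bar> \<le> M * tail (s n)"
    and "\<zeta> \<in> prob_vecs \<Longrightarrow> V_grid g k q s n \<zeta> = shapley (s n) (s (Suc n)) (V_grid g k q s (Suc n)) \<zeta>"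
proof -
  obtain W where W: "\<And>n. l1_lipschitz (M * tail (s n)) (W n)"
    "\<And>n \<zeta>. \<zeta> \<in> prob_vecs \<Longrightarrow> \<bar>W n \<zeta>\<bar> \<le> M * tail (s n)"
    "\<And>n \<zeta>. \<zeta> \<in> prob_vecs \<Longrightarrow> W n \<zeta> = shapley (s n) (s (Suc n)) (W (Suc n)) \<zeta>"
    using recursive_value_exists[OF s] by blast
  have val: "is_value strategies strategies (payoff_from g k q s n \<zeta>) (W n \<zeta>)" if \<zeta>: "\<zeta> \<in> prob_vecs" for n \<zeta>
  proof -
    have mono: "strict_mono (\<lambda>l. s (n + l))" using s by (auto simp: time_partition_def strict_mono_def)
    have "filterlim s at_top sequentially" using s by (simp add: time_partition_def)
    moreover have "filterlim ((+) n) sequentially sequentially" by (rule filterlim_subseq) (simp add: strict_mono_def)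
    ultimately have top: "filterlim (\<lambda>l. s (n + l)) at_top sequentially" by (rule filterlim_compose)
    interpret subgame g k q "\<lambda>l. s (n + l)" \<zeta>
      by unfold_locales (use mono top \<zeta> time_partition_nonneg[OF s] in auto)
    have "is_value strategies strategies (total_payoff g k q (\<lambda>l. s (n + l)) \<zeta>) (W (n + 0) \<zeta>)"
      by (rule subgame_value[where w = "\<lambda>l. W (n + l)"]) (use W in auto)
    then show ?thesis by (simp add: payoff_from_def)
  qed
  have eq: "V_grid g k q s n \<zeta> = W n \<zeta>" if "\<zeta> \<in> prob_vecs" for n \<zeta>
    using game_value_eq[OF val[OF that]] by (simp add: V_grid_def)
  show "is_value strategies strategies (payoff_from g k q s n \<zeta>) (V_grid g k q s n \<zeta>)" if "\<zeta> \<in> prob_vecs"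
    using val[OF that] eq[OF that] by simp
  show "l1_lipschitz (M * tail (s n)) (V_grid g k q s n)"
    using W(1) by (simp add: l1_lipschitz_def eq)
  show "\<bar>V_grid g k q s n \<zeta>\<bar> \<le> M * tail (s n)" if "\<zeta> \<in> prob_vecs" using W(2)[OF that] eq[OF that] by simp
  show "V_grid g k q s n \<zeta> = shapley (s n) (s (Suc n)) (V_grid g k q s (Suc n)) \<zeta>" if \<zeta>: "\<zeta> \<in> prob_vecs"
    using W(3)[OF \<zeta>] time_partition_mono[OF s, of n "Suc n"]
    by (simp add: eq[OF \<zeta>] shapley_def eq[OF vP_prob] \<zeta>)
qed

end

section \<open>The Hamiltonian\<close>

lemma is_value_cong:
  "(\<And>a b. a \<in> A \<Longrightarrow> b \<in> B \<Longrightarrow> f a b = f' a b) \<Longrightarrow> is_value A B f v \<longleftrightarrow> is_value A B f' v"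
  unfolding is_value_def by (simp cong: SUP_cong INF_cong)

context unobserved_game
begin

text \<open>The game of the Hamiltonian in pure actions. Its mixed extension is
  \<open>hamiltonian_payoff\<close> by \<open>mixed_ext_ham\<close>, so the minimax theorem for
  continuous payoffs applies.\<close>

definition ham where
  "ham t \<zeta> p i j = (\<Sum>z\<in>UNIV. \<zeta> $ z * g z i j) * k t + (\<zeta> v* q i j) \<bullet> p"

text \<open>As a linear combination of the functions \<open>g z\<close> and of the entries of
  \<open>q\<close>, the payoff is continuous and can be integrated term by term.\<close>

lemma ham_sum:
  "ham t \<zeta> p i j = (\<Sum>z\<in>UNIV. \<zeta> $ z * k t * g z i j) + (\<Sum>z'\<in>UNIV. \<Sum>z\<in>UNIV. \<zeta> $ z * p $ z' * q i j $ z $ z')"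
  by (simp add: ham_def inner_vec_def vector_matrix_mult_def sum_distrib_right sum_distrib_left mult_ac)

lemma q_entry_cont: "continuous_on UNIV (\<lambda>(i, j). q i j $ z $ z')"
  using q_cont unfolding case_prod_beta' by (intro continuous_intros)

lemma ham_cont: "continuous_on UNIV (\<lambda>(i, j). ham t \<zeta> p i j)"
  using g_cont q_entry_cont unfolding ham_sum case_prod_beta'
  by (intro continuous_on_add continuous_on_sum continuous_on_mult continuous_on_const)

lemma mixed_ext_ham:
  assumes xy: "x \<in> regular_probs" "y \<in> regular_probs"
  shows "mixed_ext (ham t \<zeta> p) x y = hamiltonian_payoff g k q t \<zeta> p x y"
proof -
  let ?m = "x \<Otimes>\<^sub>M y"
  interpret x: prob_space x by (rule regular_probsD xy)+
  interpret y: prob_space y by (rule regular_probsD xy)+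
  interpret m: pair_prob_space x y by unfold_locales
  note gi = mixed_ext_iterated(1)[OF g_cont xy] and qi = mixed_ext_iterated(1)[OF q_entry_cont xy]
  have s: "sets ?m = sets (borel \<Otimes>\<^sub>M borel)" by (intro sets_pair_measure_cong regular_probsD xy)
  obtain B where B: "\<And>i j. norm (q i j) \<le> B" using continuous_Pair_bounded[OF q_cont] by blast
  have qI: "integrable ?m (\<lambda>a. q (fst a) (snd a))" using B continuous_Pair_measurable(1)[OF q_cont]
    by (intro m.integrable_const_bound[of _ B]) (auto simp: measurable_cong_sets[OF s refl])
  have "bounded_linear (\<lambda>A :: real ^ 'w ^ 'w. A $ z $ z')" for z z'
    by (rule bounded_linear_compose[OF bounded_linear_vec_nth bounded_linear_vec_nth])
  from integral_bounded_linear[OF this qI]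
  have qe: "(\<integral>a. q (fst a) (snd a) $ z $ z' \<partial>?m) = mixed_ext q x y $ z $ z'" for z z' by (simp add: mixed_ext_def)
  have i1: "integrable ?m (\<lambda>a. \<Sum>z\<in>UNIV. \<zeta> $ z * k t * g z (fst a) (snd a))"
    by (intro Bochner_Integration.integrable_sum integrable_mult_right gi)
  have i2: "integrable ?m (\<lambda>a. \<Sum>z\<in>UNIV. \<zeta> $ z * p $ z' * q (fst a) (snd a) $ z $ z')" for z'
    by (intro Bochner_Integration.integrable_sum integrable_mult_right qi)
  have "mixed_ext (ham t \<zeta> p) x y = (\<Sum>z\<in>UNIV. \<zeta> $ z * k t * mixed_ext (g z) x y)
      + (\<Sum>z'\<in>UNIV. \<Sum>z\<in>UNIV. \<zeta> $ z * p $ z' * mixed_ext q x y $ z $ z')"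
    unfolding mixed_ext_def[of "ham t \<zeta> p"] ham_sum
    by (simp only: Bochner_Integration.integral_add[OF i1 Bochner_Integration.integrable_sum[OF i2]]
        Bochner_Integration.integral_sum[OF i2]
        Bochner_Integration.integral_sum[OF integrable_mult_right[OF gi]]
        Bochner_Integration.integral_sum[OF integrable_mult_right[OF qi]]
        integral_mult_right_zero qe mixed_ext_def[of "g _", symmetric])
  also have "\<dots> = hamiltonian_payoff g k q t \<zeta> p x y"
    by (simp add: hamiltonian_payoff_def belief_payoff_def inner_vec_def vector_matrix_mult_def
        sum_distrib_right sum_distrib_left mult_ac)
  finally show ?thesis .
qed

lemma hamiltonian_value:
  "is_value regular_probs regular_probs (hamiltonian_payoff g k q t \<zeta> p) (mixed_value (ham t \<zeta> p))"
  using is_value_mixed_value[OF ham_cont[of t \<zeta> p]] by (simp add: is_value_cong[OF mixed_ext_ham])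

lemma hamiltonian_eq: "hamiltonian g k q t \<zeta> p = mixed_value (ham t \<zeta> p)"
  unfolding hamiltonian_def by (rule game_value_eq[OF hamiltonian_value])

lemma vq_norm: "\<exists>C\<ge>0. \<forall>i j v. norm (v v* q i j) \<le> C * norm v"
proof -
  obtain B where B: "B \<ge> 0" "\<And>i j z z'. \<bar>q i j $ z $ z'\<bar> \<le> B" using q_bound by blast
  have "norm (v v* q i j) \<le> CARD('w) * (B * CARD('w)) * norm v" for i j v
  proof -
    have "\<bar>(v v* q i j) $ z'\<bar> \<le> B * l1 v" for z'
    proof -
      have "\<bar>(v v* q i j) $ z'\<bar> \<le> (\<Sum>z\<in>UNIV. \<bar>v $ z\<bar> * B)"
        unfolding vector_matrix_mult_def vec_lambda_beta
        by (rule order_trans[OF sum_abs]) (auto simp: abs_mult mult.commute[of "\<bar>q i j $ _ $ _\<bar>"] intro!: sum_mono mult_left_mono B)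
      then show ?thesis by (simp add: l1_def sum_distrib_left mult.commute)
    qed
    then have "l1 (v v* q i j) \<le> CARD('w) * (B * l1 v)"
      unfolding l1_def[of "v v* q i j"] using sum_bounded_above[of UNIV "\<lambda>z'. \<bar>(v v* q i j) $ z'\<bar>" "B * l1 v"] by simp
    also have "\<dots> \<le> CARD('w) * (B * (CARD('w) * norm v))" using B(1) by (intro mult_left_mono l1_le_norm) auto
    finally show ?thesis using norm_le_l1[of "v v* q i j"] by (simp add: mult_ac)
  qed
  then show ?thesis using B(1) by (intro exI[of _ "CARD('w) * (B * CARD('w))"]) auto
qed

lemma vm_diff: "(\<zeta> v* A) - (\<xi> v* A) = (\<zeta> - \<xi>) v* (A :: real ^ 'w ^ 'w)"
  by (simp add: vec_eq_iff vector_matrix_mult_def sum_subtractf[symmetric] left_diff_distrib right_diff_distrib)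

text \<open>The gradient \<open>p\<close> enters only through the generator, so it multiplies the
  distance of the beliefs but not that of the times. This is the structure that the comparison
  principle exploits, where \<open>p\<close> is the belief difference divided by a small
  number.\<close>

lemma ham_continuity:
  "\<exists>C\<ge>0. \<forall>t s \<zeta> \<xi> p i j. t \<ge> 0 \<and> s \<ge> 0 \<and> \<xi> \<in> prob_vecs \<longrightarrow>
     ham t \<zeta> p i j \<le> ham s \<xi> p i j + C * (\<bar>t - s\<bar> + norm (\<zeta> - \<xi>)) + C * norm (\<zeta> - \<xi>) * norm p"
proof -
  obtain Cq where Cq: "Cq \<ge> 0" "\<And>i j v. norm (v v* q i j) \<le> Cq * norm v" using vq_norm by blast
  obtain K where K: "K \<ge> 0" "\<And>t. t \<ge> 0 \<Longrightarrow> k t \<le> K" using k_bound by blast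
  obtain L where L: "L-lipschitz_on {0..} k" using k_lipschitz by blast
  have L0: "L \<ge> 0" by (rule lipschitz_on_nonneg[OF L])
  define C where "C = M * CARD('w) * K + M * L + Cq"
  have C: "C \<ge> 0" "M * CARD('w) * K \<le> C" "M * L \<le> C" "Cq \<le> C" using M K L0 Cq by (auto simp: C_def)
  have "ham t \<zeta> p i j \<le> ham s \<xi> p i j + C * (\<bar>t - s\<bar> + norm (\<zeta> - \<xi>)) + C * norm (\<zeta> - \<xi>) * norm p"
    if ts: "t \<ge> 0" "s \<ge> 0" and \<xi>: "\<xi> \<in> prob_vecs" for t s \<zeta> \<xi> p i j
  proof -
    let ?g = "\<lambda>\<zeta>. \<Sum>z\<in>UNIV. \<zeta> $ z * g z i j"
    have "\<bar>?g \<zeta> - ?g \<xi>\<bar> \<le> M * (CARD('w) * norm (\<zeta> - \<xi>))"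
      using M(1) by (intro order_trans[OF weighted_diff_le[OF M(2)]] mult_left_mono l1_le_norm)
    then have 1: "\<bar>(?g \<zeta> - ?g \<xi>) * k t\<bar> \<le> M * (CARD('w) * norm (\<zeta> - \<xi>)) * K"
      unfolding abs_mult using K(2)[OF ts(1)] k_nonneg[OF ts(1)] M(1) K(1) by (intro mult_mono) auto
    have "\<bar>?g \<xi>\<bar> \<le> M" by (rule weighted_abs_le[OF \<xi> M(2)])
    moreover have "\<bar>k t - k s\<bar> \<le> L * \<bar>t - s\<bar>" using lipschitz_onD[OF L, of t s] ts by (simp add: dist_real_def)
    ultimately have 2: "\<bar>?g \<xi> * (k t - k s)\<bar> \<le> M * (L * \<bar>t - s\<bar>)" unfolding abs_mult using M(1) by (intro mult_mono) auto
    have "(\<zeta> v* q i j) \<bullet> p - (\<xi> v* q i j) \<bullet> p = ((\<zeta> - \<xi>) v* q i j) \<bullet> p"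
      by (simp only: inner_diff_left[symmetric] vm_diff)
    also have "\<dots> \<le> norm ((\<zeta> - \<xi>) v* q i j) * norm p" by (rule norm_cauchy_schwarz)
    also have "\<dots> \<le> (Cq * norm (\<zeta> - \<xi>)) * norm p" by (intro mult_right_mono Cq(2)) simp
    also have "\<dots> \<le> C * norm (\<zeta> - \<xi>) * norm p" using C by (intro mult_right_mono) auto
    finally have 3: "(\<zeta> v* q i j) \<bullet> p - (\<xi> v* q i j) \<bullet> p \<le> C * norm (\<zeta> - \<xi>) * norm p" .
    have "?g \<zeta> * k t - ?g \<xi> * k s = (?g \<zeta> - ?g \<xi>) * k t + ?g \<xi> * (k t - k s)" by (simp add: algebra_simps)
    also have "\<dots> \<le> M * (CARD('w) * norm (\<zeta> - \<xi>)) * K + M * (L * \<bar>t - s\<bar>)" using 1 2 by linarith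
    also have "\<dots> = (M * CARD('w) * K) * norm (\<zeta> - \<xi>) + M * L * \<bar>t - s\<bar>" by (simp add: mult_ac)
    also have "\<dots> \<le> C * norm (\<zeta> - \<xi>) + C * \<bar>t - s\<bar>" using C by (intro add_mono mult_right_mono) auto
    finally show ?thesis using 3 by (simp add: ham_def distrib_left)
  qed
  with C(1) show ?thesis by blast
qed

lemma hamiltonian_continuity:
  "\<exists>C\<ge>0. \<forall>t s \<zeta> \<xi> p. t \<ge> 0 \<and> s \<ge> 0 \<and> \<zeta> \<in> prob_vecs \<and> \<xi> \<in> prob_vecs \<longrightarrow>
     hamiltonian g k q t \<zeta> p - hamiltonian g k q s \<xi> p
      \<le> C * (\<bar>t - s\<bar> + norm (\<zeta> - \<xi>)) + C * norm (\<zeta> - \<xi>) * norm p"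
proof -
  obtain C where C: "C \<ge> 0" and h: "\<And>t s \<zeta> \<xi> p i j. t \<ge> 0 \<Longrightarrow> s \<ge> 0 \<Longrightarrow> \<xi> \<in> prob_vecs \<Longrightarrow>
     ham t \<zeta> p i j \<le> ham s \<xi> p i j + C * (\<bar>t - s\<bar> + norm (\<zeta> - \<xi>)) + C * norm (\<zeta> - \<xi>) * norm p"
    using ham_continuity by blast
  have "hamiltonian g k q t \<zeta> p - hamiltonian g k q s \<xi> p
      \<le> C * (\<bar>t - s\<bar> + norm (\<zeta> - \<xi>)) + C * norm (\<zeta> - \<xi>) * norm p"
    if ts: "t \<ge> 0" "s \<ge> 0" and \<xi>: "\<xi> \<in> prob_vecs" for t s \<zeta> \<xi> p
  proof -
    let ?d = "C * (\<bar>t - s\<bar> + norm (\<zeta> - \<xi>)) + C * norm (\<zeta> - \<xi>) * norm p"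
    have "ham t \<zeta> p i j \<le> ham s \<xi> p i j + ?d" for i j using h[OF ts \<xi>, of \<zeta> p i j] by linarith
    from mixed_value_mono[OF ham_cont ham_cont this] show ?thesis unfolding hamiltonian_eq by linarith
  qed
  with C show ?thesis by blast
qed

section \<open>Regularity of the values in time\<close>

text \<open>During one stage the payoff is at most M * K times its length and the belief moves by at
  most C times its length; the stage game is therefore close to the constant game with payoff
  \<open>V_grid\<close> at the next time.\<close>

lemma grid_value_step:
  "\<exists>C\<ge>0. \<exists>h0>0. \<forall>\<pi> n. \<forall>\<zeta>\<in>prob_vecs. time_partition \<pi> \<and> \<pi> (Suc n) - \<pi> n \<le> h0 \<longrightarrow>
    \<bar>V_grid g k q \<pi> n \<zeta> - V_grid g k q \<pi> (Suc n) \<zeta>\<bar> \<le> C * (\<pi> (Suc n) - \<pi> n)"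
proof -
  obtain C h0 where C: "C \<ge> 0" "h0 > 0" and Ch: "\<And>h i j \<zeta>. 0 \<le> h \<Longrightarrow> h \<le> h0 \<Longrightarrow> \<zeta> \<in> prob_vecs \<Longrightarrow>
      l1 (\<zeta> v* P h i j - \<zeta>) \<le> C * h" using vP_expansion by blast
  obtain K where K: "K \<ge> 0" "\<And>t. t \<ge> 0 \<Longrightarrow> k t \<le> K" using k_bound by blast
  have "\<bar>V_grid g k q \<pi> n \<zeta> - V_grid g k q \<pi> (Suc n) \<zeta>\<bar> \<le> (M * K + M * C) * (\<pi> (Suc n) - \<pi> n)"
    if \<zeta>: "\<zeta> \<in> prob_vecs" and \<pi>: "time_partition \<pi>" and h: "\<pi> (Suc n) - \<pi> n \<le> h0" for \<pi> n \<zeta>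
  proof -
    let ?V = "V_grid g k q \<pi>" and ?a = "\<pi> n" and ?b = "\<pi> (Suc n)"
    have ab: "0 \<le> ?a" "?a \<le> ?b" using time_partition_nonneg[OF \<pi>] time_partition_mono[OF \<pi>] by auto
    let ?F = "\<lambda>i j. belief_stage_payoff ?a ?b \<zeta> i j + ?V (Suc n) (\<zeta> v* P (?b - ?a) i j)"
    have near: "\<bar>?F i j - ?V (Suc n) \<zeta>\<bar> \<le> (M * K + M * C) * (?b - ?a)" for i j
    proof -
      have "\<bar>belief_stage_payoff ?a ?b \<zeta> i j\<bar> \<le> M * (K * (?b - ?a))"
        by (rule order_trans[OF belief_stage_payoff_bound[OF ab(1) \<zeta>]])
          (intro mult_left_mono mass_le ab K M)
      moreover have "\<bar>?V (Suc n) (\<zeta> v* P (?b - ?a) i j) - ?V (Suc n) \<zeta>\<bar> \<le> M * tail ?b * l1 (\<zeta> v* P (?b - ?a) i j - \<zeta>)"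
        using ab by (intro l1_lipschitzD[OF partition_value(2)[OF \<pi>]] vP_prob \<zeta>) auto
      moreover have "\<dots> \<le> M * 1 * (C * (?b - ?a))"
        using ab h M(1) tail_le_1[of ?b] tail_nonneg[of ?b] by (intro mult_mono Ch \<zeta>) auto
      ultimately show ?thesis by (simp add: algebra_simps)
    qed
    have le: "?F i j \<le> ?V (Suc n) \<zeta> + (M * K + M * C) * (?b - ?a)" "?V (Suc n) \<zeta> \<le> ?F i j + (M * K + M * C) * (?b - ?a)" for i j
      using near[of i j] by (simp_all only: abs_le_iff) linarith+
    note c = shapley_cont[OF ab l1_lipschitz_continuous[OF partition_value(2)[OF \<pi>]] \<zeta>]
    have cc: "continuous_on UNIV (\<lambda>(i :: 'i, j :: 'j). ?V (Suc n) \<zeta>)" by (simp add: case_prod_beta')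
    have "mixed_value ?F \<le> mixed_value (\<lambda>(i::'i) (j::'j). ?V (Suc n) \<zeta>) + (M * K + M * C) * (?b - ?a)"
      by (rule mixed_value_mono[OF c cc le(1)])
    moreover have "mixed_value (\<lambda>(i::'i) (j::'j). ?V (Suc n) \<zeta>) \<le> mixed_value ?F + (M * K + M * C) * (?b - ?a)"
      by (rule mixed_value_mono[OF cc c le(2)])
    ultimately show ?thesis
      using partition_value(4)[OF \<pi> \<zeta>, of n] by (simp add: shapley_def mixed_value_const abs_le_iff)
  qed
  moreover have "M * K + M * C \<ge> 0" using M K C by simp
  ultimately show ?thesis using C(2) by blast
qed

section \<open>Estimates along partitions of vanishing mesh\<close>

lemma mesh_less: "mesh \<pi> < ereal h \<Longrightarrow> \<pi> (Suc n) - \<pi> n < h"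
  unfolding mesh_def using order.strict_trans1[OF SUP_upper[of n UNIV "\<lambda>n. ereal (\<pi> (Suc n) - \<pi> n)"]] by fastforce

lemma eventually_vanishing_mesh:
  "h > 0 \<Longrightarrow> eventually (\<lambda>\<pi>. time_partition \<pi> \<and> (\<forall>n. \<pi> (Suc n) - \<pi> n < h)) vanishing_mesh"
proof -
  assume h: "h > 0"
  have "eventually (\<lambda>x. x < ereal h) (nhds (0 :: ereal))"
    using h by (intro eventually_nhds_in_open[of "{..<ereal h}", simplified]) auto
  then have "eventually (\<lambda>\<pi>. mesh \<pi> < ereal h) (filtercomap mesh (nhds 0))" by (rule eventually_filtercomapI)
  then show ?thesis unfolding vanishing_mesh_def
    by (auto simp: eventually_inf_principal elim!: eventually_mono intro: mesh_less)
qed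

text \<open>The uniform partitions of step 1 / (m + 1) enter every neighbourhood of mesh 0;
  otherwise every statement about limits along the filter would be vacuous.\<close>

lemma vanishing_mesh_nontrivial: "vanishing_mesh \<noteq> bot"
proof
  assume bot: "vanishing_mesh = bot"
  then have "eventually (\<lambda>\<pi>. time_partition \<pi> \<longrightarrow> False) (filtercomap mesh (nhds 0))"
  proof -
    have "eventually (\<lambda>\<pi>. False) vanishing_mesh" using bot by simp
    then show ?thesis unfolding vanishing_mesh_def eventually_inf_principal by simp
  qed
  then obtain Q where Q: "eventually Q (nhds (0 :: ereal))" "\<And>\<pi>. Q (mesh \<pi>) \<Longrightarrow> \<not> time_partition \<pi>"
    unfolding eventually_filtercomap by blast
  have "((\<lambda>m. ereal (1 / real (Suc m))) \<longlongrightarrow> ereal 0) sequentially"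
    by (intro tendsto_ereal) (rule LIMSEQ_Suc[OF lim_1_over_n])
  then have "eventually (\<lambda>m. Q (ereal (1 / real (Suc m)))) sequentially"
    using Q(1) unfolding filterlim_iff by (simp add: zero_ereal_def)
  then obtain m where m: "Q (ereal (1 / real (Suc m)))" by (auto simp: eventually_sequentially)
  define d where "d = 1 / real (Suc m)"
  have d: "d > 0" by (simp add: d_def)
  have "filterlim (\<lambda>n. real n * d) at_top sequentially"
    using d by (intro filterlim_at_top_mult_tendsto_pos[OF tendsto_const] filterlim_real_sequentially)
  then have "time_partition (\<lambda>n. real n * d)" using d by (auto simp: time_partition_def strict_mono_def)
  moreover have "mesh (\<lambda>n. real n * d) = ereal d" by (simp add: mesh_def algebra_simps)
  ultimately show False using Q(2) m by (simp add: d_def)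
qed

text \<open>Constant on each stage instead of interpolated: each value is that of an actual game, to
  which the recursion applies, and it differs from \<open>V_part\<close> by at most the change over
  one stage.\<close>

definition "grid_value \<pi> p = V_grid g k q \<pi> (stage \<pi> (fst p)) (snd p)"

text \<open>The additive \<open>e\<close> absorbs the jumps between stages. For mesh at most 1 the
  last partition time before t is at least t - 1, whence the shifted argument of
  \<open>tail\<close>.\<close>

lemma grid_value_estimates:
  "\<exists>L\<ge>0. \<forall>e>0. eventually (\<lambda>\<pi>.
     (\<forall>p\<in>time_beliefs. \<forall>r\<in>time_beliefs. \<bar>grid_value \<pi> p - grid_value \<pi> r\<bar> \<le> L * dist p r + e) \<and>
     (\<forall>p\<in>time_beliefs. \<bar>V_part g k q \<pi> p - grid_value \<pi> p\<bar> \<le> e) \<and>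
     (\<forall>p\<in>time_beliefs. \<bar>grid_value \<pi> p\<bar> \<le> M * tail (max 0 (fst p - 1)))) vanishing_mesh"
proof -
  obtain C h0 where C: "C \<ge> 0" "h0 > 0" and step: "\<And>\<pi> n \<zeta>. \<zeta> \<in> prob_vecs \<Longrightarrow> time_partition \<pi> \<Longrightarrow> \<pi> (Suc n) - \<pi> n \<le> h0 \<Longrightarrow>
    \<bar>V_grid g k q \<pi> n \<zeta> - V_grid g k q \<pi> (Suc n) \<zeta>\<bar> \<le> C * (\<pi> (Suc n) - \<pi> n)"
    using grid_value_step by blast
  define L where "L = C + M * CARD('w)"
  have L: "L \<ge> 0" using C M by (simp add: L_def)
  show ?thesis
  proof (intro exI[of _ L] conjI L allI impI)
    fix e :: real assume e: "e > 0"
    define h where "h = min (min h0 1) (e / (C + 1))"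
    have h: "h > 0" "h \<le> h0" "h \<le> 1" using C e by (auto simp: h_def)
    have "h \<le> e / (C + 1)" by (simp add: h_def)
    then have "(C + 1) * h \<le> e" using C by (simp add: pos_le_divide_eq mult.commute)
    then have Ch: "C * h \<le> e" using h(1) by (simp add: distrib_right)
    from eventually_vanishing_mesh[OF h(1)]
    show "eventually (\<lambda>\<pi>.
     (\<forall>p\<in>time_beliefs. \<forall>r\<in>time_beliefs. \<bar>grid_value \<pi> p - grid_value \<pi> r\<bar> \<le> L * dist p r + e) \<and>
     (\<forall>p\<in>time_beliefs. \<bar>V_part g k q \<pi> p - grid_value \<pi> p\<bar> \<le> e) \<and>
     (\<forall>p\<in>time_beliefs. \<bar>grid_value \<pi> p\<bar> \<le> M * tail (max 0 (fst p - 1)))) vanishing_mesh"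
    proof eventually_elim
      case (elim \<pi>)
      then have \<pi>: "time_partition \<pi>" and \<delta>: "\<And>n. \<pi> (Suc n) - \<pi> n < h" by auto
      let ?V = "V_grid g k q \<pi>"
      have st: "\<bar>?V n \<zeta> - ?V (Suc n) \<zeta>\<bar> \<le> C * (\<pi> (Suc n) - \<pi> n)" if "\<zeta> \<in> prob_vecs" for n \<zeta>
        using \<delta>[of n] h by (intro step that \<pi>) auto
      have tel: "\<bar>?V n \<zeta> - ?V (n + d) \<zeta>\<bar> \<le> C * (\<pi> (n + d) - \<pi> n)" if "\<zeta> \<in> prob_vecs" for n d \<zeta>
      proof (induction d)
        case (Suc d) with st[OF that, of "n + d"] show ?case by (simp add: right_diff_distrib)
      qed simp
      have time: "\<bar>?V n \<zeta> - ?V m \<zeta>\<bar> \<le> C * \<bar>\<pi> n - \<pi> m\<bar>" if "\<zeta> \<in> prob_vecs" for n m \<zeta>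
      proof (cases "n \<le> m")
        case True
        then show ?thesis using tel[OF that, of n "m - n"] time_partition_mono[OF \<pi> True] by simp
      next
        case False
        then show ?thesis using tel[OF that, of m "n - m"] time_partition_mono[OF \<pi>, of m n] by simp
      qed
      have lip: "\<bar>grid_value \<pi> p - grid_value \<pi> r\<bar> \<le> L * dist p r + e" if p: "p \<in> time_beliefs" and r: "r \<in> time_beliefs" for p r
      proof -
        let ?n = "stage \<pi> (fst p)" and ?m = "stage \<pi> (fst r)"
        have pr: "fst p \<ge> 0" "fst r \<ge> 0" "snd p \<in> prob_vecs" "snd r \<in> prob_vecs" using p r by (auto simp: time_beliefs_def)
        have "\<bar>\<pi> ?n - \<pi> ?m\<bar> \<le> \<bar>fst p - fst r\<bar> + h"
          using stage_bounds[OF \<pi> pr(1)] stage_bounds[OF \<pi> pr(2)] \<delta>[of ?n] \<delta>[of ?m] by linarith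
        also have "\<bar>fst p - fst r\<bar> \<le> dist p r" using dist_fst_le[of p r] by (simp add: dist_real_def)
        finally have "C * \<bar>\<pi> ?n - \<pi> ?m\<bar> \<le> C * (dist p r + h)" using C by (intro mult_left_mono) auto
        with time[OF pr(3), of ?n ?m] have 1: "\<bar>?V ?n (snd p) - ?V ?m (snd p)\<bar> \<le> C * dist p r + e"
          using Ch by (simp add: distrib_left)
        have "\<bar>?V ?m (snd p) - ?V ?m (snd r)\<bar> \<le> M * tail (\<pi> ?m) * l1 (snd p - snd r)"
          by (rule l1_lipschitzD[OF partition_value(2)[OF \<pi>] pr(3,4)])
        also have "\<dots> \<le> M * 1 * (CARD('w) * norm (snd p - snd r))"
          using M(1) tail_le_1[OF time_partition_nonneg[OF \<pi>]] tail_nonneg[OF time_partition_nonneg[OF \<pi>]]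
          by (intro mult_mono l1_le_norm) auto
        also have "\<dots> \<le> M * CARD('w) * dist p r"
          using M(1) dist_snd_le[of p r] by (simp add: dist_norm mult_left_mono mult.assoc)
        finally show ?thesis using 1 unfolding grid_value_def L_def distrib_right by linarith
      qed
      have part: "\<bar>V_part g k q \<pi> p - grid_value \<pi> p\<bar> \<le> e" if p: "p \<in> time_beliefs" for p
      proof -
        let ?n = "stage \<pi> (fst p)"
        have pp: "fst p \<ge> 0" "snd p \<in> prob_vecs" using p by (auto simp: time_beliefs_def)
        define c where "c = (fst p - \<pi> ?n) / (\<pi> (Suc ?n) - \<pi> ?n)"
        have c: "0 \<le> c" "c \<le> 1" using stage_bounds[OF \<pi> pp(1)] by (auto simp: c_def)
        have "V_part g k q \<pi> p - grid_value \<pi> p = c * (?V (Suc ?n) (snd p) - ?V ?n (snd p))"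
          by (simp add: V_part_def grid_value_def c_def case_prod_beta' Let_def)
        also have "\<bar>\<dots>\<bar> \<le> 1 * (C * (\<pi> (Suc ?n) - \<pi> ?n))"
          unfolding abs_mult using st[OF pp(2), of ?n] c C by (intro mult_mono) (auto simp: abs_minus_commute)
        also have "\<dots> \<le> C * h" using \<delta>[of ?n] C by (simp add: mult_left_mono)
        finally show ?thesis using Ch by linarith
      qed
      have vanish: "\<bar>grid_value \<pi> p\<bar> \<le> M * tail (max 0 (fst p - 1))" if p: "p \<in> time_beliefs" for p
      proof -
        let ?n = "stage \<pi> (fst p)"
        have pp: "fst p \<ge> 0" "snd p \<in> prob_vecs" using p by (auto simp: time_beliefs_def)
        have "max 0 (fst p - 1) \<le> \<pi> ?n"
          using stage_bounds(2)[OF \<pi> pp(1)] \<delta>[of ?n] h(3) time_partition_nonneg[OF \<pi>, of ?n] by simp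
        then have "M * tail (\<pi> ?n) \<le> M * tail (max 0 (fst p - 1))" using M(1) by (intro mult_left_mono tail_antimono) auto
        with partition_value(3)[OF \<pi> pp(2), of ?n] show ?thesis by (simp add: grid_value_def)
      qed
      from lip part vanish show ?case by blast
    qed
  qed
qed

end

section \<open>Upper limits of equicontinuous families\<close>

text \<open>The limit superior along the filter, taken in the reals; \<open>bounds_set\<close>
  provides the bounds that make this infimum meaningful.\<close>

definition upper_limit :: "'p filter \<Rightarrow> ('p \<Rightarrow> 'a \<Rightarrow> real) \<Rightarrow> 'a \<Rightarrow> real" where
  "upper_limit F f p = Inf {c. eventually (\<lambda>\<pi>. f \<pi> p \<le> c) F}"

text \<open>The functions may jump, as \<open>grid_value\<close> does, provided that the jumps are
  eventually below every e; their upper limit is then genuinely L-Lipschitz.\<close>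

locale equicontinuous_family =
  fixes F :: "'p filter" and f :: "'p \<Rightarrow> 'a::metric_space \<Rightarrow> real" and S :: "'a set" and L B :: real
  assumes nontrivial: "F \<noteq> bot" and L: "L \<ge> 0"
    and bounded: "\<And>p. p \<in> S \<Longrightarrow> eventually (\<lambda>\<pi>. \<bar>f \<pi> p\<bar> \<le> B) F"
    and lipschitz: "\<And>e. e > 0 \<Longrightarrow> eventually (\<lambda>\<pi>. \<forall>p\<in>S. \<forall>r\<in>S. \<bar>f \<pi> p - f \<pi> r\<bar> \<le> L * dist p r + e) F"
begin

abbreviation "u \<equiv> upper_limit F f"

lemma bounds_set:
  assumes "p \<in> S"
  shows "{c. eventually (\<lambda>\<pi>. f \<pi> p \<le> c) F} \<noteq> {}" "bdd_below {c. eventually (\<lambda>\<pi>. f \<pi> p \<le> c) F}"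
proof -
  have "eventually (\<lambda>\<pi>. f \<pi> p \<le> B) F" using bounded[OF assms] by eventually_elim auto
  then show "{c. eventually (\<lambda>\<pi>. f \<pi> p \<le> c) F} \<noteq> {}" by blast
  have "- B \<le> c" if "eventually (\<lambda>\<pi>. f \<pi> p \<le> c) F" for c
  proof -
    have "eventually (\<lambda>\<pi>. - B \<le> c) F" using bounded[OF assms] that by eventually_elim auto
    then show ?thesis using nontrivial by (simp add: eventually_const_iff)
  qed
  then show "bdd_below {c. eventually (\<lambda>\<pi>. f \<pi> p \<le> c) F}" by (intro bdd_belowI[of _ "- B"]) blast
qed

lemma eventually_le_upper_limit:
  assumes "p \<in> S" "e > 0" shows "eventually (\<lambda>\<pi>. f \<pi> p \<le> u p + e) F"
proof -
  have "Inf {c. eventually (\<lambda>\<pi>. f \<pi> p \<le> c) F} < u p + e" using assms by (simp add: upper_limit_def)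
  then obtain c where "eventually (\<lambda>\<pi>. f \<pi> p \<le> c) F" "c < u p + e"
    using cInf_lessD[OF bounds_set(1)[OF assms(1)]] by blast
  then show ?thesis by (auto elim: eventually_mono)
qed

lemma upper_limit_le:
  assumes "p \<in> S" "eventually (\<lambda>\<pi>. f \<pi> p \<le> c) F" shows "u p \<le> c"
  unfolding upper_limit_def using assms by (intro cInf_lower bounds_set(2)) auto

lemma upper_limit_ge:
  assumes "p \<in> S" "eventually (\<lambda>\<pi>. c \<le> f \<pi> p) F" shows "c \<le> u p"
  unfolding upper_limit_def
proof (rule cInf_greatest[OF bounds_set(1)[OF assms(1)]])
  fix d assume "d \<in> {c. eventually (\<lambda>\<pi>. f \<pi> p \<le> c) F}"
  then have "eventually (\<lambda>\<pi>. f \<pi> p \<le> d) F" by simp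
  with assms(2) have "eventually (\<lambda>\<pi>. c \<le> d) F" by eventually_elim simp
  then show "c \<le> d" using nontrivial by (simp add: eventually_const_iff)
qed

lemma frequently_ge_upper_limit:
  assumes "p \<in> S" "e > 0" shows "frequently (\<lambda>\<pi>. u p - e \<le> f \<pi> p) F"
  unfolding frequently_def
proof
  assume "eventually (\<lambda>\<pi>. \<not> u p - e \<le> f \<pi> p) F"
  then have "eventually (\<lambda>\<pi>. f \<pi> p \<le> u p - e) F" by eventually_elim auto
  from upper_limit_le[OF assms(1) this] assms(2) show False by simp
qed

lemma upper_limit_lipschitz:
  assumes "p \<in> S" "r \<in> S" shows "u p \<le> u r + L * dist p r"
proof (rule field_le_epsilon)
  fix e :: real assume "e > 0"
  then have e: "e / 2 > 0" by simp
  have "eventually (\<lambda>\<pi>. f \<pi> p \<le> u r + L * dist p r + e) F"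
    using eventually_le_upper_limit[OF assms(2) e] lipschitz[OF e]
  proof eventually_elim
    case (elim \<pi>)
    then have "\<bar>f \<pi> p - f \<pi> r\<bar> \<le> L * dist p r + e / 2" using assms by blast
    with elim(1) show ?case by linarith
  qed
  then show "u p \<le> u r + L * dist p r + e" by (rule upper_limit_le[OF assms(1)])
qed

lemma upper_limit_continuous: "continuous_on S u"
proof -
  have "\<bar>u p - u r\<bar> \<le> L * dist p r" if "p \<in> S" "r \<in> S" for p r
    using upper_limit_lipschitz[OF that] upper_limit_lipschitz[OF that(2,1)] by (simp add: dist_commute)
  then have "L-lipschitz_on S u" using L by (auto simp: lipschitz_on_def dist_real_def)
  then show ?thesis by (rule lipschitz_on_continuous_on)
qed

text \<open>Half of the Arzela-Ascoli argument: the pointwise bound holds eventually at finitely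
  many net points together, and the near-Lipschitz estimate spreads it over the compact set.\<close>

lemma eventually_le_upper_limit_compact:
  assumes K: "compact K" "K \<subseteq> S" and e: "e > 0"
  shows "eventually (\<lambda>\<pi>. \<forall>p\<in>K. f \<pi> p \<le> u p + e) F"
proof -
  \<comment> \<open>Four errors of e / 4: moving from \<open>p\<close> to its net point in
    \<open>f\<close>, the slack of the near-Lipschitz estimate, the bound at the net point, and
    moving back in \<open>u\<close>.\<close>
  define d where "d = e / (4 * (L + 1))"
  have d: "d > 0" using L e by (simp add: d_def)
  have "(L + 1) * d = e / 4" using L by (simp add: d_def field_simps)
  then have Ld: "L * d \<le> e / 4" using d by (simp add: distrib_right)
  have "\<exists>C. finite C \<and> C \<subseteq> K \<and> K \<subseteq> (\<Union>c\<in>C. ball c d)"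
    using seq_compact_imp_totally_bounded[OF compact_imp_seq_compact[OF K(1)]] d by blast
  then obtain C where C: "finite C" "C \<subseteq> K" "K \<subseteq> (\<Union>c\<in>C. ball c d)" by (elim exE conjE)
  have e4: "e / 4 > 0" using e by simp
  have "eventually (\<lambda>\<pi>. \<forall>c\<in>C. f \<pi> c \<le> u c + e / 4) F"
    using C(1) by (rule eventually_ball_finite) (use C(2) K(2) e4 in \<open>auto intro!: eventually_le_upper_limit\<close>)
  with lipschitz[OF e4] show ?thesis
  proof eventually_elim
    case (elim \<pi>)
    show ?case
    proof
      fix p assume p: "p \<in> K"
      then obtain c where c: "c \<in> C" "dist c p < d" using C(3) by auto
      have S: "p \<in> S" "c \<in> S" using p c C(2) K(2) by auto
      have "L * dist p c \<le> L * d" using c(2) L by (intro mult_left_mono) (auto simp: dist_commute)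
      moreover have "\<bar>f \<pi> p - f \<pi> c\<bar> \<le> L * dist p c + e / 4" using elim(1) S by blast
      moreover have "f \<pi> c \<le> u c + e / 4" using elim(2) c(1) by blast
      moreover have "u c \<le> u p + L * dist p c" using upper_limit_lipschitz[OF S(2,1)] by (simp add: dist_commute)
      ultimately show "f \<pi> p \<le> u p + e" using Ld by linarith
    qed
  qed
qed

end

section \<open>Upper limits of value functions are subsolutions\<close>

lemma closed_time_beliefs: "closed (time_beliefs :: (real \<times> (real ^ 'w::finite)) set)"
  unfolding time_beliefs_def by (intro closed_Times compact_imp_closed[OF compact_prob_vecs] closed_atLeast)

text \<open>The mean value inequality for \<psi> minus its linear part at \<open>p\<close>, on a
  convex piece of the domain where the gradient is nearly constant. Both endpoints are free because
  the near-maximal points move with the partition.\<close>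

lemma C1_first_order:
  fixes p :: "real \<times> (real ^ 'w::finite)"
  assumes \<psi>: "C1_test_function \<psi> G" and p: "p \<in> time_beliefs" and \<theta>: "\<theta> > 0"
  obtains d where "d > 0" "\<And>x y. x \<in> time_beliefs \<Longrightarrow> y \<in> time_beliefs \<Longrightarrow> dist p x \<le> d \<Longrightarrow> dist p y \<le> d \<Longrightarrow>
    \<bar>\<psi> x - \<psi> y - (x - y) \<bullet> G p\<bar> \<le> \<theta> * norm (x - y)"
proof -
  obtain U where U: "open U" "time_beliefs \<subseteq> U" "\<And>p. p \<in> U \<Longrightarrow> GDERIV \<psi> p :> G p" "continuous_on U G"
    using \<psi> unfolding C1_test_function_def by blast
  obtain d where d: "d > 0" "\<And>x. x \<in> U \<Longrightarrow> dist x p < d \<Longrightarrow> dist (G x) (G p) < \<theta>"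
    using U(4) p U(2) \<theta> unfolding continuous_on_iff by blast
  let ?S = "time_beliefs \<inter> cball p (d / 2)"
  show thesis
  proof (rule that)
    show "d / 2 > 0" using d by simp
    fix x y assume xy: "x \<in> time_beliefs" "y \<in> time_beliefs" "dist p x \<le> d / 2" "dist p y \<le> d / 2"
    have "norm ((\<lambda>x. \<psi> x - x \<bullet> G p) x - (\<lambda>x. \<psi> x - x \<bullet> G p) y) \<le> \<theta> * norm (x - y)"
    proof (rule differentiable_bound[where S = ?S and f' = "\<lambda>z h. h \<bullet> G z - h \<bullet> G p"])
      show "convex ?S" by (intro convex_Int convex_time_beliefs convex_cball)
      fix z assume z: "z \<in> ?S"
      then have "(\<psi> has_derivative (\<lambda>h. h \<bullet> G z)) (at z)" using U(2,3) unfolding gderiv_def by blast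
      moreover have "((\<lambda>x. x \<bullet> G p) has_derivative (\<lambda>h. h \<bullet> G p)) (at z)"
        by (rule bounded_linear_imp_has_derivative[OF bounded_linear_inner_left])
      ultimately show "((\<lambda>x. \<psi> x - x \<bullet> G p) has_derivative (\<lambda>h. h \<bullet> G z - h \<bullet> G p)) (at z within ?S)"
        by (rule has_derivative_at_withinI[OF has_derivative_diff])
      show "onorm (\<lambda>h. h \<bullet> G z - h \<bullet> G p) \<le> \<theta>"
      proof (rule onorm_bound)
        fix h :: "real \<times> (real ^ 'w)"
        have "dist (G z) (G p) < \<theta>" using z U(2) d by (intro d(2)) (auto simp: dist_commute)
        then have "norm (G z - G p) \<le> \<theta>" by (simp add: dist_norm)
        then have "norm h * norm (G z - G p) \<le> norm h * \<theta>" by (intro mult_left_mono) auto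
        moreover have "\<bar>h \<bullet> (G z - G p)\<bar> \<le> norm h * norm (G z - G p)" by (rule Cauchy_Schwarz_ineq2)
        ultimately show "norm (h \<bullet> G z - h \<bullet> G p) \<le> \<theta> * norm h" by (simp add: inner_diff_right mult.commute)
      qed (use \<theta> in simp)
    qed (use xy in auto)
    then show "\<bar>\<psi> x - \<psi> y - (x - y) \<bullet> G p\<bar> \<le> \<theta> * norm (x - y)" by (simp add: inner_diff_left algebra_simps)
  qed
qed

lemma C1_continuous: "C1_test_function \<psi> G \<Longrightarrow> continuous_on time_beliefs \<psi>"
  unfolding C1_test_function_def gderiv_def
  by (metis continuous_at_imp_continuous_on has_derivative_continuous subsetD)

context unobserved_game
begin

text \<open>Consistency of the scheme with the equation: stage payoff plus the increment of a linear
  function is the stage length times the Hamiltonian integrand, with base point moved to (t, \<xi>).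
  The error per unit of time is of first order in the distance to that point and in the stage
  length.\<close>

lemma stage_game_expansion:
  "\<exists>C\<ge>0. \<exists>h0>0. \<forall>a b \<zeta> t \<xi> p1 p2 i j.
     0 \<le> a \<and> a < b \<and> b - a \<le> h0 \<and> \<zeta> \<in> prob_vecs \<and> 0 \<le> t \<and> \<xi> \<in> prob_vecs \<longrightarrow>
     norm ((b, \<zeta> v* P (b - a) i j) - (a, \<zeta>)) \<le> C * (b - a) \<and>
     belief_stage_payoff a b \<zeta> i j + ((b, \<zeta> v* P (b - a) i j) - (a, \<zeta>)) \<bullet> (p1, p2)
       \<le> (b - a) * (p1 + ham t \<xi> p2 i j + C * (1 + norm p2) * (\<bar>a - t\<bar> + norm (\<zeta> - \<xi>) + (b - a)))"
proof -
  obtain C0 h0 where C0: "C0 \<ge> 0" "h0 > 0" and Ph: "\<And>h i j \<zeta>. 0 \<le> h \<Longrightarrow> h \<le> h0 \<Longrightarrow> \<zeta> \<in> prob_vecs \<Longrightarrow>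
      l1 (\<zeta> v* P h i j - \<zeta> - h *\<^sub>R (\<zeta> v* q i j)) \<le> C0 * h\<^sup>2 \<and> l1 (\<zeta> v* P h i j - \<zeta>) \<le> C0 * h"
    using vP_expansion by blast
  obtain C1 h1 where C1: "C1 \<ge> 0" "h1 > 0" and sp: "\<And>a b \<zeta> i j. \<zeta> \<in> prob_vecs \<Longrightarrow> 0 \<le> a \<Longrightarrow> a \<le> b \<Longrightarrow> b - a \<le> h1 \<Longrightarrow>
     \<bar>belief_stage_payoff a b \<zeta> i j - (b - a) * ((\<Sum>z\<in>UNIV. \<zeta> $ z * g z i j) * k a)\<bar> \<le> C1 * (b - a)\<^sup>2"
    using stage_payoff_expansion by blast
  obtain C2 where C2: "C2 \<ge> 0" and hc: "\<And>t s \<zeta> \<xi> p i j. t \<ge> 0 \<Longrightarrow> s \<ge> 0 \<Longrightarrow> \<xi> \<in> prob_vecs \<Longrightarrow>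
     ham t \<zeta> p i j \<le> ham s \<xi> p i j + C2 * (\<bar>t - s\<bar> + norm (\<zeta> - \<xi>)) + C2 * norm (\<zeta> - \<xi>) * norm p"
    using ham_continuity by blast
  define C where "C = 1 + C0 + C1 + C2"
  have C: "C \<ge> 0" "1 + C0 \<le> C" "C0 + C1 \<le> C" "C2 \<le> C" "C1 \<le> C" "C0 \<le> C" using C0 C1 C2 by (auto simp: C_def)
  have "norm ((b, \<zeta> v* P (b - a) i j) - (a, \<zeta>)) \<le> C * (b - a) \<and>
     belief_stage_payoff a b \<zeta> i j + ((b, \<zeta> v* P (b - a) i j) - (a, \<zeta>)) \<bullet> (p1, p2)
       \<le> (b - a) * (p1 + ham t \<xi> p2 i j + C * (1 + norm p2) * (\<bar>a - t\<bar> + norm (\<zeta> - \<xi>) + (b - a)))"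
    if ab: "0 \<le> a" "a < b" "b - a \<le> min h0 h1" and \<zeta>: "\<zeta> \<in> prob_vecs" and t: "0 \<le> t" and \<xi>: "\<xi> \<in> prob_vecs"
    for a b \<zeta> t \<xi> p1 p2 i j
  proof
    define \<delta> where "\<delta> = b - a"
    have \<delta>: "\<delta> > 0" "\<delta> \<le> h0" "\<delta> \<le> h1" using ab by (auto simp: \<delta>_def)
    let ?\<zeta> = "\<zeta> v* P \<delta> i j"
    have P1: "norm (?\<zeta> - \<zeta>) \<le> C0 * \<delta>" using order_trans[OF norm_le_l1] Ph[of \<delta> \<zeta> i j] \<delta> \<zeta> by auto
    have P2: "norm (?\<zeta> - \<zeta> - \<delta> *\<^sub>R (\<zeta> v* q i j)) \<le> C0 * \<delta>\<^sup>2" using order_trans[OF norm_le_l1] Ph[of \<delta> \<zeta> i j] \<delta> \<zeta> by auto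
    have "norm ((b, ?\<zeta>) - (a, \<zeta>)) \<le> norm (b - a) + norm (?\<zeta> - \<zeta>)" using norm_Pair_le[of "b - a" "?\<zeta> - \<zeta>"] by simp
    also have "\<dots> \<le> (1 + C0) * \<delta>" using P1 \<delta> by (simp add: \<delta>_def distrib_right)
    also have "\<dots> \<le> C * \<delta>" using C \<delta> by (intro mult_right_mono) auto
    finally show "norm ((b, \<zeta> v* P (b - a) i j) - (a, \<zeta>)) \<le> C * (b - a)" by (simp add: \<delta>_def)
    let ?r = "\<bar>a - t\<bar> + norm (\<zeta> - \<xi>)"
    have "(?\<zeta> - \<zeta>) \<bullet> p2 = \<delta> * ((\<zeta> v* q i j) \<bullet> p2) + (?\<zeta> - \<zeta> - \<delta> *\<^sub>R (\<zeta> v* q i j)) \<bullet> p2"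
      by (simp add: inner_diff_left)
    also have "(?\<zeta> - \<zeta> - \<delta> *\<^sub>R (\<zeta> v* q i j)) \<bullet> p2 \<le> C0 * \<delta>\<^sup>2 * norm p2"
      using P2 by (intro order_trans[OF norm_cauchy_schwarz] mult_right_mono) auto
    finally have 1: "(?\<zeta> - \<zeta>) \<bullet> p2 \<le> \<delta> * ((\<zeta> v* q i j) \<bullet> p2) + C0 * \<delta>\<^sup>2 * norm p2" by simp
    have 2: "belief_stage_payoff a b \<zeta> i j \<le> \<delta> * ((\<Sum>z\<in>UNIV. \<zeta> $ z * g z i j) * k a) + C1 * \<delta>\<^sup>2"
      using sp[OF \<zeta> ab(1), of b i j] ab by (auto simp: \<delta>_def abs_le_iff)
    have "ham a \<zeta> p2 i j \<le> ham t \<xi> p2 i j + C2 * ?r + C2 * norm (\<zeta> - \<xi>) * norm p2"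
      by (rule hc[OF ab(1) t \<xi>])
    also have "\<dots> \<le> ham t \<xi> p2 i j + C * ?r + C * ?r * norm p2"
      using C(4) C2 by (intro add_mono mult_right_mono mult_mono) auto
    finally have 3: "\<delta> * ham a \<zeta> p2 i j \<le> \<delta> * (ham t \<xi> p2 i j + C * ?r + C * ?r * norm p2)"
      using \<delta> by (intro mult_left_mono) auto
    have "C1 * \<delta>\<^sup>2 + C0 * \<delta>\<^sup>2 * norm p2 \<le> C * \<delta>\<^sup>2 + C * \<delta>\<^sup>2 * norm p2"
      using C by (intro add_mono mult_right_mono) auto
    then have 4: "C1 * \<delta>\<^sup>2 + C0 * \<delta>\<^sup>2 * norm p2 \<le> \<delta> * (C * \<delta> + C * \<delta> * norm p2)"
      by (simp add: power2_eq_square algebra_simps)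
    have "((b, ?\<zeta>) - (a, \<zeta>)) \<bullet> (p1, p2) = \<delta> * p1 + (?\<zeta> - \<zeta>) \<bullet> p2" by (simp add: \<delta>_def)
    then have "belief_stage_payoff a b \<zeta> i j + ((b, ?\<zeta>) - (a, \<zeta>)) \<bullet> (p1, p2)
        \<le> \<delta> * p1 + \<delta> * ham a \<zeta> p2 i j + (C1 * \<delta>\<^sup>2 + C0 * \<delta>\<^sup>2 * norm p2)"
      using 1 2 unfolding ham_def distrib_left by linarith
    also have "\<dots> \<le> \<delta> * p1 + \<delta> * (ham t \<xi> p2 i j + C * ?r + C * ?r * norm p2) + \<delta> * (C * \<delta> + C * \<delta> * norm p2)"
      using 3 4 by linarith
    also have "\<dots> = \<delta> * (p1 + ham t \<xi> p2 i j + C * (1 + norm p2) * (?r + \<delta>))"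
      by (simp add: algebra_simps)
    finally show "belief_stage_payoff a b \<zeta> i j + ((b, \<zeta> v* P (b - a) i j) - (a, \<zeta>)) \<bullet> (p1, p2)
       \<le> (b - a) * (p1 + ham t \<xi> p2 i j + C * (1 + norm p2) * (\<bar>a - t\<bar> + norm (\<zeta> - \<xi>) + (b - a)))"
      by (simp add: \<delta>_def)
  qed
  moreover have "min h0 h1 > 0" using C0 C1 by simp
  ultimately show ?thesis using C(1) by blast
qed

text \<open>The values \<open>W\<close> are only evaluated at partition times, where the maximum of \<open>W - \<psi>\<close> need
  not be attained; a near maximum up to \<open>\<theta>\<close> times the smallest relevant stage length suffices.\<close>

lemma upper_limit_subsolution:
  fixes W :: "(nat \<Rightarrow> real) \<Rightarrow> nat \<Rightarrow> real ^ 'w \<Rightarrow> real" and u :: "real \<times> (real ^ 'w) \<Rightarrow> real"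
  assumes rec: "\<And>\<pi> n \<zeta>. time_partition \<pi> \<Longrightarrow> \<zeta> \<in> prob_vecs \<Longrightarrow> W \<pi> n \<zeta> = shapley (\<pi> n) (\<pi> (Suc n)) (W \<pi> (Suc n)) \<zeta>"
    and W_cont: "\<And>\<pi> n. time_partition \<pi> \<Longrightarrow> continuous_on prob_vecs (W \<pi> n)"
    and u_cont: "continuous_on time_beliefs u"
    and above: "\<And>K e. compact K \<Longrightarrow> K \<subseteq> time_beliefs \<Longrightarrow> e > 0 \<Longrightarrow>
      eventually (\<lambda>\<pi>. \<forall>p\<in>K. W \<pi> (stage \<pi> (fst p)) (snd p) \<le> u p + e) vanishing_mesh"
    and freq: "\<And>p e. p \<in> time_beliefs \<Longrightarrow> e > 0 \<Longrightarrow>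
      frequently (\<lambda>\<pi>. u p - e \<le> W \<pi> (stage \<pi> (fst p)) (snd p)) vanishing_mesh"
  shows "viscosity_subsolution (hamiltonian g k q) u"
  unfolding viscosity_subsolution_def
proof (intro allI impI)
  fix \<psi> and G :: "real \<times> (real ^ 'w) \<Rightarrow> real \<times> (real ^ 'w)" and t0 :: real and \<xi> :: "real ^ 'w"
  assume \<psi>: "C1_test_function \<psi> G" and max: "strict_max_on time_beliefs (\<lambda>p. u p - \<psi> p) (t0, \<xi>)"
  define p0 where "p0 = (t0, \<xi>)"
  define G1 where "G1 = fst (G p0)" define G2 where "G2 = snd (G p0)"
  have Gp: "G p0 = (G1, G2)" by (simp add: G1_def G2_def)
  have p0: "p0 \<in> time_beliefs" using max by (simp add: strict_max_on_def p0_def)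
  then have t0: "0 \<le> t0" and \<xi>: "\<xi> \<in> prob_vecs" by (auto simp: time_beliefs_def p0_def)
  define m where "m = u p0 - \<psi> p0"
  have strict: "u p - \<psi> p < m" if "p \<in> time_beliefs" "p \<noteq> p0" for p
    using max that by (simp add: strict_max_on_def p0_def m_def)
  then have le_m: "u p - \<psi> p \<le> m" if "p \<in> time_beliefs" for p using that by (cases "p = p0") (auto simp: m_def less_imp_le)
  obtain C h0 where C: "C \<ge> 0" "h0 > 0" and ex: "\<And>a b \<zeta> t \<xi> p1 p2 i j.
     0 \<le> a \<Longrightarrow> a < b \<Longrightarrow> b - a \<le> h0 \<Longrightarrow> \<zeta> \<in> prob_vecs \<Longrightarrow> 0 \<le> t \<Longrightarrow> \<xi> \<in> prob_vecs \<Longrightarrow>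
     norm ((b, \<zeta> v* P (b - a) i j) - (a, \<zeta>)) \<le> C * (b - a) \<and>
     belief_stage_payoff a b \<zeta> i j + ((b, \<zeta> v* P (b - a) i j) - (a, \<zeta>)) \<bullet> (p1, p2)
       \<le> (b - a) * (p1 + ham t \<xi> p2 i j + C * (1 + norm p2) * (\<bar>a - t\<bar> + norm (\<zeta> - \<xi>) + (b - a)))"
    using stage_game_expansion by blast
  \<comment> \<open>Errors in units of \<theta>: three from the distances in time and belief and
    from the stage length, C from the nonlinearity of \<psi> along a step of length at most C *
    \<delta>, and 1 from the near-maximum.\<close>
  define D where "D = C * (1 + norm G2) * 3 + C + 1"
  have D: "D > 0" using C by (auto simp: D_def intro!: add_nonneg_pos mult_nonneg_nonneg)
  have main: "0 \<le> G1 + hamiltonian g k q t0 \<xi> G2 + D * \<theta>" if \<theta>: "\<theta> > 0" for \<theta>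
  proof -
    obtain d where d: "d > 0" and lin: "\<And>x y. x \<in> time_beliefs \<Longrightarrow> y \<in> time_beliefs \<Longrightarrow> dist p0 x \<le> d \<Longrightarrow> dist p0 y \<le> d \<Longrightarrow>
        \<bar>\<psi> x - \<psi> y - (x - y) \<bullet> G p0\<bar> \<le> \<theta> * norm (x - y)"
      using C1_first_order[OF \<psi> p0 \<theta>] by blast
    define r where "r = min d \<theta>"
    have r: "r > 0" "r \<le> d" "r \<le> \<theta>" using d \<theta> by (auto simp: r_def)
    define K where "K = cball p0 r \<inter> time_beliefs"
    have K: "compact K" "K \<subseteq> time_beliefs" unfolding K_def by (auto intro: compact_Int_closed closed_time_beliefs)
    have linK: "\<bar>\<psi> x - \<psi> y - (x - y) \<bullet> G p0\<bar> \<le> \<theta> * norm (x - y)" if "x \<in> K" "y \<in> K" for x y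
      using that r by (intro lin) (auto simp: K_def)
    \<comment> \<open>On the compact shell r / 2 \<le> dist \<le> r strictness leaves a uniform gap.
      Near-maximal points thus lie within r / 2 of the contact point, and their successors after one
      short stage are still in K.\<close>
    obtain \<eta> where \<eta>: "\<eta> > 0" and gap: "\<And>p. p \<in> K \<Longrightarrow> r / 2 \<le> dist p0 p \<Longrightarrow> u p - \<psi> p \<le> m - 3 * \<eta>"
    proof (cases "K - ball p0 (r / 2) = {}")
      case True
      show thesis by (rule that[of 1]) (use True in auto)
    next
      case False
      have "compact (K - ball p0 (r / 2))" by (intro compact_diff K) simp
      moreover have "continuous_on (K - ball p0 (r / 2)) (\<lambda>p. u p - \<psi> p)"
        using K by (intro continuous_intros continuous_on_subset[OF u_cont] continuous_on_subset[OF C1_continuous[OF \<psi>]]) auto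
      ultimately obtain x where x: "x \<in> K - ball p0 (r / 2)" "\<And>p. p \<in> K - ball p0 (r / 2) \<Longrightarrow> u p - \<psi> p \<le> u x - \<psi> x"
        using continuous_attains_sup[OF _ False] by blast
      have "u x - \<psi> x < m" using x(1) K r by (intro strict) auto
      moreover have "3 * ((m - (u x - \<psi> x)) / 3) = m - (u x - \<psi> x)" by simp
      moreover have "u p - \<psi> p \<le> u x - \<psi> x" if "p \<in> K" "r / 2 \<le> dist p0 p" for p
        using that by (intro x(2)) simp
      ultimately show thesis by (intro that[of "(m - (u x - \<psi> x)) / 3"]) (simp, smt (verit))
    qed
    \<comment> \<open>\<open>h0\<close> makes the expansion valid, \<theta> bounds the stage-length
      error, r puts the partition time before t0 into K, the fourth entry keeps successors in K, and
      the last limits the change of \<psi> between t0 and that partition time to \<eta> / 2.\<close>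
    define h where "h = Min {h0, \<theta>, r, r / (2 * (C + 1)), \<eta> / (2 * (\<bar>G1\<bar> + \<theta>))}"
    have G1\<theta>: "\<bar>G1\<bar> + \<theta> > 0" using \<theta> by simp
    have h: "h > 0" "h \<le> h0" "h \<le> \<theta>" "h \<le> r" "h \<le> r / (2 * (C + 1))" "h \<le> \<eta> / (2 * (\<bar>G1\<bar> + \<theta>))"
      using C \<theta> r \<eta> G1\<theta> unfolding h_def by (auto simp: Min_gr_iff)
    have hC: "C * h \<le> r / 2"
    proof -
      have "(C + 1) * h \<le> r / 2" using h(5) C by (simp add: pos_le_divide_eq field_simps)
      then show ?thesis using h(1) by (simp add: distrib_right)
    qed
    have hG: "(\<bar>G1\<bar> + \<theta>) * h \<le> \<eta> / 2" using h(6) G1\<theta> by (simp add: pos_le_divide_eq field_simps)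
    have "\<eta> / 2 > 0" using \<eta> by simp
    \<comment> \<open>Near the upper limit at \<open>p0\<close> the values come only frequently,
      while the bounds on K hold eventually; a single partition with both properties
      suffices.\<close>
    from frequently_eventually_frequently[OF freq[OF p0 this]
        eventually_conj[OF above[OF K \<eta>] eventually_vanishing_mesh[OF h(1)]]]
    obtain \<pi> where f0: "u p0 - \<eta> / 2 \<le> W \<pi> (stage \<pi> t0) \<xi>"
      and ab: "\<And>p. p \<in> K \<Longrightarrow> W \<pi> (stage \<pi> (fst p)) (snd p) \<le> u p + \<eta>"
      and \<pi>: "time_partition \<pi>" and mesh: "\<And>n. \<pi> (Suc n) - \<pi> n < h"
      by (auto simp: p0_def dest!: frequently_ex)
    have step: "\<pi> n < \<pi> (Suc n)" for n using \<pi> by (simp add: time_partition_def strict_mono_less)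
    have stage_grid: "stage \<pi> (\<pi> n) = n" for n
      using \<pi> step[of n] by (intro stage_eq) (auto simp: time_partition_def)
    have grid: "W \<pi> n \<zeta> - \<psi> (\<pi> n, \<zeta>) \<le> u (\<pi> n, \<zeta>) - \<psi> (\<pi> n, \<zeta>) + \<eta>" if "(\<pi> n, \<zeta>) \<in> K" for n \<zeta>
      using ab[OF that] by (simp add: stage_grid)
    let ?E = "{x. \<exists>n \<zeta>. (\<pi> n, \<zeta>) \<in> K \<and> x = W \<pi> n \<zeta> - \<psi> (\<pi> n, \<zeta>)}"
    have bdd: "bdd_above ?E"
    proof (rule bdd_aboveI[of _ "m + \<eta>"])
      fix x assume "x \<in> ?E"
      then obtain n \<zeta> where n: "(\<pi> n, \<zeta>) \<in> K" "x = W \<pi> n \<zeta> - \<psi> (\<pi> n, \<zeta>)" by blast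
      have "(\<pi> n, \<zeta>) \<in> time_beliefs" using n(1) K(2) by blast
      from le_m[OF this] grid[OF n(1)] show "x \<le> m + \<eta>" unfolding n(2) by linarith
    qed
    let ?n0 = "stage \<pi> t0"
    have n0: "\<pi> ?n0 \<le> t0" "t0 - \<pi> ?n0 \<le> h" using stage_bounds[OF \<pi> t0] mesh[of ?n0] by auto
    have dn0: "dist p0 (\<pi> ?n0, \<xi>) = t0 - \<pi> ?n0" using n0 by (simp add: p0_def dist_Pair_Pair dist_real_def)
    have K0: "(\<pi> ?n0, \<xi>) \<in> K"
      using dn0 n0 h(4) time_partition_nonneg[OF \<pi>] \<xi> by (simp add: K_def time_beliefs_def)
    have p0K: "p0 \<in> K" using p0 r by (simp add: K_def)
    have "\<psi> (\<pi> ?n0, \<xi>) - \<psi> p0 \<le> ((\<pi> ?n0, \<xi>) - p0) \<bullet> G p0 + \<theta> * norm ((\<pi> ?n0, \<xi>) - p0)"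
      using linK[OF K0 p0K] by (simp add: abs_le_iff)
    also have "((\<pi> ?n0, \<xi>) - p0) \<bullet> G p0 = (\<pi> ?n0 - t0) * G1" by (subst Gp) (simp add: p0_def)
    also have "\<dots> \<le> h * \<bar>G1\<bar>"
    proof -
      have "\<bar>(\<pi> ?n0 - t0) * G1\<bar> \<le> h * \<bar>G1\<bar>" unfolding abs_mult using n0 by (intro mult_right_mono) auto
      then show ?thesis by simp
    qed
    also have "norm ((\<pi> ?n0, \<xi>) - p0) \<le> h" using dn0 n0 by (simp add: dist_norm norm_minus_commute)
    finally have "\<psi> (\<pi> ?n0, \<xi>) - \<psi> p0 \<le> (\<bar>G1\<bar> + \<theta>) * h" using \<theta> by (simp add: algebra_simps)
    with hG f0 have E0: "W \<pi> ?n0 \<xi> - \<psi> (\<pi> ?n0, \<xi>) \<ge> m - \<eta>" by (simp add: m_def)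
    have "W \<pi> ?n0 \<xi> - \<psi> (\<pi> ?n0, \<xi>) \<in> ?E" using K0 by blast
    then have E_ne: "?E \<noteq> {}" and SupE: "m - \<eta> \<le> Sup ?E" using E0 cSup_upper[OF _ bdd] by (blast, fastforce)
    have "eventually (\<lambda>n. t0 + r < \<pi> n) sequentially" using \<pi> by (simp add: time_partition_def filterlim_at_top_dense)
    then obtain N where N: "t0 + r < \<pi> N" by (auto simp: eventually_sequentially)
    \<comment> \<open>Stage lengths may have infimum 0 over the whole partition, but only stages up
      to \<open>N\<close> meet K, so the relevant minimum is positive.\<close>
    define c where "c = Min ((\<lambda>n. \<pi> (Suc n) - \<pi> n) ` {..N})"
    have c: "c > 0" using step unfolding c_def by (subst Min_gr_iff) auto
    have c_le: "c \<le> \<pi> (Suc n) - \<pi> n" if "n \<le> N" for n unfolding c_def using that by (intro Min_le) auto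
    \<comment> \<open>The slack is fixed before the near-maximal stage is known: it is below
      \<theta> times the length of any relevant stage, and at most \<eta> / 2, so that the shell
      remains excluded.\<close>
    define sl where "sl = min (\<theta> * c) (\<eta> / 2)"
    have sl: "sl > 0" "sl \<le> \<theta> * c" "sl \<le> \<eta> / 2" using c \<theta> \<eta> by (auto simp: sl_def)
    have "Sup ?E - sl < Sup ?E" using sl by simp
    then obtain x where "x \<in> ?E" "Sup ?E - sl < x" using less_cSup_iff[OF E_ne bdd] by blast
    then obtain n \<zeta> where n: "(\<pi> n, \<zeta>) \<in> K" and near: "Sup ?E - sl < W \<pi> n \<zeta> - \<psi> (\<pi> n, \<zeta>)" by blast
    have nT: "(\<pi> n, \<zeta>) \<in> time_beliefs" using n K by blast
    then have \<zeta>: "\<zeta> \<in> prob_vecs" by (simp add: time_beliefs_def)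
    have inner: "dist p0 (\<pi> n, \<zeta>) < r / 2"
    proof (rule ccontr)
      assume "\<not> ?thesis"
      then have "u (\<pi> n, \<zeta>) - \<psi> (\<pi> n, \<zeta>) \<le> m - 3 * \<eta>" by (intro gap n) auto
      with grid[OF n] near SupE sl \<eta> show False by linarith
    qed
    have tn: "\<bar>\<pi> n - t0\<bar> \<le> r" "norm (\<zeta> - \<xi>) \<le> r"
      using inner r dist_fst_le[of p0 "(\<pi> n, \<zeta>)"] dist_snd_le[of p0 "(\<pi> n, \<zeta>)"]
      by (auto simp: p0_def dist_real_def dist_norm norm_minus_commute)
    have "n \<le> N"
    proof (rule ccontr)
      assume "\<not> n \<le> N"
      then have "\<pi> N \<le> \<pi> n" using time_partition_mono[OF \<pi>] by simp
      with N tn show False by linarith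
    qed
    let ?a = "\<pi> n" and ?b = "\<pi> (Suc n)"
    define \<delta> where "\<delta> = ?b - ?a"
    have \<delta>: "\<delta> > 0" "\<delta> \<le> h" using step[of n] mesh[of n] by (auto simp: \<delta>_def)
    have sl\<delta>: "sl \<le> \<theta> * \<delta>" using sl(2) c_le[OF \<open>n \<le> N\<close>] \<theta> by (auto simp: \<delta>_def intro: order_trans mult_left_mono)
    have ab0: "0 \<le> ?a" "?a < ?b" "?b - ?a \<le> h0" using time_partition_nonneg[OF \<pi>] step \<delta> h by (auto simp: \<delta>_def)
    have bound: "belief_stage_payoff ?a ?b \<zeta> i j + W \<pi> (Suc n) (\<zeta> v* P (?b - ?a) i j)
        \<le> (\<delta> * ham t0 \<xi> G2 i j + (W \<pi> n \<zeta> + \<delta> * (G1 + D * \<theta>)))" for i j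
    proof -
      let ?p = "(?a, \<zeta>)" and ?p' = "(?b, \<zeta> v* P (?b - ?a) i j)"
      note e = ex[OF ab0 \<zeta> t0 \<xi>, of i j G1 G2]
      have pT: "?p' \<in> time_beliefs" using ab0 \<zeta> vP_prob[of "?b - ?a" \<zeta> i j] by (simp add: time_beliefs_def)
      have nb: "norm (?p' - ?p) \<le> C * \<delta>" using e by (simp add: \<delta>_def)
      have "C * \<delta> \<le> C * h" using \<delta> C by (intro mult_left_mono) auto
      moreover have "dist ?p ?p' \<le> C * \<delta>" unfolding dist_norm by (subst norm_minus_commute) (rule nb)
      ultimately have "dist p0 ?p' \<le> r" using hC inner dist_triangle[of p0 ?p' ?p] by linarith
      then have K': "?p' \<in> K" using pT by (simp add: K_def)
      have "W \<pi> (Suc n) (\<zeta> v* P (?b - ?a) i j) - \<psi> ?p' \<le> Sup ?E" by (rule cSup_upper[OF _ bdd]) (use K' in blast)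
      moreover have "\<psi> ?p' - \<psi> ?p \<le> (?p' - ?p) \<bullet> (G1, G2) + \<theta> * norm (?p' - ?p)"
        using linK[OF K' n] unfolding Gp by (simp only: abs_le_iff) linarith
      moreover have "\<theta> * norm (?p' - ?p) \<le> \<theta> * (C * \<delta>)" using nb \<theta> by (intro mult_left_mono) auto
      moreover have "\<delta> * (C * (1 + norm G2) * (\<bar>?a - t0\<bar> + norm (\<zeta> - \<xi>) + \<delta>)) \<le> \<delta> * (C * (1 + norm G2) * (\<theta> + \<theta> + \<theta>))"
        using tn \<delta> h r C by (intro mult_left_mono add_mono) auto
      moreover have "belief_stage_payoff ?a ?b \<zeta> i j + (?p' - ?p) \<bullet> (G1, G2)
         \<le> \<delta> * (G1 + ham t0 \<xi> G2 i j) + \<delta> * (C * (1 + norm G2) * (\<bar>?a - t0\<bar> + norm (\<zeta> - \<xi>) + \<delta>))"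
        using e by (simp only: \<delta>_def distrib_left[symmetric])
      moreover have "\<delta> * (C * (1 + norm G2) * (\<theta> + \<theta> + \<theta>)) + \<theta> * (C * \<delta>) + \<theta> * \<delta> = \<delta> * (D * \<theta>)"
        by (simp add: D_def algebra_simps)
      ultimately have "belief_stage_payoff ?a ?b \<zeta> i j + W \<pi> (Suc n) (\<zeta> v* P (?b - ?a) i j)
         \<le> \<delta> * (G1 + ham t0 \<xi> G2 i j) + W \<pi> n \<zeta> + \<delta> * (D * \<theta>)"
        using near sl\<delta> by linarith
      then show ?thesis by (simp add: algebra_simps)
    qed
    note wc = shapley_cont[OF ab0(1) less_imp_le[OF ab0(2)] W_cont[OF \<pi>, of "Suc n"] \<zeta>]
    \<comment> \<open>The same W \<pi> n \<zeta> appears as a constant in the bound of the stage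
      game, hence cancels and leaves the stage length times the desired inequality.\<close>
    have "W \<pi> n \<zeta> = mixed_value (\<lambda>i j. belief_stage_payoff ?a ?b \<zeta> i j + W \<pi> (Suc n) (\<zeta> v* P (?b - ?a) i j))"
      using rec[OF \<pi> \<zeta>, of n] by (simp add: shapley_def)
    also have "\<dots> \<le> mixed_value (\<lambda>i j. \<delta> * ham t0 \<xi> G2 i j + (W \<pi> n \<zeta> + \<delta> * (G1 + D * \<theta>))) + 0"
      by (rule mixed_value_mono[OF wc continuous_affine_Pair[OF ham_cont]]) (use bound in simp)
    also have "\<dots> \<le> \<delta> * mixed_value (ham t0 \<xi> G2) + (W \<pi> n \<zeta> + \<delta> * (G1 + D * \<theta>))"
      using mixed_value_affine_le[OF ham_cont, of \<delta>] \<delta> by simp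
    finally have "0 \<le> \<delta> * (G1 + hamiltonian g k q t0 \<xi> G2 + D * \<theta>)" by (simp add: hamiltonian_eq algebra_simps)
    then show ?thesis using \<delta>(1) by (simp add: zero_le_mult_iff)
  qed
  show "0 \<le> fst (G (t0, \<xi>)) + hamiltonian g k q t0 \<xi> (snd (G (t0, \<xi>)))"
  proof (rule field_le_epsilon)
    fix e :: real assume "e > 0"
    with main[of "e / D"] D show "0 \<le> fst (G (t0, \<xi>)) + hamiltonian g k q t0 \<xi> (snd (G (t0, \<xi>))) + e"
      by (simp add: G1_def G2_def p0_def)
  qed
qed

end

section \<open>Exchanging the players\<close>

context unobserved_game
begin

text \<open>The game with exchanged roles and negated payoff satisfies the same hypotheses, so every
  result of the locale is available for it.\<close>

lemma swap_players: "unobserved_game (\<lambda>z j i. - g z i j) k (\<lambda>j i. q i j)"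
proof
  show "continuous_on UNIV (\<lambda>(j, i). - g z i j)" for z by (rule continuous_swap_uminus[OF g_cont])
  have "range (\<lambda>(j, i). q i j) = range (\<lambda>(i, j). q i j)" by (auto simp: image_def)
  moreover have "continuous_on UNIV (\<lambda>p :: 'j \<times> 'i. (\<lambda>(i, j). q i j) (snd p, fst p))"
    by (intro continuous_on_compose2[OF q_cont] continuous_intros) auto
  ultimately show "transition_rate (\<lambda>j i. q i j)"
    using q_rate by (auto simp: transition_rate_def case_prod_beta')
qed (fact k_nonneg k_lipschitz k_integrable k_density)+

lemma swap_belief_stage_payoff:
  "unobserved_game.belief_stage_payoff (\<lambda>z j i. - g z i j) k (\<lambda>j i. q i j) a b \<zeta> j i = - belief_stage_payoff a b \<zeta> i j"
proof -
  interpret sw: unobserved_game "\<lambda>z j i. - g z i j" k "\<lambda>j i. q i j" by (rule swap_players)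
  have "sw.flow_payoff h z j i = - flow_payoff h z i j" for h z
    by (simp add: sw.flow_payoff_def flow_payoff_def trans_prob_def sum_negf)
  then have "sw.stage_payoff a b z j i = - stage_payoff a b z i j" for z
    by (simp add: sw.stage_payoff_def stage_payoff_def set_lebesgue_integral_def)
  then show ?thesis by (simp add: sw.belief_stage_payoff_def belief_stage_payoff_def sum_negf)
qed

text \<open>Only the recursion is transported to the exchanged game, not its strategies:
  \<open>upper_limit_subsolution\<close> accepts any continuous solution of the recursion with
  suitable limits, and minus \<open>V_grid\<close> is one.\<close>

lemma swap_shapley:
  assumes "0 \<le> a" "a \<le> b" "continuous_on prob_vecs w" "\<zeta> \<in> prob_vecs"
  shows "unobserved_game.shapley (\<lambda>z j i. - g z i j) k (\<lambda>j i. q i j) a b (\<lambda>\<zeta>. - w \<zeta>) \<zeta> = - shapley a b w \<zeta>"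
proof -
  interpret sw: unobserved_game "\<lambda>z j i. - g z i j" k "\<lambda>j i. q i j" by (rule swap_players)
  show ?thesis
    using mixed_value_swap[OF shapley_cont[OF assms]]
    by (simp add: sw.shapley_def shapley_def swap_belief_stage_payoff trans_prob_def)
qed

text \<open>The sign of \<open>p\<close> changes as well, since it stands for the gradient of the
  negated function.\<close>

lemma swap_hamiltonian:
  "hamiltonian (\<lambda>z j i. - g z i j) k (\<lambda>j i. q i j) t \<zeta> p = - hamiltonian g k q t \<zeta> (- p)"
proof -
  interpret sw: unobserved_game "\<lambda>z j i. - g z i j" k "\<lambda>j i. q i j" by (rule swap_players)
  have "sw.ham t \<zeta> p j i = - ham t \<zeta> (- p) i j" for i j by (simp add: sw.ham_def ham_def sum_negf)
  then have "sw.ham t \<zeta> p = (\<lambda>j i. - ham t \<zeta> (- p) i j)" by (intro ext)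
  then show ?thesis using mixed_value_swap[OF ham_cont] by (simp add: sw.hamiltonian_eq hamiltonian_eq)
qed

lemma swap_supersolution:
  assumes "viscosity_subsolution (hamiltonian (\<lambda>z j i. - g z i j) k (\<lambda>j i. q i j)) u"
  shows "viscosity_supersolution (hamiltonian g k q) (\<lambda>p. - u p)"
  unfolding viscosity_supersolution_def
proof (intro allI impI)
  fix \<psi> and G :: "real \<times> (real ^ 'w) \<Rightarrow> real \<times> (real ^ 'w)" and t \<zeta>
  assume \<psi>: "C1_test_function \<psi> G" and min: "strict_min_on time_beliefs (\<lambda>p. - u p - \<psi> p) (t, \<zeta>)"
  have "C1_test_function (\<lambda>p. - \<psi> p) (\<lambda>p. - G p)"
    using \<psi> unfolding C1_test_function_def gderiv_def
    by (auto intro!: continuous_on_minus has_derivative_minus)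
  moreover have "strict_max_on time_beliefs (\<lambda>p. u p - - \<psi> p) (t, \<zeta>)"
    using min by (auto simp: strict_max_on_def strict_min_on_def)
  ultimately have "0 \<le> fst (- G (t, \<zeta>)) + hamiltonian (\<lambda>z j i. - g z i j) k (\<lambda>j i. q i j) t \<zeta> (snd (- G (t, \<zeta>)))"
    using assms unfolding viscosity_subsolution_def by blast
  then show "fst (G (t, \<zeta>)) + hamiltonian g k q t \<zeta> (snd (G (t, \<zeta>))) \<le> 0" by (simp add: swap_hamiltonian)
qed

section \<open>Convergence\<close>

lemma values_converge:
  "\<exists>V. viscosity_solution (hamiltonian g k q) V \<and> vanishes_at_infinity V \<and>
    (\<forall>u. viscosity_solution (hamiltonian g k q) u \<and> vanishes_at_infinity u \<longrightarrow> (\<forall>p\<in>time_beliefs. u p = V p)) \<and>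
    (\<forall>K. compact K \<and> K \<subseteq> time_beliefs \<longrightarrow> uniform_limit K (V_part g k q) V vanishing_mesh)"
proof -
  let ?H = "hamiltonian g k q"
  obtain L where L: "L \<ge> 0" and est: "\<And>e. e > 0 \<Longrightarrow> eventually (\<lambda>\<pi>.
     (\<forall>p\<in>time_beliefs. \<forall>r\<in>time_beliefs. \<bar>grid_value \<pi> p - grid_value \<pi> r\<bar> \<le> L * dist p r + e) \<and>
     (\<forall>p\<in>time_beliefs. \<bar>V_part g k q \<pi> p - grid_value \<pi> p\<bar> \<le> e) \<and>
     (\<forall>p\<in>time_beliefs. \<bar>grid_value \<pi> p\<bar> \<le> M * tail (max 0 (fst p - 1)))) vanishing_mesh"
    using grid_value_estimates by blast
  have lip: "eventually (\<lambda>\<pi>. \<forall>p\<in>time_beliefs. \<forall>r\<in>time_beliefs. \<bar>grid_value \<pi> p - grid_value \<pi> r\<bar> \<le> L * dist p r + e) vanishing_mesh"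
    if "e > 0" for e using est[OF that] by (rule eventually_mono) blast
  have bnd: "eventually (\<lambda>\<pi>. \<bar>grid_value \<pi> p\<bar> \<le> M * tail (max 0 (fst p - 1))) vanishing_mesh" if "p \<in> time_beliefs" for p
    using est[OF zero_less_one] by (rule eventually_mono) (use that in blast)
  have bndM: "eventually (\<lambda>\<pi>. \<bar>grid_value \<pi> p\<bar> \<le> M) vanishing_mesh" if "p \<in> time_beliefs" for p
  proof -
    have "M * tail (max 0 (fst p - 1)) \<le> M" using mult_left_le[OF tail_le_1 M(1)] by simp
    with bnd[OF that] show ?thesis by (auto elim: eventually_mono)
  qed
  interpret up: equicontinuous_family vanishing_mesh grid_value time_beliefs L M
    by unfold_locales (fact vanishing_mesh_nontrivial L bndM lip)+
  interpret dn: equicontinuous_family vanishing_mesh "\<lambda>\<pi> p. - grid_value \<pi> p" time_beliefs L M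
  proof
    show "eventually (\<lambda>\<pi>. \<bar>- grid_value \<pi> p\<bar> \<le> M) vanishing_mesh" if "p \<in> time_beliefs" for p
      using bndM[OF that] by simp
    show "eventually (\<lambda>\<pi>. \<forall>p\<in>time_beliefs. \<forall>r\<in>time_beliefs. \<bar>- grid_value \<pi> p - - grid_value \<pi> r\<bar> \<le> L * dist p r + e) vanishing_mesh"
      if "e > 0" for e using lip[OF that] by (rule eventually_mono) (simp add: abs_minus_commute)
  qed (fact vanishing_mesh_nontrivial L)+
  \<comment> \<open>The lower limit of the values, as minus the upper limit of their
    negatives.\<close>
  define lo where "lo p = - dn.u p" for p
  have up_cont: "continuous_on time_beliefs up.u" by (rule up.upper_limit_continuous)
  have lo_cont: "continuous_on time_beliefs lo"
    unfolding lo_def[abs_def] by (intro continuous_on_minus dn.upper_limit_continuous)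
  have vanish: "\<bar>up.u p\<bar> \<le> M * tail (max 0 (fst p - 1))" "\<bar>lo p\<bar> \<le> M * tail (max 0 (fst p - 1))" if "p \<in> time_beliefs" for p
  proof -
    let ?B = "M * tail (max 0 (fst p - 1))"
    have b: "eventually (\<lambda>\<pi>. grid_value \<pi> p \<le> ?B) vanishing_mesh" "eventually (\<lambda>\<pi>. - ?B \<le> grid_value \<pi> p) vanishing_mesh"
      "eventually (\<lambda>\<pi>. - grid_value \<pi> p \<le> ?B) vanishing_mesh" "eventually (\<lambda>\<pi>. - ?B \<le> - grid_value \<pi> p) vanishing_mesh"
      using bnd[OF that] by (auto elim!: eventually_mono)
    show "\<bar>up.u p\<bar> \<le> ?B" using up.upper_limit_le[OF that b(1)] up.upper_limit_ge[OF that b(2)] by simp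
    show "\<bar>lo p\<bar> \<le> ?B" using dn.upper_limit_le[OF that b(3)] dn.upper_limit_ge[OF that b(4)] by (simp add: lo_def)
  qed
  have vanishing: "vanishes_at_infinity v" if v: "\<And>p. p \<in> time_beliefs \<Longrightarrow> \<bar>v p\<bar> \<le> M * tail (max 0 (fst p - 1))"
    for v :: "real \<times> (real ^ 'w) \<Rightarrow> real"
    unfolding vanishes_at_infinity_def
  proof (intro allI impI)
    fix e :: real assume e: "e > 0"
    have "(\<lambda>n. M * tail (real n)) \<longlonglongrightarrow> 0"
      using tendsto_mult_left[OF tail_tendsto[OF filterlim_real_sequentially], of M] by simp
    then obtain n where "\<bar>M * tail (real n)\<bar> < e" using LIMSEQ_D[of _ 0 e] e by fastforce
    then have n: "M * tail (real n) < e" by simp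
    have "\<bar>v (t, \<zeta>)\<bar> \<le> e" if "t \<ge> real n + 1" "\<zeta> \<in> prob_vecs" for t \<zeta>
    proof -
      have "\<bar>v (t, \<zeta>)\<bar> \<le> M * tail (max 0 (t - 1))" using v[of "(t, \<zeta>)"] that by (simp add: time_beliefs_def)
      also have "\<dots> \<le> M * tail (real n)" using that M(1) by (intro mult_left_mono tail_antimono) auto
      finally show ?thesis using n by simp
    qed
    then show "\<exists>T\<ge>0. \<forall>t\<ge>T. \<forall>\<zeta>\<in>prob_vecs. \<bar>v (t, \<zeta>)\<bar> \<le> e" by (intro exI[of _ "real n + 1"]) auto
  qed
  have up_sub: "viscosity_subsolution ?H up.u"
  proof (rule upper_limit_subsolution[where W = "V_grid g k q"])
    show "eventually (\<lambda>\<pi>. \<forall>p\<in>K. V_grid g k q \<pi> (stage \<pi> (fst p)) (snd p) \<le> up.u p + e) vanishing_mesh"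
      if "compact K" "K \<subseteq> time_beliefs" "e > 0" for K e
      using up.eventually_le_upper_limit_compact[OF that] by (simp add: grid_value_def)
    show "frequently (\<lambda>\<pi>. up.u p - e \<le> V_grid g k q \<pi> (stage \<pi> (fst p)) (snd p)) vanishing_mesh"
      if "p \<in> time_beliefs" "e > 0" for p e
      using up.frequently_ge_upper_limit[OF that] by (simp add: grid_value_def)
  qed (rule partition_value(4) l1_lipschitz_continuous[OF partition_value(2)] up_cont; assumption)+
  have lo_super: "viscosity_supersolution ?H lo"
    unfolding lo_def[abs_def]
  proof (rule swap_supersolution)
    interpret sw: unobserved_game "\<lambda>z j i. - g z i j" k "\<lambda>j i. q i j" by (rule swap_players)
    show "viscosity_subsolution (hamiltonian (\<lambda>z j i. - g z i j) k (\<lambda>j i. q i j)) dn.u"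
    proof (rule sw.upper_limit_subsolution[where W = "\<lambda>\<pi> n \<zeta>. - V_grid g k q \<pi> n \<zeta>"])
      fix \<pi> n and \<zeta> :: "real ^ 'w" assume \<pi>: "time_partition \<pi>" and \<zeta>: "\<zeta> \<in> prob_vecs"
      show "- V_grid g k q \<pi> n \<zeta> = sw.shapley (\<pi> n) (\<pi> (Suc n)) (\<lambda>\<zeta>. - V_grid g k q \<pi> (Suc n) \<zeta>) \<zeta>"
        using swap_shapley[OF time_partition_nonneg[OF \<pi>] time_partition_mono[OF \<pi>]
            l1_lipschitz_continuous[OF partition_value(2)[OF \<pi>]] \<zeta>, of n "Suc n" "Suc n"]
          partition_value(4)[OF \<pi> \<zeta>, of n] by simp
    next
      fix \<pi> n assume "time_partition \<pi>"
      then show "continuous_on prob_vecs (\<lambda>\<zeta>. - V_grid g k q \<pi> n \<zeta>)"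
        by (intro continuous_on_minus l1_lipschitz_continuous[OF partition_value(2)])
    next
      show "continuous_on time_beliefs dn.u" by (rule dn.upper_limit_continuous)
    next
      show "eventually (\<lambda>\<pi>. \<forall>p\<in>K. - V_grid g k q \<pi> (stage \<pi> (fst p)) (snd p) \<le> dn.u p + e) vanishing_mesh"
        if "compact K" "K \<subseteq> time_beliefs" "e > 0" for K e
        using dn.eventually_le_upper_limit_compact[OF that] by (simp add: grid_value_def)
      show "frequently (\<lambda>\<pi>. dn.u p - e \<le> - V_grid g k q \<pi> (stage \<pi> (fst p)) (snd p)) vanishing_mesh"
        if "p \<in> time_beliefs" "e > 0" for p e
        using dn.frequently_ge_upper_limit[OF that] by (simp add: grid_value_def)
    qed
  qed
  obtain C where C: "C \<ge> 0" and HC: "\<And>t s \<zeta> \<xi> p. t \<ge> 0 \<Longrightarrow> s \<ge> 0 \<Longrightarrow> \<zeta> \<in> prob_vecs \<Longrightarrow> \<xi> \<in> prob_vecs \<Longrightarrow>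
     ?H t \<zeta> p - ?H s \<xi> p \<le> C * (\<bar>t - s\<bar> + norm (\<zeta> - \<xi>)) + C * norm (\<zeta> - \<xi>) * norm p"
    using hamiltonian_continuity by blast
  note comparison = viscosity_comparison[OF _ _ _ _ _ _ C HC]
  note up_van = vanishing[OF vanish(1)] and lo_van = vanishing[OF vanish(2)]
  have eq: "lo p = up.u p" if p: "p \<in> time_beliefs" for p
  proof (rule order_antisym)
    show "up.u p \<le> lo p" by (rule comparison[OF up_cont up_van up_sub lo_cont lo_van lo_super _ _ _ _ p])
    \<comment> \<open>The direction without comparison: along a nontrivial filter some partition
      satisfies both one-sided bounds.\<close>
    show "lo p \<le> up.u p"
    proof (rule field_le_epsilon)
      fix e :: real assume "e > 0"
      then have e: "e / 2 > 0" by simp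
      have "eventually (\<lambda>\<pi>. lo p \<le> up.u p + e) vanishing_mesh"
        using up.eventually_le_upper_limit[OF p e] dn.eventually_le_upper_limit[OF p e]
        by eventually_elim (simp add: lo_def)
      then show "lo p \<le> up.u p + e" using vanishing_mesh_nontrivial by (simp add: eventually_const_iff)
    qed
  qed
  \<comment> \<open>\<open>lo\<close> and the upper limit are known to agree on
    \<open>time_beliefs\<close> only, which is all that \<open>strict_min_on\<close>
    inspects.\<close>
  have up_super: "viscosity_supersolution ?H up.u"
  proof -
    have "strict_min_on time_beliefs (\<lambda>p. up.u p - \<psi> p) r \<longleftrightarrow> strict_min_on time_beliefs (\<lambda>p. lo p - \<psi> p) r" for \<psi> r
      unfolding strict_min_on_def by (auto simp: eq)
    with lo_super show ?thesis unfolding viscosity_supersolution_def by simp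
  qed
  show ?thesis
  proof (intro exI[of _ up.u] conjI allI impI ballI)
    show "viscosity_solution ?H up.u" using up_cont up_sub up_super by (simp add: viscosity_solution_iff)
    show "vanishes_at_infinity up.u" by (rule up_van)
    show "v p = up.u p" if "viscosity_solution ?H v \<and> vanishes_at_infinity v" and p: "p \<in> time_beliefs" for v p
    proof (rule order_antisym)
      have v: "continuous_on time_beliefs v" "vanishes_at_infinity v" "viscosity_subsolution ?H v" "viscosity_supersolution ?H v"
        using that(1) by (auto simp: viscosity_solution_iff)
      show "v p \<le> up.u p" by (rule comparison[OF v(1-3) up_cont up_van up_super _ _ _ _ p])
      show "up.u p \<le> v p" by (rule comparison[OF up_cont up_van up_sub v(1,2,4) _ _ _ _ p])
    qed
    fix K :: "(real \<times> (real ^ 'w)) set" assume "compact K \<and> K \<subseteq> time_beliefs"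
    then have K: "compact K" "K \<subseteq> time_beliefs" by auto
    show "uniform_limit K (V_part g k q) up.u vanishing_mesh"
      unfolding uniform_limit_iff
    proof (intro allI impI)
      fix e :: real assume "e > 0"
      then have e: "e / 4 > 0" by simp
      from up.eventually_le_upper_limit_compact[OF K e] dn.eventually_le_upper_limit_compact[OF K e] est[OF e]
      show "eventually (\<lambda>\<pi>. \<forall>p\<in>K. dist (V_part g k q \<pi> p) (up.u p) < e) vanishing_mesh"
      proof eventually_elim
        case (elim \<pi>)
        show ?case
        proof
          fix p assume p: "p \<in> K"
          have "grid_value \<pi> p \<le> up.u p + e / 4" "- grid_value \<pi> p \<le> dn.u p + e / 4"
            "\<bar>V_part g k q \<pi> p - grid_value \<pi> p\<bar> \<le> e / 4" "dn.u p = - up.u p"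
            using elim p K(2) eq[of p] by (auto simp: lo_def)
          then show "dist (V_part g k q \<pi> p) (up.u p) < e" using e unfolding dist_real_def by linarith
        qed
      qed
    qed
  qed
qed

end

text \<open>\<open>game_value\<close> is a definite description, meaningful where a value exists;
  the first two conjuncts assert this existence for the games behind \<open>V_part\<close> and
  \<open>hamiltonian\<close>.\<close>

theorem proposition4p3:
  fixes g :: "'w::finite \<Rightarrow> 'i::compact_metric_space \<Rightarrow> 'j::compact_metric_space \<Rightarrow> real"
    and k :: "real \<Rightarrow> real"
    and q :: "'i \<Rightarrow> 'j \<Rightarrow> real ^ 'w ^ 'w"
  assumes g_cont: "\<And>z. continuous_on UNIV (\<lambda>(i, j). g z i j)"
    and k_nonneg: "\<And>t. t \<ge> 0 \<Longrightarrow> k t \<ge> 0"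
    and k_lipschitz: "\<exists>L. L-lipschitz_on {0..} k"
    and k_integrable: "set_integrable lborel {0..} k"
    and k_density: "(LINT t:{0..}|lborel. k t) = 1"
    and q_rate: "transition_rate q"
  shows
    "(\<forall>\<pi> n. \<forall>\<zeta>\<in>prob_vecs. time_partition \<pi> \<longrightarrow>
        (\<exists>v. is_value strategies strategies (payoff_from g k q \<pi> n \<zeta>) v)) \<and>
     (\<forall>t\<ge>0. \<forall>\<zeta>\<in>prob_vecs. \<forall>p.
        \<exists>v. is_value regular_probs regular_probs (hamiltonian_payoff g k q t \<zeta> p) v) \<and>
     (\<exists>V. viscosity_solution (hamiltonian g k q) V \<and> vanishes_at_infinity V \<and>
        (\<forall>u. viscosity_solution (hamiltonian g k q) u \<and> vanishes_at_infinity u \<longrightarrow>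
           (\<forall>p\<in>time_beliefs. u p = V p)) \<and>
        (\<forall>K. compact K \<and> K \<subseteq> time_beliefs \<longrightarrow>
           uniform_limit K (V_part g k q) V vanishing_mesh))"
proof -
  interpret unobserved_game g k q by unfold_locales (fact assms)+
  have "\<exists>v. is_value strategies strategies (payoff_from g k q \<pi> n \<zeta>) v"
    if "time_partition \<pi>" "\<zeta> \<in> prob_vecs" for \<pi> n \<zeta>
    using partition_value(1)[OF that] by (rule exI)
  moreover have "\<exists>v. is_value regular_probs regular_probs (hamiltonian_payoff g k q t \<zeta> p) v" for t \<zeta> p
    using hamiltonian_value by (rule exI)
  ultimately show ?thesis by (intro conjI allI ballI impI values_converge) simp_all
qed

end
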